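(* Let $k\ge1$ be an integer and let $\gamma\colon[a,b]\to\mathbf{R}^{2+k}$ be a rectifiable curve with length $L$, width $w$ and inradius $r$. Then $$L\geq\sqrt{2.2782^2+9k}\;w\quad\text{and}\quad L\geq\sqrt{(\pi+2)^2+36k}\;r.$$ Further, if $\gamma$ is closed, then $$L\geq\sqrt{\pi^2+16k}\;w\quad\text{and}\quad L\geq\sqrt{(6\sqrt3)^2+64(k-1)}\;r.$$
   Context: The width $w$ of $\gamma$ is the infimum of the distances between pairs of parallel hyperplanes of $\mathbf{R}^{2+k}$ between which $\gamma$ lies. The inradius $r$ of $\gamma$ is the supremum of the radii of all spheres which are contained in the convex hull of $\gamma$ and are disjoint from $\gamma$. *)

theory Defs
  imports "HOL-Analysis.Analysis"
begin

definition polygon_sums :: "(real \<Rightarrow> 'a::metric_space) \<Rightarrow> real \<Rightarrow> real \<Rightarrow> real set" where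
  "polygon_sums \<gamma> a b = {(\<Sum>i<n. dist (\<gamma> (t i)) (\<gamma> (t (Suc i)))) | n t.
      t 0 = a \<and> t n = b \<and> (\<forall>i<n. t i \<le> t (Suc i))}"

definition rectifiable_curve :: "(real \<Rightarrow> 'a::metric_space) \<Rightarrow> real \<Rightarrow> real \<Rightarrow> bool" where
  "rectifiable_curve \<gamma> a b \<longleftrightarrow> a < b \<and> continuous_on {a..b} \<gamma> \<and> bdd_above (polygon_sums \<gamma> a b)"

definition curve_length :: "(real \<Rightarrow> 'a::metric_space) \<Rightarrow> real \<Rightarrow> real \<Rightarrow> real" where
  "curve_length \<gamma> a b = Sup (polygon_sums \<gamma> a b)"

text \<open>Width: infimum of distances between pairs of parallel hyperplanes
  {x. u \<bullet> x = c1}, {x. u \<bullet> x = c2} (u a unit normal) between which the curve lies.\<close>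
definition curve_width :: "(real \<Rightarrow> 'a::euclidean_space) \<Rightarrow> real \<Rightarrow> real \<Rightarrow> real" where
  "curve_width \<gamma> a b = Inf {c2 - c1 | u c1 c2. norm u = 1 \<and>
      (\<forall>t\<in>{a..b}. c1 \<le> u \<bullet> \<gamma> t \<and> u \<bullet> \<gamma> t \<le> c2)}"

text \<open>Inradius: supremum of radii of spheres contained in the convex hull of the curve
  and disjoint from the curve (0 if there is no such sphere of positive radius).\<close>
definition curve_inradius :: "(real \<Rightarrow> 'a::euclidean_space) \<Rightarrow> real \<Rightarrow> real \<Rightarrow> real" where
  "curve_inradius \<gamma> a b = Sup ({0} \<union> {\<rho>. \<rho> > 0 \<and> (\<exists>x. sphere x \<rho> \<subseteq> convex hull (\<gamma> ` {a..b})
      \<and> sphere x \<rho> \<inter> \<gamma> ` {a..b} = {})})"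

end

theory Submission
  imports Defs
begin

text \<open>
  Replacing the curve by an inscribed polygon, both width and inradius become statements about the
  extent of the vertices in each direction. By Borsuk--Ulam, in dimension at least three there is
  a direction in which the maximum and minimum of the vertices are attained alternately four times
  along the polygon; so the projection to that direction has length at least \<open>3 * W\<close> (\<open>4 * W\<close> if
  closed), where \<open>W\<close> is the width (at least \<open>2 * r\<close>). As \<open>L\<^sup>2\<close> dominates the sum of the squared lengths of
  the projections to the line and to its orthogonal complement, every removed dimension contributes
  \<open>9 * W\<^sup>2\<close> or \<open>16 * W\<^sup>2\<close>. It remains to treat the plane, and space for the inradius of closed curves.

  The planar width bounds are integral-geometric: the length is an average (for open curves a finite
  weighted sum) of lengths of projections to lines. For the inradius, the polygon has to see every point of the
  unit sphere (\<open>u\<close> is seen from \<open>x\<close> if \<open>1 \<le> u \<bullet> x\<close>), and as each point is also unseen from some vertex, the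
  measures of the symmetric differences of the caps seen from consecutive vertices add up
  to at least twice the measure of the sphere in the closed case, up to endpoint terms otherwise. Deleting vertices whose cap is
  contained in that of a neighbour, each edge meets the ball or lies on a line outside it, and the change of the
  cap along such an edge is bounded by its length.
\<close>

section \<open>Directions with alternating extrema\<close>

text \<open>Pruning is forced by radial motion. When a point leaves the unit sphere along a ray, its
  cap grows at an unbounded rate in the plane and, in space, faster than the rate
  \<open>4 * pi / (3 * sqrt 3)\<close> needed for the bound, so the change of the cap cannot be
  controlled by the length of every edge. Such edges join nested caps. An unnested edge through the
  ball is at least as long as the two tangents from its ends; on a line missing the ball, growth and
  sideways motion of the cap can be bounded together.

  The constants record critical positions. An open planar curve loses the caps of its ends, and an
  end costs least at distance \<open>sqrt 2\<close>, where the tangent has length 1; this gives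
  \<open>pi / 2 + 1\<close> per end. In space the rate bound is sharp in the estimate at distance
  \<open>sqrt (3 / 2)\<close>, moving along a tangent; twice the area of the sphere divided by the
  rate is \<open>6 * sqrt 3\<close>. For closed curves it pays to stop the reduction in space: the
  planar constant \<open>2 * pi\<close> would yield only \<open>4 * pi\<^sup>2 + 64 < 108\<close>
  there.\<close>

text \<open>Borsuk-Ulam for the 2-sphere, by lifting. \<open>h\<close> maps the unit disc to the
  upper hemisphere; without a zero of \<open>f\<close>, the map \<open>f \<circ> h\<close> has a
  continuous logarithm \<open>g\<close> on the disc. On the boundary circle
  \<open>k z = g (- z) - g z\<close> satisfies \<open>exp (k z) = -1\<close>, so its values are
  discrete and it is constant; being odd, it is 0, which is no logarithm of -1.\<close>

lemma antipodal_zero: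
  fixes f :: "real^3 \<Rightarrow> complex"
  assumes cont: "continuous_on (sphere 0 1) f"
    and odd: "\<And>x. norm x = 1 \<Longrightarrow> f (- x) = - f x"
  shows "\<exists>x. norm x = 1 \<and> f x = 0"
proof (rule ccontr)
  assume "\<not> ?thesis"
  then have nz: "\<And>x. norm x = 1 \<Longrightarrow> f x \<noteq> 0" by blast
  define h :: "complex \<Rightarrow> real^3" where
    "h z = (\<chi> i. if i = 1 then Re z else if i = 2 then Im z else sqrt (1 - (norm z)\<^sup>2))" for z
  have norm_h: "norm (h z) = 1" if "norm z \<le> 1" for z
  proof -
    have "(norm z)\<^sup>2 \<le> 1" using that by (simp add: power_le_one)
    then show ?thesis
      by (simp add: h_def norm_vec_def L2_set_def sum_3 cmod_power2)
  qed
  have cont_h: "continuous_on (cball 0 1) h"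
    unfolding h_def
  proof (rule continuous_on_vec_lambda)
    fix i :: 3
    show "continuous_on (cball 0 1)
        (\<lambda>z :: complex. if i = 1 then Re z else if i = 2 then Im z else sqrt (1 - (norm z)\<^sup>2))"
      by (cases "i = 1"; cases "i = 2") (auto intro!: continuous_intros)
  qed
  have cont_fh: "continuous_on (cball 0 1) (f \<circ> h)"
    by (rule continuous_on_compose[OF cont_h])
      (rule continuous_on_subset[OF cont], auto simp: norm_h)
  have "\<And>z. z \<in> cball 0 1 \<Longrightarrow> (f \<circ> h) z \<noteq> 0"
    using nz norm_h by auto
  then obtain g where cont_g: "continuous_on (cball 0 1) g"
    and g: "\<And>z. z \<in> cball 0 1 \<Longrightarrow> (f \<circ> h) z = exp (g z)"
    using continuous_logarithm_on_cball[OF cont_fh] by metis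
  define k where "k z = g (- z) - g z" for z
  have cont_k: "continuous_on (sphere 0 1) k"
    unfolding k_def
    by (intro continuous_intros continuous_on_compose2[OF cont_g]) auto
  have h_minus: "h (- z) = - h z" if "norm z = 1" for z
    using that by (simp add: h_def vec_eq_iff)
  have exp_k: "exp (k z) = -1" if "norm z = 1" for z
  proof -
    have "exp (g (- z)) = - exp (g z)"
      using g[of z] g[of "- z"] that odd[OF norm_h[of z]] h_minus[of z] by simp
    then show ?thesis by (simp add: k_def exp_diff)
  qed
  have "k constant_on sphere 0 1"
  proof (rule continuous_discrete_range_constant[OF connected_sphere cont_k])
    fix z :: complex assume z: "z \<in> sphere 0 1"
    show "\<exists>e>0. \<forall>y. y \<in> sphere 0 1 \<and> k y \<noteq> k z \<longrightarrow> e \<le> norm (k y - k z)"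
    proof (intro exI[of _ "2 * pi"] conjI allI impI)
      fix y assume y: "y \<in> sphere 0 1 \<and> k y \<noteq> k z"
      have "exp (k y) = exp (k z)" using y z exp_k by simp
      then obtain n :: int where n: "k y = k z + (of_int (2 * n) * pi) * \<i>"
        by (auto simp: exp_eq)
      with y have "n \<noteq> 0" by auto
      then have "1 \<le> \<bar>real_of_int n\<bar>" by linarith
      then have "2 * pi * 1 \<le> 2 * pi * \<bar>real_of_int n\<bar>" by (intro mult_left_mono) auto
      then show "2 * pi \<le> norm (k y - k z)"
        by (simp add: n norm_mult abs_mult)
    qed simp
  qed simp
  then have "k (-1) = k 1"
    by (auto simp: constant_on_def)
  then have "k 1 = 0" by (simp add: k_def)
  then show False using exp_k[of 1] by simp
qed

lemma infdist_uminus: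
  fixes A :: "'a::real_normed_vector set"
  shows "infdist (- x) (uminus ` A) = infdist x A"
proof -
  have "infdist (- x) (uminus ` A) = (if A = {} then 0 else INF a\<in>A. dist (- x) (- a))"
    by (simp add: infdist_def image_image)
  also have "\<dots> = infdist x A"
    by (simp add: infdist_def dist_minus)
  finally show ?thesis .
qed

text \<open>Borsuk--Ulam, applied to the distances from the directions in which the extrema alternate max, min, max
  and max, min to their antipodal sets.\<close>

lemma alternating_extrema:
  fixes z :: "nat \<Rightarrow> real^3" and m :: nat
  defines "mx \<equiv> \<lambda>u i. \<forall>j\<le>m. u \<bullet> z j \<le> u \<bullet> z i"
  shows "\<exists>u i1 i2 i3 i4. norm u = 1 \<and> i1 \<le> i2 \<and> i2 \<le> i3 \<and> i3 \<le> i4 \<and> i4 \<le> m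
           \<and> mx u i1 \<and> mx (- u) i2 \<and> mx u i3 \<and> mx (- u) i4"
proof -
  define I where "I = {(i1, i2, i3). i1 \<le> i2 \<and> i2 \<le> i3 \<and> i3 \<le> m}"
  define J where "J = {(i1, i2). i1 \<le> i2 \<and> i2 \<le> m}"
  define A where "A = (\<Union>(i1, i2, i3)\<in>I. {u. norm u = 1 \<and> mx u i1 \<and> mx (- u) i2 \<and> mx u i3})"
  define B where "B = (\<Union>(i1, i2)\<in>J. {u. norm u = 1 \<and> mx u i1 \<and> mx (- u) i2})"
  have "I \<subseteq> {..m} \<times> {..m} \<times> {..m}" "J \<subseteq> {..m} \<times> {..m}"
    by (auto simp: I_def J_def)
  then have fin: "finite I" "finite J"
    by (meson finite_SigmaI finite_atMost finite_subset)+
  let ?S = "\<lambda>F :: (real^3) set. \<lambda>u. infdist u (uminus ` F) - infdist u F"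
  have A: "u \<in> A \<longleftrightarrow> norm u = 1 \<and> (\<exists>i1 i2 i3. i1 \<le> i2 \<and> i2 \<le> i3 \<and> i3 \<le> m
      \<and> mx u i1 \<and> mx (- u) i2 \<and> mx u i3)" for u
    unfolding A_def I_def by auto
  have B: "u \<in> B \<longleftrightarrow> norm u = 1 \<and> (\<exists>i1 i2. i1 \<le> i2 \<and> i2 \<le> m \<and> mx u i1 \<and> mx (- u) i2)" for u
    unfolding B_def J_def by auto
  have cl: "closed {u. mx u i}" "closed {u. mx (- u) i}" "closed {u :: real^3. norm u = 1}" for i
    unfolding mx_def
    by (intro closed_Collect_all closed_Collect_imp closed_Collect_le closed_Collect_eq
        open_Collect_const continuous_intros)+
  have clA: "closed A"
    unfolding A_def using fin by (intro closed_UN) (auto intro!: closed_Collect_conj cl)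
  have clB: "closed B"
    unfolding B_def using fin by (intro closed_UN) (auto intro!: closed_Collect_conj cl)
  have mem_minus: "u \<in> uminus ` F \<longleftrightarrow> - u \<in> F" for F :: "(real^3) set" and u
    by (metis image_iff minus_minus)
  have closed_minus: "closed (uminus ` F)" if "closed F" for F :: "(real^3) set"
    using that closed_negations by blast
  have ex_mx: "\<exists>i\<le>m. mx u i" for u
  proof -
    have "finite ((\<lambda>j. u \<bullet> z j) ` {..m})" "(\<lambda>j. u \<bullet> z j) ` {..m} \<noteq> {}" by auto
    then have "Max ((\<lambda>j. u \<bullet> z j) ` {..m}) \<in> (\<lambda>j. u \<bullet> z j) ` {..m}" by (rule Max_in)
    then obtain i where "i \<le> m" "Max ((\<lambda>j. u \<bullet> z j) ` {..m}) = u \<bullet> z i"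
      by (metis (no_types, lifting) atMost_iff imageE)
    then show ?thesis unfolding mx_def
      by (metis Max_ge \<open>finite ((\<lambda>j. u \<bullet> z j) ` {..m})\<close> atMost_iff image_eqI)
  qed
  have cover: "u \<in> B \<or> - u \<in> B" if "norm u = 1" for u
  proof -
    obtain i j where "i \<le> m" "mx u i" "j \<le> m" "mx (- u) j" using ex_mx by blast
    then show ?thesis using that unfolding B by (cases "i \<le> j") force+
  qed
  \<comment> \<open>The two directions give a maximum before a minimum and a minimum before a
    maximum; whichever pair ends later supplies the third extremum.\<close>
  have BB: "u \<in> A \<or> - u \<in> A" if uB: "u \<in> B" "- u \<in> B" for u
  proof -
    obtain i1 i2 where i: "i1 \<le> i2" "i2 \<le> m" "mx u i1" "mx (- u) i2" using uB(1) B by auto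
    obtain j1 j2 where j: "j1 \<le> j2" "j2 \<le> m" "mx (- u) j1" "mx u j2" using uB(2) B by auto
    have n: "norm u = 1" using uB B by auto
    show ?thesis
    proof (cases "i2 \<le> j2")
      case True
      then have "u \<in> A" unfolding A using n i j by blast
      then show ?thesis ..
    next
      case False
      then have "j2 \<le> i2" by simp
      then have "- u \<in> A" unfolding A using n i j by auto
      then show ?thesis ..
    qed
  qed
  \<comment> \<open>One odd real coordinate for each of the two families: this is what makes the
    2-sphere, hence dimension three, sufficient.\<close>
  define F where "F u = Complex (?S A u) (?S B u)" for u
  have "continuous_on (sphere 0 1) F"
    unfolding F_def by (intro continuous_on_Complex continuous_intros)
  moreover have "F (- u) = - F u" for u
  proof -
    have "infdist (- u) G = infdist u (uminus ` G)" for G :: "(real^3) set"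
      using infdist_uminus[of "- u" G] by simp
    moreover have "infdist (- u) (uminus ` G) = infdist u G" for G :: "(real^3) set"
      by (rule infdist_uminus)
    ultimately show ?thesis by (simp add: F_def complex_eq_iff)
  qed
  ultimately obtain u where u: "norm u = 1" "F u = 0"
    using antipodal_zero[of F] by blast
  \<comment> \<open>A vanishing coordinate puts \<open>u\<close> at equal distance from
    \<open>G\<close> and from its antipodal set. It lies in one of the two, and both are closed, so
    it lies in both.\<close>
  have both: "u \<in> G \<and> - u \<in> G" if "closed G" "?S G u = 0" "u \<in> G \<or> - u \<in> G" for G
  proof -
    have ne: "G \<noteq> {}" "uminus ` G \<noteq> {}" using that(3) by auto
    show ?thesis
      using that(2,3) in_closed_iff_infdist_zero[OF that(1) ne(1), of u]
        in_closed_iff_infdist_zero[OF closed_minus[OF that(1)] ne(2), of u] mem_minus[of u G]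
      by auto
  qed
  have S0: "?S A u = 0" "?S B u = 0" using u(2) by (auto simp: F_def complex_eq_iff)
  have "u \<in> B \<and> - u \<in> B" using both[OF clB S0(2)] cover[OF u(1)] by blast
  then have "u \<in> A \<and> - u \<in> A" using both[OF clA S0(1)] BB by blast
  then obtain i1 i2 i3 j1 j2 j3 where ij: "i1 \<le> i2" "i2 \<le> i3" "i3 \<le> m" "mx u i1" "mx (- u) i2" "mx u i3"
      "j1 \<le> j2" "j2 \<le> j3" "j3 \<le> m" "mx (- u) j1" "mx u j2" "mx (- u) j3"
    unfolding A by auto
  \<comment> \<open>Now max, min, max occur at the \<open>i\<close>'s and min, max, min at the
    \<open>j\<close>'s. The triple that starts earlier puts its first index in front of the other
    triple.\<close>
  show ?thesis
  proof (cases "i1 \<le> j1")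
    case True
    then show ?thesis using ij u(1) by blast
  next
    case False
    then have "j1 \<le> i1" by simp
    then show ?thesis using ij u(1)
      by (intro exI[of _ "- u"] exI[of _ j1] exI[of _ i1] exI[of _ i2] exI[of _ i3]) auto
  qed
qed

section \<open>Projection to a lower dimension\<close>

definition polyline_length :: "(nat \<Rightarrow> 'a::metric_space) \<Rightarrow> nat \<Rightarrow> real" where
  "polyline_length x m = (\<Sum>i<m. dist (x i) (x (Suc i)))"

text \<open>Polygonal form of having width at least \<open>W\<close>, tested only on directions in
  \<open>S\<close>, because the subspace shrinks while dimensions are removed.\<close>

definition has_breadth :: "'a::real_inner set \<Rightarrow> (nat \<Rightarrow> 'a) \<Rightarrow> nat \<Rightarrow> real \<Rightarrow> bool" where
  "has_breadth S x m W \<longleftrightarrow> (\<forall>u\<in>S. norm u = 1 \<longrightarrow> (\<exists>i\<le>m. \<exists>j\<le>m. W \<le> u \<bullet> (x i - x j)))"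

lemma polyline_length_nonneg: "0 \<le> polyline_length x m"
  unfolding polyline_length_def by (simp add: sum_nonneg)

lemma dist_le_segment_sum:
  fixes x :: "nat \<Rightarrow> 'a::metric_space"
  assumes "i \<le> j"
  shows "dist (x i) (x j) \<le> (\<Sum>k=i..<j. dist (x k) (x (Suc k)))"
  using assms
proof (induction j rule: dec_induct)
  case (step n)
  then show ?case
    using dist_triangle[of "x i" "x (Suc n)" "x n"] by simp
qed simp

lemma polyline_length_ge_chords:
  fixes x :: "nat \<Rightarrow> 'a::metric_space"
  assumes "i1 \<le> i2" "i2 \<le> i3" "i3 \<le> i4" "i4 \<le> m"
  shows "dist (x 0) (x i1) + dist (x i1) (x i2) + dist (x i2) (x i3) + dist (x i3) (x i4)
      + dist (x i4) (x m) \<le> polyline_length x m"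
proof -
  let ?s = "\<lambda>i j. \<Sum>k=i..<j. dist (x k) (x (Suc k))"
  have "polyline_length x m = ?s 0 m"
    by (simp add: polyline_length_def lessThan_atLeast0)
  also have "\<dots> = ?s 0 i1 + ?s i1 i2 + ?s i2 i3 + ?s i3 i4 + ?s i4 m"
    using assms by (simp add: sum.atLeastLessThan_concat)
  finally show ?thesis
    using dist_le_segment_sum[of 0 i1 x] dist_le_segment_sum[of i1 i2 x] dist_le_segment_sum[of i2 i3 x]
      dist_le_segment_sum[of i3 i4 x] dist_le_segment_sum[of i4 m x] assms by linarith
qed

text \<open>Closing the path by one more step makes it sweep its range twice; the subtracted term is
  the cost of that step.\<close>

lemma variation_ge_range:
  fixes f :: "nat \<Rightarrow> real"
  assumes "i \<le> m" "j \<le> m"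
  shows "2 * (f i - f j) - \<bar>f m - f 0\<bar> \<le> polyline_length f m"
proof (cases "i \<le> j")
  case True
  then show ?thesis
    using polyline_length_ge_chords[of i j j j m f] assms by (simp add: dist_real_def)
next
  case False
  then show ?thesis
    using polyline_length_ge_chords[of j i i i m f] assms by (simp add: dist_real_def)
qed

text \<open>Each of the three moves between consecutive indices covers \<open>W\<close>. For a
  closed path, the way from \<open>i4\<close> through the common end to \<open>i1\<close> is a
  fourth such move.\<close>

lemma alternating_variation:
  fixes f :: "nat \<Rightarrow> real"
  assumes "i1 \<le> i2" "i2 \<le> i3" "i3 \<le> i4" "i4 \<le> m"
    and "W \<le> f i1 - f i2" "W \<le> f i3 - f i2" "W \<le> f i3 - f i4" "W \<le> f i1 - f i4"
  shows "3 * W \<le> polyline_length f m" and "f m = f 0 \<Longrightarrow> 4 * W \<le> polyline_length f m"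
  using polyline_length_ge_chords[OF assms(1-4), of f] assms(5-) by (auto simp: dist_real_def)

text \<open>An isometry \<open>h\<close> embeds R^3 into \<open>S\<close>. Its adjoint transports
  the vertices to R^3 and keeps their products with the directions in the image of \<open>h\<close>,
  so \<open>alternating_extrema\<close> applies.\<close>

lemma has_breadth_alternating:
  fixes x :: "nat \<Rightarrow> 'a::euclidean_space"
  assumes S: "subspace S" "3 \<le> dim S" and W: "has_breadth S x m W"
  obtains u where "u \<in> S" "norm u = 1"
    "3 * W \<le> polyline_length (\<lambda>i. u \<bullet> x i) m"
    "x m = x 0 \<Longrightarrow> 4 * W \<le> polyline_length (\<lambda>i. u \<bullet> x i) m"
proof -
  obtain h :: "real^3 \<Rightarrow> 'a" where h: "linear h" "\<And>v. h v \<in> S" "\<And>v. norm (h v) = norm v"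
    using isometry_subset_subspace[OF subspace_UNIV[where 'a="real^3"] S(1)] S(2) by (auto simp: Pi_iff)
  define z where "z i = adjoint h (x i)" for i
  have z: "v \<bullet> z i = h v \<bullet> x i" for v i
    unfolding z_def by (simp add: adjoint_works h(1))
  obtain v i1 i2 i3 i4 where v: "norm v = 1" and i: "i1 \<le> i2" "i2 \<le> i3" "i3 \<le> i4" "i4 \<le> m"
    and mx: "\<And>j. j \<le> m \<Longrightarrow> v \<bullet> z j \<le> v \<bullet> z i1" "\<And>j. j \<le> m \<Longrightarrow> v \<bullet> z i2 \<le> v \<bullet> z j"
      "\<And>j. j \<le> m \<Longrightarrow> v \<bullet> z j \<le> v \<bullet> z i3" "\<And>j. j \<le> m \<Longrightarrow> v \<bullet> z i4 \<le> v \<bullet> z j"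
    using alternating_extrema[of m z] by auto
  let ?u = "h v"
  have u: "?u \<in> S" "norm ?u = 1" using h v by auto
  obtain a b where "a \<le> m" "b \<le> m" "W \<le> ?u \<bullet> (x a - x b)"
    using W u unfolding has_breadth_def by blast
  then have "W \<le> ?u \<bullet> x p - ?u \<bullet> x q" if "p \<in> {i1, i3}" "q \<in> {i2, i4}" for p q
    using that mx(1,3)[of a] mx(2,4)[of b] by (auto simp: z inner_diff_right)
  then show thesis
    using that[of ?u] u alternating_variation[OF i, of W "\<lambda>i. ?u \<bullet> x i"] by simp
qed

text \<open>Minkowski's inequality, read as the triangle inequality for the plane vectors
  \<open>Complex (a i) (b i)\<close>.\<close>

lemma sum_sqrt_sum_squares_ge:
  fixes a b :: "'i \<Rightarrow> real"
  shows "(\<Sum>i\<in>I. a i)\<^sup>2 + (\<Sum>i\<in>I. b i)\<^sup>2 \<le> (\<Sum>i\<in>I. sqrt ((a i)\<^sup>2 + (b i)\<^sup>2))\<^sup>2"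
proof -
  have "norm (\<Sum>i\<in>I. Complex (a i) (b i)) \<le> (\<Sum>i\<in>I. norm (Complex (a i) (b i)))"
    by (rule norm_sum)
  moreover have "(\<Sum>i\<in>I. Complex (a i) (b i)) = Complex (\<Sum>i\<in>I. a i) (\<Sum>i\<in>I. b i)"
    by (simp add: complex_eq_iff)
  ultimately have "sqrt ((\<Sum>i\<in>I. a i)\<^sup>2 + (\<Sum>i\<in>I. b i)\<^sup>2) \<le> (\<Sum>i\<in>I. sqrt ((a i)\<^sup>2 + (b i)\<^sup>2))"
    by (simp add: complex_norm)
  then show ?thesis
    by (simp add: sqrt_le_D)
qed

lemma polyline_length_decompose:
  fixes x :: "nat \<Rightarrow> 'a::real_inner"
  assumes "norm u = 1"
  shows "(polyline_length (\<lambda>i. u \<bullet> x i) m)\<^sup>2 + (polyline_length (\<lambda>i. x i - (u \<bullet> x i) *\<^sub>R u) m)\<^sup>2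
      \<le> (polyline_length x m)\<^sup>2"
proof -
  let ?y = "\<lambda>i. x i - (u \<bullet> x i) *\<^sub>R u"
  have "sqrt ((dist (u \<bullet> x i) (u \<bullet> x j))\<^sup>2 + (dist (?y i) (?y j))\<^sup>2) = dist (x i) (x j)" for i j
  proof -
    define v where "v = x i - x j"
    have uu: "u \<bullet> u = 1" using assms by (simp add: dot_square_norm)
    have "(dist (?y i) (?y j))\<^sup>2 = (v - (u \<bullet> v) *\<^sub>R u) \<bullet> (v - (u \<bullet> v) *\<^sub>R u)"
      by (simp add: v_def dist_norm power2_norm_eq_inner algebra_simps)
    also have "\<dots> = v \<bullet> v - (u \<bullet> v)\<^sup>2"
      by (simp add: inner_diff_left inner_diff_right uu inner_commute power2_eq_square)
    finally have "(dist (u \<bullet> x i) (u \<bullet> x j))\<^sup>2 + (dist (?y i) (?y j))\<^sup>2 = v \<bullet> v"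
      by (simp add: v_def dist_real_def inner_diff_right)
    then show ?thesis
      by (simp add: v_def dist_norm norm_eq_sqrt_inner)
  qed
  then show ?thesis
    using sum_sqrt_sum_squares_ge[of "\<lambda>i. dist (u \<bullet> x i) (u \<bullet> x (Suc i))" "{..<m}"
        "\<lambda>i. dist (?y i) (?y (Suc i))"]
    by (simp add: polyline_length_def)
qed

text \<open>Induction on \<open>k\<close>. While the dimension exceeds \<open>d\<close> it is at
  least three, by \<open>2 \<le> d\<close>, so an alternating direction \<open>u\<close> exists.
  Projecting to the complement of \<open>u\<close> keeps the products with all remaining directions,
  hence the breadth, and Pythagoras splits off the variation along \<open>u\<close>.\<close>

lemma has_breadth_reduce_subspace:
  fixes x :: "nat \<Rightarrow> 'a::euclidean_space"
  assumes "subspace S" "dim S = d + k" "2 \<le> d" "has_breadth S x m W" "0 \<le> W"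
    and "\<And>i. x i \<in> S" and "c = 3 \<or> c = 4 \<and> x m = x 0"
  shows "\<exists>T y. subspace T \<and> dim T = d \<and> T \<subseteq> S \<and> (\<forall>i. y i \<in> T) \<and> (\<forall>v\<in>T. \<forall>i. v \<bullet> y i = v \<bullet> x i)
      \<and> (x m = x 0 \<longrightarrow> y m = y 0)
      \<and> (c * W)\<^sup>2 * real k + (polyline_length y m)\<^sup>2 \<le> (polyline_length x m)\<^sup>2"
  using assms
proof (induction k arbitrary: S x)
  case 0
  then show ?case by (intro exI[of _ S] exI[of _ x]) auto
next
  case (Suc k)
  obtain u where u: "u \<in> S" "norm u = 1"
    and TV: "3 * W \<le> polyline_length (\<lambda>i. u \<bullet> x i) m"
      "x m = x 0 \<Longrightarrow> 4 * W \<le> polyline_length (\<lambda>i. u \<bullet> x i) m"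
    using has_breadth_alternating[OF Suc.prems(1) _ Suc.prems(4)] Suc.prems(2,3) by auto
  define y where "y i = x i - (u \<bullet> x i) *\<^sub>R u" for i
  define S' where "S' = {v \<in> S. u \<bullet> v = 0}"
  have uu: "u \<bullet> u = 1" using u by (simp add: dot_square_norm)
  have sub: "subspace S'"
    unfolding S'_def using Suc.prems(1)
    by (auto simp: subspace_def inner_add_right)
  have "{v \<in> S. \<forall>w\<in>span {u}. orthogonal w v} = S'"
    by (auto simp: S'_def orthogonal_def span_singleton)
  moreover have "dim (span {u}) = 1" using u by (auto simp: dim_eq_card_independent)
  moreover have "span {u} \<subseteq> S" using u Suc.prems(1) by (simp add: span_minimal)
  ultimately have dim: "dim S' = d + k"
    using dim_subspace_orthogonal_to_vectors[of "span {u}" S] Suc.prems(1,2) by simp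
  have y_in: "y i \<in> S'" for i
    unfolding S'_def y_def using Suc.prems(1,6) u uu
    by (auto simp: subspace_diff subspace_scale inner_diff_right)
  have inner_y: "v \<bullet> y i = v \<bullet> x i" if "v \<in> S'" for v i
    using that by (simp add: S'_def y_def inner_diff_right inner_commute)
  have "has_breadth S' y m W"
    using Suc.prems(4) inner_y unfolding has_breadth_def
    by (auto simp: S'_def inner_diff_right)
  moreover have closed: "x m = x 0 \<Longrightarrow> y m = y 0" by (simp add: y_def)
  ultimately have "\<exists>T z. subspace T \<and> dim T = d \<and> T \<subseteq> S' \<and> (\<forall>i. z i \<in> T) \<and> (\<forall>v\<in>T. \<forall>i. v \<bullet> z i = v \<bullet> y i)
      \<and> (y m = y 0 \<longrightarrow> z m = z 0)
      \<and> (c * W)\<^sup>2 * real k + (polyline_length z m)\<^sup>2 \<le> (polyline_length y m)\<^sup>2"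
    using Suc.prems(5,7) y_in by (intro Suc.IH[OF sub dim Suc.prems(3)]) auto
  then obtain T z where T: "subspace T" "dim T = d" "T \<subseteq> S'" "\<And>i. z i \<in> T"
      "\<And>v i. v \<in> T \<Longrightarrow> v \<bullet> z i = v \<bullet> y i" "y m = y 0 \<longrightarrow> z m = z 0"
      "(c * W)\<^sup>2 * real k + (polyline_length z m)\<^sup>2 \<le> (polyline_length y m)\<^sup>2" by blast
  have "c * W \<le> polyline_length (\<lambda>i. u \<bullet> x i) m" using TV Suc.prems(7) by auto
  moreover have "0 \<le> c * W" using Suc.prems(5,7) by auto
  ultimately have "(c * W)\<^sup>2 \<le> (polyline_length (\<lambda>i. u \<bullet> x i) m)\<^sup>2" by (rule power_mono)
  then have "(c * W)\<^sup>2 * real (Suc k) + (polyline_length z m)\<^sup>2 \<le> (polyline_length x m)\<^sup>2"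
    using T(7) polyline_length_decompose[OF u(2), of x m] unfolding y_def
    by (simp add: algebra_simps)
  then show ?case
    using T closed inner_y by (intro exI[of _ T] exI[of _ z]) (auto simp: S'_def)
qed

text \<open>Moves the projected polygon into the coordinates of \<open>'b\<close>. The map
  \<open>h\<close> stays in the conclusion because breadth and covering are transferred from
  \<open>x\<close> to \<open>z\<close> through it.\<close>

lemma has_breadth_reduce_dimension:
  fixes x :: "nat \<Rightarrow> 'a::euclidean_space"
  assumes "DIM('a) = DIM('b::euclidean_space) + k" "2 \<le> DIM('b::euclidean_space)"
    and "has_breadth UNIV x m W" "0 \<le> W" and "c = 3 \<or> c = 4 \<and> x m = x 0"
  obtains z :: "nat \<Rightarrow> 'b::euclidean_space" and h :: "'b \<Rightarrow> 'a" where "\<And>v. norm (h v) = norm v"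
    "\<And>v i. v \<bullet> z i = h v \<bullet> x i"
    "x m = x 0 \<Longrightarrow> z m = z 0"
    "(c * W)\<^sup>2 * real k + (polyline_length z m)\<^sup>2 \<le> (polyline_length x m)\<^sup>2"
proof -
  obtain T y where T: "subspace T" "dim T = DIM('b::euclidean_space)" "\<And>i. y i \<in> T" "\<And>v i. v \<in> T \<Longrightarrow> v \<bullet> y i = v \<bullet> x i"
      "x m = x 0 \<Longrightarrow> y m = y 0"
      "(c * W)\<^sup>2 * real k + (polyline_length y m)\<^sup>2 \<le> (polyline_length x m)\<^sup>2"
    using has_breadth_reduce_subspace[OF subspace_UNIV _ assms(2,3,4) _ assms(5), of k] assms(1)
    by (metis UNIV_I dim_UNIV)
  obtain f :: "'a \<Rightarrow> 'b" and g where fg: "linear f" "linear g" "g ` UNIV = T"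
    "\<And>x. x \<in> T \<Longrightarrow> norm (f x) = norm x" "\<And>x. norm (g x) = norm x" "\<And>x. x \<in> T \<Longrightarrow> g (f x) = x"
  proof (rule isometries_subspaces[OF T(1) subspace_UNIV[where 'a='b]])
    show "dim T = dim (UNIV :: 'b set)" using T(2) by simp
  qed (auto intro: that)
  have gT: "g v \<in> T" for v using fg(3) by auto
  have inner_g: "g v \<bullet> g w = v \<bullet> w" for v w
    using fg(5) by (simp add: dot_norm linear_add[OF fg(2), symmetric])
  show thesis
  proof (rule that[of g "\<lambda>i. f (y i)"])
    show "v \<bullet> f (y i) = g v \<bullet> x i" for v i
      using inner_g[of v "f (y i)"] fg(6)[OF T(3)] T(4)[OF gT] by simp
    have "dist (f (y i)) (f (y j)) = dist (y i) (y j)" for i j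
      using fg(4)[OF subspace_diff[OF T(1) T(3) T(3)]] by (simp add: dist_norm linear_diff[OF fg(1)])
    then have "polyline_length (\<lambda>i. f (y i)) m = polyline_length y m"
      by (simp add: polyline_length_def)
    then show "(c * W)\<^sup>2 * real k + (polyline_length (\<lambda>i. f (y i)) m)\<^sup>2 \<le> (polyline_length x m)\<^sup>2"
      using T(6) by simp
  qed (use fg T(5) in auto)
qed

section \<open>Planar width bounds\<close>

text \<open>The mean of \<open>\<bar>cos\<bar>\<close> over a half turn, which expresses an edge
  length by its projections. For \<open>v\<close> in the upper half-plane the interval is cut at the
  zero of the cosine, \<open>a + pi / 2\<close> or \<open>a - pi / 2\<close>; the other half-plane
  follows by the symmetry \<open>v\<close> to \<open>- v\<close>.\<close>

lemma integral_abs_inner_cis: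
  "((\<lambda>t. \<bar>cis t \<bullet> v\<bar>) has_integral 2 * norm v) {0..pi}"
proof -
  have upper: "((\<lambda>t. \<bar>cis t \<bullet> v\<bar>) has_integral 2 * norm v) {0..pi}" if "0 \<le> Im v" for v
  proof -
    define a where "a = Arg v"
    have a: "0 \<le> a" "a \<le> pi"
      using that Arg_bounded[of v] Arg_less_0[of v] by (auto simp: a_def)
    have v: "v = norm v *\<^sub>R cis a"
      using rcis_cmod_Arg[of v] by (simp add: a_def rcis_def scaleR_conv_of_real)
    have "cis t \<bullet> v = norm v * cos (t - a)" for t
      by (subst v) (simp add: inner_complex_def cos_diff algebra_simps)
    then have eq: "\<bar>cis t \<bullet> v\<bar> = norm v * \<bar>cos (t - a)\<bar>" for t
      by (simp add: abs_mult)
    have ftc: "((\<lambda>t. \<bar>cos (t - a)\<bar>) has_integral (e * sin (r - a) - e * sin (l - a))) {l..r}"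
      if "l \<le> r" "\<And>t. t \<in> {l..r} \<Longrightarrow> \<bar>cos (t - a)\<bar> = e * cos (t - a)" for l r e
    proof -
      have "((\<lambda>t. e * cos (t - a)) has_integral (e * sin (r - a) - e * sin (l - a))) {l..r}"
        using that(1) by (intro fundamental_theorem_of_calculus)
          (auto intro!: derivative_eq_intros simp flip: has_real_derivative_iff_has_vector_derivative)
      then show ?thesis
        by (rule has_integral_eq[rotated]) (use that(2) in auto)
    qed
    have neg: "cos t \<le> 0" if "pi / 2 \<le> \<bar>t\<bar>" "\<bar>t\<bar> \<le> pi" for t :: real
      using cos_monotone_0_pi_le[of "pi / 2" "\<bar>t\<bar>"] that by simp
    have "((\<lambda>t. \<bar>cos (t - a)\<bar>) has_integral 2) {0..pi}"
    proof (cases "a \<le> pi / 2")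
      case True
      have 1: "((\<lambda>t. \<bar>cos (t - a)\<bar>) has_integral (1 * sin (a + pi/2 - a) - 1 * sin (0 - a))) {0..a + pi/2}"
        using True a by (intro ftc) (auto intro!: abs_of_nonneg cos_ge_zero)
      have 2: "((\<lambda>t. \<bar>cos (t - a)\<bar>) has_integral ((-1) * sin (pi - a) - (-1) * sin (a + pi/2 - a))) {a + pi/2..pi}"
        using True a by (intro ftc) (auto intro!: abs_of_nonpos neg)
      show ?thesis
        using has_integral_combine[OF _ _ 1 2] True a by simp
    next
      case False
      have 1: "((\<lambda>t. \<bar>cos (t - a)\<bar>) has_integral ((-1) * sin (a - pi/2 - a) - (-1) * sin (0 - a))) {0..a - pi/2}"
        using False a by (intro ftc) (auto intro!: abs_of_nonpos neg)
      have 2: "((\<lambda>t. \<bar>cos (t - a)\<bar>) has_integral (1 * sin (pi - a) - 1 * sin (a - pi/2 - a))) {a - pi/2..pi}"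
        using False a by (intro ftc) (auto intro!: abs_of_nonneg cos_ge_zero)
      show ?thesis
        using has_integral_combine[OF _ _ 1 2] False a by simp
    qed
    from has_integral_mult_right[OF this, of "norm v"] show ?thesis
      by (simp only: eq mult.commute[of _ 2])
  qed
  show ?thesis
    using upper[of v] upper[of "- v"] by (cases "0 \<le> Im v") auto
qed

text \<open>The left side is one of the values \<open>X j * a + Y j * b\<close>, each bounded by
  Cauchy-Schwarz. An edge term selects \<open>b * s k\<close> when advancing to the next vertex pays
  off; by \<open>mono\<close> the ratios \<open>c k / s k\<close> increase, so if this happens at an
  edge, it happens at all earlier ones, and the sum telescopes.\<close>

lemma norm_ge_polygon_support:
  fixes X Y :: "nat \<Rightarrow> real"
  defines "c \<equiv> \<lambda>k. X k - X (Suc k)" and "s \<equiv> \<lambda>k. Y (Suc k) - Y k"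
  assumes circ: "\<And>k. k \<le> n \<Longrightarrow> (X k)\<^sup>2 + (Y k)\<^sup>2 \<le> 1"
    and s: "\<And>k. k < n \<Longrightarrow> 0 < s k"
    and mono: "\<And>j k. j < k \<Longrightarrow> k < n \<Longrightarrow> c j * s k \<le> c k * s j"
    and ab: "0 \<le> a" "0 \<le> b"
  shows "X n * a + Y 0 * b + (\<Sum>k<n. max (a * c k) (b * s k)) \<le> sqrt (a\<^sup>2 + b\<^sup>2)"
proof -
  have dot: "x * a + y * b \<le> sqrt (a\<^sup>2 + b\<^sup>2)" if "x\<^sup>2 + y\<^sup>2 \<le> 1" for x y
  proof -
    have "(x * a + y * b)\<^sup>2 \<le> (x\<^sup>2 + y\<^sup>2) * (a\<^sup>2 + b\<^sup>2)"
      using zero_le_power2[of "x * b - y * a"] by (simp add: power2_eq_square algebra_simps)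
    also have "\<dots> \<le> 1 * (a\<^sup>2 + b\<^sup>2)" using that by (intro mult_right_mono) auto
    finally show ?thesis by (simp add: real_le_rsqrt)
  qed
  show ?thesis
    using circ s mono
  proof (induction n)
  case 0
  then show ?case using dot[of "X 0" "Y 0"] by simp
next
  case (Suc n)
  show ?case
  proof (cases "b * s n \<le> a * c n")
    case True
    have "X n * a + Y 0 * b + (\<Sum>k<n. max (a * c k) (b * s k)) \<le> sqrt (a\<^sup>2 + b\<^sup>2)"
      using Suc by simp
    then show ?thesis using True by (simp add: max_def c_def algebra_simps)
  next
    case False
    have "a * c k \<le> b * s k" if "k < n" for k
    proof -
      have "(a * c k) * s n \<le> (a * c n) * s k"
        using mult_left_mono[OF Suc.prems(3)[OF that] ab(1)] by (simp add: mult.assoc)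
      also have "\<dots> \<le> (b * s n) * s k"
        using False Suc.prems(2)[of k] that by (intro mult_right_mono) auto
      finally have "(a * c k) * s n \<le> (b * s k) * s n" by (simp add: mult_ac)
      then show ?thesis using Suc.prems(2)[of n] by simp
    qed
    then have "(\<Sum>k<Suc n. max (a * c k) (b * s k)) = (\<Sum>k<Suc n. b * s k)"
      using False by (intro sum.cong) (auto simp: less_Suc_eq max_def)
    also have "\<dots> = b * (Y (Suc n) - Y 0)"
      unfolding s_def by (simp only: sum_lessThan_telescope flip: sum_distrib_left)
    finally show ?thesis using dot[OF Suc.prems(1)[of "Suc n"]] by (simp add: algebra_simps)
  qed
qed
qed

text \<open>Each projection is a closed path and so sweeps its range twice; integrating over a half
  turn compares \<open>2 * pi * W\<close> with twice the length.\<close>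

lemma planar_breadth_closed:
  fixes z :: "nat \<Rightarrow> complex"
  assumes "has_breadth UNIV z m W" "z m = z 0"
  shows "pi * W \<le> polyline_length z m"
proof -
  have int: "((\<lambda>t. polyline_length (\<lambda>i. cis t \<bullet> z i) m) has_integral 2 * polyline_length z m) {0..pi}"
  proof -
    have "((\<lambda>t. \<Sum>i<m. \<bar>cis t \<bullet> (z i - z (Suc i))\<bar>) has_integral (\<Sum>i<m. 2 * norm (z i - z (Suc i)))) {0..pi}"
      by (intro has_integral_sum integral_abs_inner_cis finite_lessThan)
    then show ?thesis
      by (simp add: polyline_length_def dist_norm inner_diff_right sum_distrib_left)
  qed
  have "2 * W \<le> polyline_length (\<lambda>i. cis t \<bullet> z i) m" for t
  proof -
    obtain i j where "i \<le> m" "j \<le> m" "W \<le> cis t \<bullet> (z i - z j)"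
      using assms(1) unfolding has_breadth_def by (metis UNIV_I norm_cis)
    then show ?thesis
      using variation_ge_range[of i m j "\<lambda>i. cis t \<bullet> z i"] assms(2)
      by (simp add: inner_diff_right)
  qed
  then have "2 * W * pi \<le> 2 * polyline_length z m"
    using has_integral_le[OF has_integral_const_real[of "2 * W" 0 pi] int] by (simp add: mult_ac)
  then show ?thesis by (simp add: mult_ac)
qed

text \<open>With the chord between the ends on the real axis, the projection to \<open>u\<close>
  loses \<open>\<bar>Re u\<bar> * d\<close> against a closed path (\<open>V_ge\<close>, homogeneous
  in \<open>u\<close> so that weights can be absorbed). The projection to the real axis itself is at
  least \<open>d\<close> (\<open>V1\<close>), and the weights balance the losses against this
  gain.\<close>

lemma planar_breadth_open_aligned:
  fixes z :: "nat \<Rightarrow> complex"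
  assumes breadth: "has_breadth UNIV z m W" and W: "0 \<le> W"
    and \<delta>: "z m - z 0 = of_real d" "0 \<le> d"
  shows "2.2782 * W \<le> polyline_length z m"
proof -
  define V where "V u = polyline_length (\<lambda>i. u \<bullet> z i) m" for u :: complex
  have V_ge: "2 * (W * norm u) - \<bar>Re u\<bar> * d \<le> V u" for u
  proof (cases "u = 0")
    case True
    then show ?thesis by (simp add: V_def polyline_length_nonneg)
  next
    case False
    then obtain i j where ij: "i \<le> m" "j \<le> m" "W \<le> sgn u \<bullet> (z i - z j)"
      using breadth unfolding has_breadth_def by (metis UNIV_I norm_sgn)
    have "W * norm u \<le> (sgn u \<bullet> (z i - z j)) * norm u"
      using ij(3) by (rule mult_right_mono) simp
    also have "\<dots> = u \<bullet> z i - u \<bullet> z j"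
      using False by (simp add: sgn_div_norm inner_diff_right field_simps)
    finally have "2 * (W * norm u) \<le> 2 * (u \<bullet> z i - u \<bullet> z j)" by simp
    moreover have "\<bar>u \<bullet> z m - u \<bullet> z 0\<bar> = \<bar>Re u\<bar> * d"
    proof -
      have "u \<bullet> z m - u \<bullet> z 0 = u \<bullet> of_real d" by (simp add: \<delta>(1)[symmetric] inner_diff_right)
      then show ?thesis using \<delta>(2) by (simp add: inner_complex_def abs_mult)
    qed
    ultimately show ?thesis
      using variation_ge_range[OF ij(1,2), of "\<lambda>i. u \<bullet> z i"] by (simp add: V_def)
  qed
  have V1: "d \<le> V 1"
  proof -
    have "1 \<bullet> z m - 1 \<bullet> z 0 = d"
      using arg_cong[OF \<delta>(1), of Re] by (simp add: inner_complex_def)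
    then show ?thesis
      using polyline_length_ge_chords[of 0 0 0 0 m "\<lambda>i. 1 \<bullet> z i"] by (simp add: V_def dist_real_def)
  qed
  \<comment> \<open>The points \<open>(X k, Y k)\<close> lie just inside the unit circle, roughly evenly spaced in angle between
    \<open>arccos 0.57\<close> and \<open>arccos 0.285\<close>. The support function of the polygon spanned by \<open>(\<plusminus>X k, \<plusminus>Y k)\<close> is a sum
    of absolute values of linear forms, hence a lower bound for the norm that can be summed over
    the edges. The condition \<open>X 0 = 2 * X 6\<close> makes the terms in \<open>d\<close> cancel.\<close>
  define X where "X = (\<lambda>k. [571500, 527148, 481312, 434119, 385703, 336200, 285750] ! k / 1000000 :: real)"
  define Y where "Y = (\<lambda>k. [820602, 849772, 876549, 900855, 922622, 941790, 958304] ! k / 1000000 :: real)"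
  define c where "c k = X k - X (Suc k)" for k
  define s where "s k = Y (Suc k) - Y k" for k
  have edge: "X 6 * \<bar>1 \<bullet> v\<bar> + Y 0 * \<bar>\<i> \<bullet> v\<bar>
      + (\<Sum>k<6. (\<bar>Complex (c k) (s k) \<bullet> v\<bar> + \<bar>Complex (c k) (- s k) \<bullet> v\<bar>) / 2) \<le> norm v" for v :: complex
  proof -
    have "X 6 * \<bar>Re v\<bar> + Y 0 * \<bar>Im v\<bar> + (\<Sum>k<6. max (\<bar>Re v\<bar> * (X k - X (Suc k))) (\<bar>Im v\<bar> * (Y (Suc k) - Y k)))
        \<le> sqrt (\<bar>Re v\<bar>\<^sup>2 + \<bar>Im v\<bar>\<^sup>2)"
    proof (rule norm_ge_polygon_support)
      fix k :: nat assume "k \<le> 6"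
      then have "k \<in> {0, 1, 2, 3, 4, 5, 6}" by auto
      then show "(X k)\<^sup>2 + (Y k)\<^sup>2 \<le> 1"
        by (auto simp: X_def Y_def power2_eq_square)
    next
      fix k :: nat assume "k < 6"
      then have "k \<in> {0, 1, 2, 3, 4, 5}" by auto
      then show "0 < Y (Suc k) - Y k" by (auto simp: Y_def)
    next
      fix j k :: nat assume "j < k" "k < 6"
      then have "k \<in> {1, 2, 3, 4, 5}" "j \<in> {0, 1, 2, 3, 4}" "j < k" by auto
      then show "(X j - X (Suc j)) * (Y (Suc k) - Y k) \<le> (X k - X (Suc k)) * (Y (Suc j) - Y j)"
        by (auto simp: X_def Y_def)
    qed auto
    \<comment> \<open>A maximum of two absolute values is an average of absolute values of linear
      forms in \<open>v\<close>; this makes the bound summable into values of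
      \<open>V\<close>.\<close>
    moreover have "(\<bar>Complex (c k) (s k) \<bullet> v\<bar> + \<bar>Complex (c k) (- s k) \<bullet> v\<bar>) / 2
        = max (\<bar>Re v\<bar> * (X k - X (Suc k))) (\<bar>Im v\<bar> * (Y (Suc k) - Y k))" if "k < 6" for k
    proof -
      have "k \<in> {0, 1, 2, 3, 4, 5}" using that by auto
      then have "0 \<le> c k" "0 \<le> s k" by (auto simp: X_def Y_def c_def s_def)
      then have "\<bar>Re v\<bar> * c k = \<bar>c k * Re v\<bar>" "\<bar>Im v\<bar> * s k = \<bar>s k * Im v\<bar>"
        by (simp_all add: abs_mult)
      moreover have "(\<bar>p + q\<bar> + \<bar>p - q\<bar>) / 2 = max \<bar>p\<bar> \<bar>q\<bar>" for p q :: real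
        by (auto simp: max_def abs_if)
      ultimately show ?thesis
        unfolding c_def[symmetric] s_def[symmetric] by (simp add: inner_complex_def)
    qed
    ultimately show ?thesis
      by (simp add: inner_complex_def cmod_def)
  qed
  have "X 6 * V 1 + Y 0 * V \<i> + (\<Sum>k<6. (V (Complex (c k) (s k)) + V (Complex (c k) (- s k))) / 2)
      = (\<Sum>i<m. X 6 * \<bar>1 \<bullet> (z i - z (Suc i))\<bar> + Y 0 * \<bar>\<i> \<bullet> (z i - z (Suc i))\<bar>
      + (\<Sum>k<6. (\<bar>Complex (c k) (s k) \<bullet> (z i - z (Suc i))\<bar> + \<bar>Complex (c k) (- s k) \<bullet> (z i - z (Suc i))\<bar>) / 2))"
  proof -
    have V_eq: "V u = (\<Sum>i<m. \<bar>u \<bullet> (z i - z (Suc i))\<bar>)" for u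
      by (simp add: V_def polyline_length_def dist_real_def inner_diff_right)
    show ?thesis
      unfolding V_eq sum.distrib sum_distrib_left
      by (simp only: sum.swap[of _ "{..<m}"] sum.distrib sum_divide_distrib add_divide_distrib)
  qed
  also have "\<dots> \<le> polyline_length z m"
    unfolding polyline_length_def dist_norm by (intro sum_mono edge)
  finally have L: "X 6 * V 1 + Y 0 * V \<i> + (\<Sum>k<6. (V (Complex (c k) (s k)) + V (Complex (c k) (- s k))) / 2)
      \<le> polyline_length z m" .
  \<comment> \<open>\<open>0.053084\<close> is a common lower bound for the lengths of the six
    chords \<open>(c k, s k)\<close>.\<close>
  have chord: "2 * (W * 0.053084) - c k * d \<le> V (Complex (c k) t)" if "k < 6" "t = s k \<or> t = - s k" for k t
  proof -
    have k: "k \<in> {0, 1, 2, 3, 4, 5}" using that by auto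
    then have "(0.053084)\<^sup>2 \<le> (c k)\<^sup>2 + (s k)\<^sup>2" "0 \<le> c k"
      by (auto simp: X_def Y_def c_def s_def power2_eq_square)
    then have "0.053084 \<le> norm (Complex (c k) t)"
      using that(2) unfolding complex_norm by (intro real_le_rsqrt) auto
    then have "W * 0.053084 \<le> W * norm (Complex (c k) t)" using W by (rule mult_left_mono)
    then show ?thesis using V_ge[of "Complex (c k) t"] \<open>0 \<le> c k\<close> by simp
  qed
  have "(\<Sum>k<6. 2 * (W * 0.053084) - c k * d)
      \<le> (\<Sum>k<6. (V (Complex (c k) (s k)) + V (Complex (c k) (- s k))) / 2)"
  proof (intro sum_mono)
    fix k :: nat assume "k \<in> {..<6}"
    then show "2 * (W * 0.053084) - c k * d \<le> (V (Complex (c k) (s k)) + V (Complex (c k) (- s k))) / 2"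
      using chord[of k "s k"] chord[of k "- s k"] by simp
  qed
  moreover have "(\<Sum>k<6. 2 * (W * 0.053084) - c k * d) = 6 * (2 * (W * 0.053084)) - (X 0 - X 6) * d"
    unfolding c_def by (simp add: sum_subtractf flip: sum_distrib_right)
      (simp add: eval_nat_numeral)
  \<comment> \<open>The chords lose \<open>(X 0 - X 6) * d = 0.28575 * d\<close>, which
    \<open>V1\<close> returns with the same weight. What remains is
    \<open>12 * 0.053084 + 2 * 0.820602 = 2.278212\<close> times \<open>W\<close>.\<close>
  ultimately have "6 * (2 * (W * 0.053084)) - 0.28575 * d + 0.28575 * V 1 + 0.820602 * V \<i> \<le> polyline_length z m"
    using L by (simp add: X_def Y_def)
  moreover have "2 * W \<le> V \<i>" using V_ge[of \<i>] by simp
  ultimately show ?thesis using V1 W by simp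
qed

lemma planar_breadth_open:
  fixes z :: "nat \<Rightarrow> complex"
  assumes "has_breadth UNIV z m W" "0 \<le> W"
  shows "2.2782 * W \<le> polyline_length z m"
proof -
  define \<delta> where "\<delta> = z m - z 0"
  define e where "e = cis (- Arg \<delta>)"
  have e: "norm e = 1" by (simp add: e_def)
  have "e * \<delta> = of_real (norm \<delta>)"
    using rcis_cmod_Arg[of \<delta>] unfolding e_def
    by (metis add.right_inverse add.commute cis_mult cis_zero mult.left_commute mult.right_neutral rcis_def)
  then have \<delta>: "e * z m - e * z 0 = of_real (norm \<delta>)"
    by (simp add: \<delta>_def algebra_simps)
  have "has_breadth UNIV (\<lambda>i. e * z i) m W"
    unfolding has_breadth_def
  proof (intro ballI impI)
    fix u :: complex assume "norm u = 1"
    then have "norm (cnj e * u) = 1" using e by (simp add: norm_mult)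
    then obtain i j where ij: "i \<le> m" "j \<le> m" "W \<le> (cnj e * u) \<bullet> (z i - z j)"
      using assms(1) unfolding has_breadth_def by blast
    moreover have "(cnj e * u) \<bullet> (z i - z j) = u \<bullet> (e * z i - e * z j)"
      by (simp add: inner_complex_def algebra_simps)
    ultimately show "\<exists>i\<le>m. \<exists>j\<le>m. W \<le> u \<bullet> (e * z i - e * z j)" by auto
  qed
  from planar_breadth_open_aligned[OF this assms(2) \<delta>]
  show ?thesis
    using e by (simp add: polyline_length_def dist_norm norm_mult flip: right_diff_distrib)
qed

section \<open>Crossing counts and pruned polygons\<close>

text \<open>Lists instead of indexed vertices, since pruning deletes vertices. The weight is
  arbitrary because lengths, changes of membership and measures of symmetric differences are all
  summed along the same polygon.\<close>

fun edge_sum :: "('a \<Rightarrow> 'a \<Rightarrow> real) \<Rightarrow> 'a list \<Rightarrow> real" where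
  "edge_sum f (x # y # zs) = f x y + edge_sum f (y # zs)"
| "edge_sum f _ = 0"

lemma edge_sum_append: "edge_sum f (xs @ x # ys) = edge_sum f (xs @ [x]) + edge_sum f (x # ys)"
  by (induction xs rule: induct_list012) auto

lemma edge_sum_mono:
  assumes "successively (\<lambda>x y. f x y \<le> g x y) xs"
  shows "edge_sum f xs \<le> edge_sum g xs"
  using assms by (induction f xs rule: edge_sum.induct) auto

lemma edge_sum_ge_abs_diff:
  fixes h :: "'a \<Rightarrow> real"
  assumes "xs \<noteq> []"
  shows "\<bar>h (hd xs) - h (last xs)\<bar> \<le> edge_sum (\<lambda>x y. \<bar>h x - h y\<bar>) xs"
  using assms
proof (induction xs rule: induct_list012)
  case (3 x y zs)
  then have "\<bar>h y - h (last (y # zs))\<bar> \<le> edge_sum (\<lambda>x y. \<bar>h x - h y\<bar>) (y # zs)" by simp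
  moreover have "last (x # y # zs) = last (y # zs)" by simp
  ultimately show ?case
    using abs_triangle_ineq[of "h x - h y" "h y - h (last (y # zs))"] by simp
qed auto

lemma edge_sum_add: "edge_sum (\<lambda>x y. f x y + g x y) xs = edge_sum f xs + edge_sum g xs"
  by (induction f xs rule: edge_sum.induct) auto

lemma edge_sum_mult: "edge_sum (\<lambda>x y. c * f x y) xs = c * edge_sum f xs"
  by (induction f xs rule: edge_sum.induct) (auto simp: algebra_simps)

lemma successively_set_cong:
  assumes "successively P xs" "\<And>x y. x \<in> set xs \<Longrightarrow> y \<in> set xs \<Longrightarrow> P x y \<Longrightarrow> Q x y"
  shows "successively Q xs"
  using assms by (induction P xs rule: successively.induct) auto

lemma not_successively_split:
  assumes "\<not> successively P xs"
  obtains as x y bs where "xs = as @ x # y # bs" "\<not> P x y"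
proof -
  have "\<exists>as x y bs. xs = as @ x # y # bs \<and> \<not> P x y"
    using assms
  proof (induction P xs rule: successively.induct)
    case (3 P x y xs)
    then show ?case
    proof (cases "P x y")
      case True
      then obtain as v w bs where "y # xs = as @ v # w # bs" "\<not> P v w" using 3 by auto
      then show ?thesis by (intro exI[of _ "x # as"]) auto
    next
      case False
      then show ?thesis by (intro exI[of _ "[]"]) auto
    qed
  qed auto
  then show thesis using that by blast
qed

lemma edge_sum_dist_delete:
  "edge_sum dist (as @ bs) \<le> edge_sum dist (as @ x # bs)"
proof (induction as rule: induct_list012)
  case 1
  then show ?case by (cases bs) auto
next
  case (2 a)
  then show ?case
  proof (cases bs)
    case (Cons b cs)
    then show ?thesis using dist_triangle[of a b x] by simp
  qed simp
qed auto

lemma edge_sum_dist_replace_last: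
  "cs \<noteq> [] \<Longrightarrow> edge_sum dist (cs @ [b]) \<le> edge_sum dist (cs @ [x]) + dist x b"
proof (induction cs rule: induct_list012)
  case (2 a)
  then show ?case using dist_triangle[of a b x] by simp
qed auto

text \<open>The delicate case is deletion of the head, which also changes the closing vertex: the
  detour through \<open>x\<close> between the last vertex and the new head \<open>b\<close> is cut
  short.\<close>

lemma closed_edge_sum_delete:
  assumes "as @ bs \<noteq> []"
  shows "edge_sum dist ((as @ bs) @ [hd (as @ bs)]) \<le> edge_sum dist ((as @ x # bs) @ [hd (as @ x # bs)])"
proof (cases as)
  case Nil
  with assms obtain b cs where bs: "bs = b # cs" by (cases bs) auto
  have "edge_sum dist ((b # cs) @ [b]) \<le> edge_sum dist ((b # cs) @ [x]) + dist x b"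
    by (rule edge_sum_dist_replace_last) simp
  then show ?thesis by (simp add: Nil bs)
next
  case (Cons a as')
  then show ?thesis
    using edge_sum_dist_delete[of as "bs @ [a]" x] by simp
qed

section \<open>Visibility caps and pruning of nested ones\<close>

definition sees :: "'a::real_inner \<Rightarrow> 'a set" where
  "sees x = {u. norm u = 1 \<and> 1 \<le> u \<bullet> x}"

definition unnested :: "'a::real_inner \<Rightarrow> 'a \<Rightarrow> bool" where
  "unnested x y \<longleftrightarrow> \<not> sees x \<subseteq> sees y \<and> \<not> sees y \<subseteq> sees x"

definition covering :: "'a::real_inner list \<Rightarrow> bool" where
  "covering xs \<longleftrightarrow> (\<forall>u. norm u = 1 \<longrightarrow> (\<exists>x\<in>set xs. u \<in> sees x))"

lemma covering_delete:
  assumes "covering (as @ x # bs)" "sees x \<subseteq> sees y" "y \<in> set (as @ bs)"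
  shows "covering (as @ bs)"
  unfolding covering_def
proof (intro allI impI)
  fix u :: 'a assume "norm u = 1"
  then obtain w where "w \<in> set (as @ x # bs)" "u \<in> sees w"
    using assms(1) unfolding covering_def by blast
  then show "\<exists>w\<in>set (as @ bs). u \<in> sees w"
    using assms(2,3) by (cases "w = x") auto
qed

text \<open>A single point never sees two antipodal directions.\<close>

lemma covering_not_singleton:
  fixes xs :: "'a::euclidean_space list"
  assumes "covering xs" "xs \<noteq> []"
  obtains x y zs where "xs = x # y # zs"
proof -
  have False if "xs = [x]" for x
  proof -
    obtain u :: 'a where u: "norm u = 1" using vector_choose_size[of 1] by auto
    then have "1 \<le> u \<bullet> x" "1 \<le> (- u) \<bullet> x"
      using assms(1) that unfolding covering_def sees_def by (auto dest: spec[of _ u] spec[of _ "- u"])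
    then show False by simp
  qed
  then show thesis using that assms(2) by (cases xs; cases "tl xs") auto
qed

lemma prune_open:
  fixes xs :: "'a::real_inner list"
  assumes "covering xs" "xs \<noteq> []"
  obtains ys :: "'a list" where "covering ys" "ys \<noteq> []" "successively unnested ys"
    "edge_sum dist ys \<le> edge_sum dist xs"
proof -
  have "\<exists>ys :: 'a list. covering ys \<and> ys \<noteq> [] \<and> successively unnested ys \<and> edge_sum dist ys \<le> edge_sum dist xs"
    using assms
  proof (induction "length xs" arbitrary: xs rule: less_induct)
    case less
    show ?case
    proof (cases "successively unnested xs")
      case True
      then show ?thesis using less.prems by (intro exI[of _ xs]) simp
    next
      case False
      then obtain as x y bs where xs: "xs = as @ x # y # bs" "\<not> unnested x y"
        by (rule not_successively_split)
      obtain cs w ds where *: "xs = cs @ w # ds" "covering (cs @ ds)" "cs @ ds \<noteq> []"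
      proof (cases "sees x \<subseteq> sees y")
        case True
        then show ?thesis
          using that[of as x "y # bs"] covering_delete[of as x "y # bs" y] less.prems xs by simp
      next
        case False
        then have "sees y \<subseteq> sees x" using xs(2) by (auto simp: unnested_def)
        then show ?thesis
          using that[of "as @ [x]" y bs] covering_delete[of "as @ [x]" y bs x] less.prems xs by simp
      qed
      have "edge_sum dist (cs @ ds) \<le> edge_sum dist xs"
        using edge_sum_dist_delete[of cs ds w] *(1) by simp
      then show ?thesis
        using less.hyps[of "cs @ ds"] * by fastforce
    qed
  qed
  then show thesis using that by blast
qed

text \<open>As in the open case, but the closing edge has to become unnested too, and a deletion may
  remove the head, which is also the closing vertex.\<close>

lemma prune_closed:
  fixes xs :: "'a::euclidean_space list"
  assumes "covering xs" "xs \<noteq> []"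
  obtains ys :: "'a list" where "covering ys" "ys \<noteq> []" "successively unnested (ys @ [hd ys])"
    "edge_sum dist (ys @ [hd ys]) \<le> edge_sum dist (xs @ [hd xs])"
proof -
  have "\<exists>ys :: 'a list. covering ys \<and> ys \<noteq> [] \<and> successively unnested (ys @ [hd ys])
      \<and> edge_sum dist (ys @ [hd ys]) \<le> edge_sum dist (xs @ [hd xs])"
    using assms
  proof (induction "length xs" arbitrary: xs rule: less_induct)
    case less
    show ?case
    proof (cases "successively unnested (xs @ [hd xs])")
      case True
      then show ?thesis using less.prems by (intro exI[of _ xs]) simp
    next
      case False
      then obtain as x y bs where xs: "xs @ [hd xs] = as @ x # y # bs" "\<not> unnested x y"
        by (rule not_successively_split)
      obtain p q zs where pq: "xs = p # q # zs"
        using covering_not_singleton less.prems by metis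
      obtain cs w ds where *: "xs = cs @ w # ds" "covering (cs @ ds)" "cs @ ds \<noteq> []"
      proof (cases "bs = []")
        \<comment> \<open>The nested edge is the closing one: \<open>y\<close> is the head
          \<open>p\<close> and \<open>x\<close> the last vertex, so one of these two is
          deleted.\<close>
        case True
        then have "as @ x # y # bs = (as @ [x]) @ [y]" by simp
        then have "xs @ [hd xs] = (as @ [x]) @ [y]" by (rule trans[OF xs(1)])
        then have "(p # q # zs) @ [p] = (as @ [x]) @ [y]" by (simp only: pq list.sel)
        then have "p # q # zs = as @ [x] \<and> p = y" by (rule append1_eq_conv[THEN iffD1])
        then have y: "y = p" "as @ [x] = p # q # zs" by (blast intro: sym)+
        obtain as' where as: "as = p # as'" using y(2) by (cases as) auto
        have x: "x \<in> set (q # zs)"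
        proof -
          have "as' @ [x] = q # zs" using y(2) as by simp
          then show ?thesis by (metis in_set_conv_decomp)
        qed
        show ?thesis
        proof (cases "sees x \<subseteq> sees y")
          case True
          then show ?thesis
            using that[of as x "[]"] covering_delete[of as x "[]" y] less.prems pq y as by simp
        next
          case False
          then have "sees y \<subseteq> sees x" using xs(2) by (auto simp: unnested_def)
          then show ?thesis
            using that[of "[]" p "q # zs"] covering_delete[of "[]" p "q # zs" x] less.prems pq y x by simp
        qed
      next
        case False
        then have "xs = as @ x # y # butlast bs"
          using arg_cong[OF xs(1), of butlast] by (simp add: butlast_append)
        note xs' = this
        show ?thesis
        proof (cases "sees x \<subseteq> sees y")
          case True
          then show ?thesis
            using that[of as x "y # butlast bs"] covering_delete[of as x "y # butlast bs" y] less.prems xs' by simp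
        next
          case False
          then have "sees y \<subseteq> sees x" using xs(2) by (auto simp: unnested_def)
          then show ?thesis
            using that[of "as @ [x]" y "butlast bs"] covering_delete[of "as @ [x]" y "butlast bs" x] less.prems xs' by simp
        qed
      qed
      have le: "edge_sum dist ((cs @ ds) @ [hd (cs @ ds)]) \<le> edge_sum dist (xs @ [hd xs])"
        using closed_edge_sum_delete[OF *(3), of w] *(1) by simp
      have "length (cs @ ds) < length xs" using *(1) by simp
      from less.hyps[OF this *(2,3)] le show ?thesis by (meson order_trans)
    qed
  qed
  then show thesis using that by blast
qed

text \<open>For a direction \<open>u\<close> seen from \<open>x\<close>, the number
  \<open>u \<bullet> x\<close> is at least 1 and a mean of \<open>u \<bullet> z\<close>, which is at
  most 1, and \<open>u \<bullet> y\<close>; so the latter is at least 1. Going straight away from a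
  point of the ball never loses visibility.\<close>

lemma sees_subset_beyond:
  assumes "norm z \<le> 1" "x = (1 - t) *\<^sub>R z + t *\<^sub>R y" "0 < t" "t \<le> 1"
  shows "sees x \<subseteq> sees y"
proof
  fix u assume "u \<in> sees x"
  then have u: "norm u = 1" "1 \<le> (1 - t) * (u \<bullet> z) + t * (u \<bullet> y)"
    using assms(2) by (auto simp: sees_def inner_add_right)
  have "u \<bullet> z \<le> 1" using norm_cauchy_schwarz[of u z] u(1) assms(1) by simp
  then have "(1 - t) * (u \<bullet> z) \<le> 1 - t"
    using assms(4) mult_left_mono[of "u \<bullet> z" 1 "1 - t"] by simp
  then have "t * 1 \<le> t * (u \<bullet> y)" using u(2) by simp
  then show "u \<in> sees y" using u(1) assms(3) by (simp add: sees_def)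
qed

text \<open>If the line meets the ball, but only outside the segment, then the nearer end lies
  between a point of the ball and the farther end, and its cap is nested by
  \<open>sees_subset_beyond\<close>.\<close>

lemma unnested_cases:
  assumes "unnested x y"
  shows "(\<exists>z\<in>closed_segment x y. norm z \<le> 1) \<or> (\<forall>t. 1 < norm (x + t *\<^sub>R (y - x)))"
proof (rule ccontr)
  assume neg: "\<not> ?thesis"
  then have "\<not> (\<forall>t. 1 < norm (x + t *\<^sub>R (y - x)))" by simp
  then obtain t where "norm (x + t *\<^sub>R (y - x)) \<le> 1"
    by (auto simp: not_less)
  then obtain z where z: "z = x + t *\<^sub>R (y - x)" and t: "norm z \<le> 1" by blast
  have "\<not> (0 \<le> t \<and> t \<le> 1)"
  proof
    assume t01: "0 \<le> t \<and> t \<le> 1"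
    have "z = (1 - t) *\<^sub>R x + t *\<^sub>R y" by (simp add: z algebra_simps)
    then have "z \<in> closed_segment x y" unfolding closed_segment_def using t01 by blast
    then show False using neg t by blast
  qed
  then consider "t < 0" | "1 < t" by linarith
  then show False
  proof cases
    case 1
    have "x = (1 - (- t / (1 - t))) *\<^sub>R z + (- t / (1 - t)) *\<^sub>R y"
    proof -
      have "(1 - t) *\<^sub>R x = z - t *\<^sub>R y" by (simp add: z algebra_simps)
      then have "inverse (1 - t) *\<^sub>R ((1 - t) *\<^sub>R x) = inverse (1 - t) *\<^sub>R (z - t *\<^sub>R y)" by simp
      moreover have "1 - (- t / (1 - t)) = inverse (1 - t)" using 1 by (simp add: field_simps)
      ultimately show ?thesis using 1 by (simp add: scaleR_diff_right divide_inverse mult.commute)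
    qed
    then have "sees x \<subseteq> sees y"
      using 1 t by (intro sees_subset_beyond[of z _ "- t / (1 - t)"]) (auto simp: field_simps)
    then show False using assms by (simp add: unnested_def)
  next
    case 2
    have "y = (1 - (t - 1) / t) *\<^sub>R z + ((t - 1) / t) *\<^sub>R x"
    proof -
      have "t *\<^sub>R y = z + (t - 1) *\<^sub>R x" by (simp add: z algebra_simps)
      then have "inverse t *\<^sub>R (t *\<^sub>R y) = inverse t *\<^sub>R (z + (t - 1) *\<^sub>R x)" by simp
      moreover have "1 - (t - 1) / t = inverse t" using 2 by (simp add: field_simps)
      ultimately show ?thesis using 2 by (simp add: scaleR_add_right divide_inverse mult.commute)
    qed
    then have "sees y \<subseteq> sees x"
      using 2 t by (intro sees_subset_beyond[of z _ "(t - 1) / t"]) (auto simp: field_simps)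
    then show False using assms by (simp add: unnested_def)
  qed
qed

text \<open>From inside the open ball nothing is seen, and an empty cap is nested in every other
  one.\<close>

lemma unnested_norm_ge:
  fixes x :: "'a::real_inner"
  shows "unnested x y \<Longrightarrow> 1 \<le> norm x \<and> 1 \<le> norm y"
  unfolding unnested_def sees_def
proof -
  have "1 \<le> norm w" if "norm u = 1" "1 \<le> u \<bullet> w" for u w :: 'a
    using norm_cauchy_schwarz[of u w] that by simp
  then show "\<not> {u. norm u = 1 \<and> 1 \<le> u \<bullet> x} \<subseteq> {u. norm u = 1 \<and> 1 \<le> u \<bullet> y} \<and>
      \<not> {u. norm u = 1 \<and> 1 \<le> u \<bullet> y} \<subseteq> {u. norm u = 1 \<and> 1 \<le> u \<bullet> x} \<Longrightarrow> 1 \<le> norm x \<and> 1 \<le> norm y"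
    by blast
qed

text \<open>The signs \<open>a \<le> 0 \<le> b\<close> say that the foot of the perpendicular from
  the origin lies on the segment. Its distance from the origin is at most \<open>norm z\<close>,
  hence at most 1, so by Pythagoras the distances \<open>- a / D\<close> and \<open>b / D\<close>
  from the foot to the ends are at least the tangent lengths.\<close>

lemma unnested_segment_meets_ball:
  fixes x y :: "'a::real_inner"
  assumes un: "unnested x y" and z: "z \<in> closed_segment x y" "norm z \<le> 1"
  shows "sqrt ((norm x)\<^sup>2 - 1) + sqrt ((norm y)\<^sup>2 - 1) \<le> dist x y"
proof -
  define v where "v = y - x"
  define a where "a = v \<bullet> x"
  define b where "b = v \<bullet> y"
  define D where "D = norm v"
  obtain s where s: "0 \<le> s" "s \<le> 1" "z = x + s *\<^sub>R v"
    using z(1) by (auto simp: closed_segment_def v_def algebra_simps)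
  have "x \<noteq> y" using un by (auto simp: unnested_def)
  then have D: "0 < D" by (simp add: D_def v_def)
  have DD: "v \<bullet> v = D * D" by (simp add: D_def dot_square_norm power2_eq_square)
  have ba: "b - a = D * D" unfolding DD[symmetric] by (simp add: a_def b_def v_def inner_diff_right)
  have z1: "z \<bullet> z \<le> 1" using z(2) by (simp add: dot_square_norm power_le_one)
  have nx: "1 \<le> norm x" "1 \<le> norm y" using unnested_norm_ge[OF un] by auto
  \<comment> \<open>A point of the unit sphere sees only itself.\<close>
  have touch: "sees p \<subseteq> sees q" if "norm p = 1" "1 \<le> p \<bullet> q" for p q :: 'a
  proof
    fix u assume u: "u \<in> sees p"
    then have "u \<bullet> p = norm u * norm p"
      using norm_cauchy_schwarz[of u p] that(1) by (simp add: sees_def)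
    then have "u = p" using norm_cauchy_schwarz_eq[of u p] u that(1) by (simp add: sees_def)
    then show "u \<in> sees q" using that by (simp add: sees_def)
  qed
  have zx: "z \<bullet> z = x \<bullet> x + 2 * s * a + s * s * (D * D)"
    by (simp add: s(3) a_def inner_add_left inner_add_right DD[symmetric] inner_commute)
  have zy: "z \<bullet> z = y \<bullet> y - 2 * (1 - s) * b + (1 - s) * (1 - s) * (D * D)"
  proof -
    have z: "z = y - (1 - s) *\<^sub>R v" by (simp add: s(3) v_def algebra_simps)
    show ?thesis
      unfolding z b_def DD[symmetric]
      by (simp add: inner_diff_left inner_diff_right inner_commute)
  qed
  \<comment> \<open>If the norm increased from \<open>x\<close> towards \<open>z\<close>, then
    \<open>x\<close> would have norm one and its cap, the single point \<open>x\<close>, would be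
    seen from \<open>y\<close>.\<close>
  have a: "a \<le> 0"
  proof (rule ccontr)
    assume "\<not> a \<le> 0"
    then have "0 \<le> 2 * s * a + s * s * (D * D)" using s by simp
    then have "x \<bullet> x \<le> 1" using zx z1 by linarith
    then have "norm x \<le> 1" by (simp add: norm_eq_sqrt_inner)
    then have "norm x = 1" using nx by simp
    moreover have "x \<bullet> y = x \<bullet> x + a" by (simp add: a_def v_def inner_diff_left inner_diff_right inner_commute)
    ultimately have "sees x \<subseteq> sees y"
      using \<open>\<not> a \<le> 0\<close> by (intro touch) (simp_all add: dot_square_norm)
    then show False using un by (simp add: unnested_def)
  qed
  have b: "0 \<le> b"
  proof (rule ccontr)
    assume "\<not> 0 \<le> b"
    then have "0 \<le> (1 - s) * (- b)" using s by (intro mult_nonneg_nonneg) auto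
    moreover have "0 \<le> (1 - s) * (1 - s) * (D * D)" by simp
    ultimately have "y \<bullet> y \<le> 1" using zy z1 by linarith
    then have "norm y \<le> 1" by (simp add: norm_eq_sqrt_inner)
    then have "norm y = 1" using nx by simp
    moreover have "y \<bullet> x = y \<bullet> y - b" by (simp add: b_def v_def inner_diff_left inner_diff_right inner_commute)
    ultimately have "sees y \<subseteq> sees x"
      using \<open>\<not> 0 \<le> b\<close> by (intro touch) (simp_all add: dot_square_norm)
    then show False using un by (simp add: unnested_def)
  qed
  have "sqrt ((norm x)\<^sup>2 - 1) \<le> - a / D"
  proof (rule real_le_lsqrt)
    have "(a + s * (D * D))\<^sup>2 = (z \<bullet> z) * (D * D) - (x \<bullet> x) * (D * D) + a\<^sup>2"
      by (simp add: zx power2_eq_square algebra_simps)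
    then have "(x \<bullet> x) * (D * D) - a\<^sup>2 \<le> (z \<bullet> z) * (D * D)"
      using zero_le_power2[of "a + s * (D * D)"] by linarith
    also have "\<dots> \<le> 1 * (D * D)" using z1 by (rule mult_right_mono) simp
    finally have "(x \<bullet> x - 1) * (D * D) \<le> a\<^sup>2" by (simp add: algebra_simps)
    then show "(norm x)\<^sup>2 - 1 \<le> (- a / D)\<^sup>2"
      using D by (simp add: dot_square_norm power_divide pos_le_divide_eq power2_eq_square[of D])
  qed (use a D in \<open>auto simp: divide_le_0_iff\<close>)
  moreover have "sqrt ((norm y)\<^sup>2 - 1) \<le> b / D"
  proof (rule real_le_lsqrt)
    have "(b - (1 - s) * (D * D))\<^sup>2 = (z \<bullet> z) * (D * D) - (y \<bullet> y) * (D * D) + b\<^sup>2"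
      by (simp add: zy power2_eq_square algebra_simps)
    then have "(y \<bullet> y) * (D * D) - b\<^sup>2 \<le> (z \<bullet> z) * (D * D)"
      using zero_le_power2[of "b - (1 - s) * (D * D)"] by linarith
    also have "\<dots> \<le> 1 * (D * D)" using z1 by (rule mult_right_mono) simp
    finally have "(y \<bullet> y - 1) * (D * D) \<le> b\<^sup>2" by (simp add: algebra_simps)
    then show "(norm y)\<^sup>2 - 1 \<le> (b / D)\<^sup>2"
      using D by (simp add: dot_square_norm power_divide pos_le_divide_eq power2_eq_square[of D])
  qed (use b D in auto)
  ultimately have "sqrt ((norm x)\<^sup>2 - 1) + sqrt ((norm y)\<^sup>2 - 1) \<le> (b - a) / D"
    by (simp add: diff_divide_distrib)
  also have "\<dots> = dist x y"
    using D by (simp add: ba D_def v_def dist_norm norm_minus_commute)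
  finally show ?thesis .
qed

section \<open>Counting how often a direction enters and leaves view\<close>

text \<open>The number of changes is the total variation of the indicator of \<open>P\<close>: on
  the way from the head to an element with \<open>P\<close>, and again from there to the last one,
  it is at least 1 minus the indicator at the end.\<close>

lemma changes_count:
  assumes "\<exists>x\<in>set xs. P x"
  shows "2 \<le> edge_sum (\<lambda>x y. of_bool (P x \<noteq> P y)) xs + of_bool (P (hd xs)) + of_bool (P (last xs))"
proof -
  obtain as x bs where xs: "xs = as @ x # bs" "P x" using assms by (metis split_list)
  have eq: "(\<lambda>x y. of_bool (P x \<noteq> P y) :: real) = (\<lambda>x y. \<bar>of_bool (P x) - of_bool (P y)\<bar>)"
    by (auto simp: fun_eq_iff)
  show ?thesis
    using edge_sum_ge_abs_diff[of "as @ [x]" "\<lambda>x. of_bool (P x)"]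
      edge_sum_ge_abs_diff[of "x # bs" "\<lambda>x. of_bool (P x)"] xs(2)
    unfolding eq xs(1) edge_sum_append[of _ as x bs]
    by (cases as) (auto split: if_splits simp del: edge_sum.simps)
qed

text \<open>If the common end satisfies \<open>P\<close>, the changes of the negation are counted
  instead; for this some element must fail \<open>P\<close>.\<close>

lemma changes_count_closed:
  assumes "\<exists>x\<in>set xs. P x" "\<exists>x\<in>set xs. \<not> P x" "hd xs = last xs"
  shows "2 \<le> edge_sum (\<lambda>x y. of_bool (P x \<noteq> P y)) xs"
proof (cases "P (hd xs)")
  case True
  then show ?thesis using changes_count[of xs "\<lambda>x. \<not> P x"] assms by simp
next
  case False
  then show ?thesis using changes_count[of xs P] assms by simp
qed

lemma edge_sum_measure:
  assumes "finite_measure M" "\<And>x. x \<in> set xs \<Longrightarrow> A x \<in> sets M"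
  shows "integrable M (\<lambda>\<omega>. edge_sum (\<lambda>x y. of_bool ((\<omega> \<in> A x) \<noteq> (\<omega> \<in> A y))) xs)
    \<and> (LINT \<omega>|M. edge_sum (\<lambda>x y. of_bool ((\<omega> \<in> A x) \<noteq> (\<omega> \<in> A y))) xs)
      = edge_sum (\<lambda>x y. measure M (sym_diff (A x) (A y))) xs"
  using assms(2)
proof (induction xs rule: induct_list012)
  case (3 x y zs)
  interpret finite_measure M by fact
  have S: "sym_diff (A x) (A y) \<in> sets M" using 3 by auto
  have eq: "(of_bool ((\<omega> \<in> A x) \<noteq> (\<omega> \<in> A y)) :: real) = indicator (sym_diff (A x) (A y)) \<omega>" for \<omega>
    by (auto simp: indicator_def)
  have "integrable M (indicator (sym_diff (A x) (A y)) :: _ \<Rightarrow> real)"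
    using S by (simp add: emeasure_eq_measure)
  moreover have "(LINT \<omega>|M. indicator (sym_diff (A x) (A y)) \<omega> :: real) = measure M (sym_diff (A x) (A y))"
    using S sets.Int_space_eq2 by (metis Bochner_Integration.integral_indicator scaleR_one mult.right_neutral)
  moreover have "integrable M (\<lambda>\<omega>. edge_sum (\<lambda>x y. of_bool ((\<omega> \<in> A x) \<noteq> (\<omega> \<in> A y))) (y # zs))
    \<and> (LINT \<omega>|M. edge_sum (\<lambda>x y. of_bool ((\<omega> \<in> A x) \<noteq> (\<omega> \<in> A y))) (y # zs))
      = edge_sum (\<lambda>x y. measure M (sym_diff (A x) (A y))) (y # zs)"
    using 3 by simp
  ultimately show ?case unfolding edge_sum.simps(1) eq by simp
qed auto

lemma measure_changes_open:
  assumes M: "finite_measure M" "\<And>x. x \<in> set xs \<Longrightarrow> A x \<in> sets M" and "xs \<noteq> []"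
    and cover: "\<And>\<omega>. \<omega> \<in> space M \<Longrightarrow> \<exists>x\<in>set xs. \<omega> \<in> A x"
  shows "2 * measure M (space M) \<le> edge_sum (\<lambda>x y. measure M (sym_diff (A x) (A y))) xs
    + measure M (A (hd xs)) + measure M (A (last xs))"
proof -
  interpret finite_measure M by fact
  let ?e = "\<lambda>\<omega>. edge_sum (\<lambda>x y. of_bool ((\<omega> \<in> A x) \<noteq> (\<omega> \<in> A y))) xs"
  have A: "A (hd xs) \<in> sets M" "A (last xs) \<in> sets M" using M(2) assms(3) by auto
  have int: "integrable M ?e" "integral\<^sup>L M ?e = edge_sum (\<lambda>x y. measure M (sym_diff (A x) (A y))) xs"
    using edge_sum_measure[of M xs A] M by blast+
  have ind: "integrable M (indicator (A x) :: _ \<Rightarrow> real)" "(LINT \<omega>|M. indicator (A x) \<omega> :: real) = measure M (A x)"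
    if "A x \<in> sets M" for x
    using that sets.Int_space_eq2 by (auto simp: emeasure_eq_measure)
  have "(LINT \<omega>|M. 2) \<le> (LINT \<omega>|M. ?e \<omega> + indicator (A (hd xs)) \<omega> + indicator (A (last xs)) \<omega>)"
  proof (rule integral_mono)
    fix \<omega> assume "\<omega> \<in> space M"
    then show "2 \<le> ?e \<omega> + indicator (A (hd xs)) \<omega> + indicator (A (last xs)) \<omega>"
      using changes_count[OF cover] by (simp add: indicator_def of_bool_def)
  qed (use int ind A in auto)
  then show ?thesis
    using int ind A by (simp add: mult.commute)
qed

lemma measure_changes_closed:
  assumes M: "finite_measure M" "\<And>x. x \<in> set xs \<Longrightarrow> A x \<in> sets M" and "hd xs = last xs"
    and cover: "\<And>\<omega>. \<omega> \<in> space M \<Longrightarrow> \<exists>x\<in>set xs. \<omega> \<in> A x"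
    and miss: "\<And>\<omega>. \<omega> \<in> space M \<Longrightarrow> \<exists>x\<in>set xs. \<omega> \<notin> A x"
  shows "2 * measure M (space M) \<le> edge_sum (\<lambda>x y. measure M (sym_diff (A x) (A y))) xs"
proof -
  interpret finite_measure M by fact
  let ?e = "\<lambda>\<omega>. edge_sum (\<lambda>x y. of_bool ((\<omega> \<in> A x) \<noteq> (\<omega> \<in> A y))) xs"
  have int: "integrable M ?e" "integral\<^sup>L M ?e = edge_sum (\<lambda>x y. measure M (sym_diff (A x) (A y))) xs"
    using edge_sum_measure[of M xs A] M by blast+
  have "(LINT \<omega>|M. 2) \<le> integral\<^sup>L M ?e"
    using int(1) changes_count_closed[OF cover miss assms(3)] by (intro integral_mono) auto
  then show ?thesis using int by (simp add: mult.commute)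
qed

section \<open>The planar inradius bound\<close>

text \<open>The image of \<open>{l..r}\<close> on the circle, represented in one period; the
  interval may be longer than a period.\<close>

definition wrapped :: "real \<Rightarrow> real \<Rightarrow> real set" where
  "wrapped l r = {t\<in>{0..2 * pi}. \<exists>n::int. t + 2 * pi * of_int n \<in> {l..r}}"

text \<open>The interval is cut at the multiples \<open>s k\<close> of the period.
  \<open>T k\<close> is the \<open>k\<close>-th piece moved back to \<open>{0..2 * pi}\<close>; its
  length is at most the increment of \<open>clamp\<close> from \<open>s k\<close> to
  \<open>s (Suc k)\<close>, and the increments telescope. \<open>K\<close> is large enough for the
  periods to cover \<open>{l..r}\<close>.\<close>

lemma
  assumes "l \<le> r"
  shows wrapped_measurable: "wrapped l r \<in> sets lborel"
    and measure_wrapped_le: "measure lborel (wrapped l r) \<le> r - l"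
proof -
  define K where "K = nat \<lceil>(\<bar>l\<bar> + \<bar>r\<bar>) / (2 * pi)\<rceil> + 1"
  define s where "s k = 2 * pi * (real k - real K)" for k
  define T where "T k = {max 0 (l - s k)..min (2 * pi) (r - s k)}" for k
  define clamp where "clamp t = min r (max l t)" for t
  have "(\<bar>l\<bar> + \<bar>r\<bar>) / (2 * pi) \<le> real K - 1"
    unfolding K_def by linarith
  then have K: "\<bar>l\<bar> + \<bar>r\<bar> \<le> 2 * pi * (real K - 1)"
    by (simp add: pos_divide_le_eq mult.commute)
  have eq: "wrapped l r = (\<Union>k<2 * K. T k)"
  proof (intro equalityI subsetI)
    fix t assume "t \<in> wrapped l r"
    then obtain n :: int where t: "0 \<le> t" "t \<le> 2 * pi" "l \<le> t + 2 * pi * of_int n" "t + 2 * pi * of_int n \<le> r"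
      by (auto simp: wrapped_def)
    have "2 * pi * (- real K) \<le> 2 * pi * of_int n"
      using t K by (simp add: algebra_simps)
    then have "- real K \<le> of_int n" by (rule mult_left_le_imp_le) simp
    then have 1: "- int K \<le> n" by linarith
    have "2 * pi * of_int n \<le> 2 * pi * (real K - 1)"
      using t K by linarith
    then have "of_int n \<le> real K - 1" by (rule mult_left_le_imp_le) simp
    then have 2: "n < int K" by linarith
    have "real (nat (n + int K)) - real K = of_int n" using 1 by simp
    then have "t \<in> T (nat (n + int K))" using t by (simp add: T_def s_def)
    moreover have "nat (n + int K) < 2 * K" using 1 2 by linarith
    ultimately show "t \<in> (\<Union>k<2 * K. T k)" by blast
  next
    fix t assume "t \<in> (\<Union>k<2 * K. T k)"
    then obtain k where t: "t \<in> T k" by blast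
    have "of_int (int k - int K) = real k - real K" by simp
    then have "t + 2 * pi * of_int (int k - int K) \<in> {l..r}"
      using t unfolding T_def s_def by simp
    then have "\<exists>n::int. t + 2 * pi * of_int n \<in> {l..r}" by blast
    then show "t \<in> wrapped l r" using t by (auto simp: wrapped_def T_def)
  qed
  show "wrapped l r \<in> sets lborel" by (simp add: eq T_def)
  have "measure lborel (wrapped l r) \<le> (\<Sum>k<2 * K. measure lborel (T k))"
    unfolding eq by (intro measure_UNION_le) (auto simp: T_def)
  also have "\<dots> \<le> (\<Sum>k<2 * K. clamp (s (Suc k)) - clamp (s k))"
  proof (intro sum_mono)
    fix k
    have "s (Suc k) = s k + 2 * pi" by (simp add: s_def algebra_simps)
    moreover have "(if x \<le> y then y - x else 0) \<le> min r (max l (c + 2 * pi)) - min r (max l c)"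
      if "x = max 0 (l - c)" "y = min (2 * pi) (r - c)" for c x y
      using assms that by (auto simp: max_def min_def) (insert pi_gt_zero, linarith+)
    ultimately show "measure lborel (T k) \<le> clamp (s (Suc k)) - clamp (s k)"
      unfolding T_def clamp_def content_real_if by simp
  qed
  also have "\<dots> = clamp (s (2 * K)) - clamp (s 0)" by (rule sum_lessThan_telescope)
  also have "\<dots> \<le> r - l" using assms by (auto simp: clamp_def)
  finally show "measure lborel (wrapped l r) \<le> r - l" .
qed

lemma cos_ge_cos_iff:
  assumes "0 \<le> a" "a \<le> pi"
  shows "cos a \<le> cos t \<longleftrightarrow> (\<exists>n::int. \<bar>t + 2 * pi * of_int n\<bar> \<le> a)"
proof
  assume le: "cos a \<le> cos t"
  obtain y where y: "- pi < y" "y \<le> pi" "sin y = sin t" "cos y = cos t"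
    using sincos_principal_value[of t] by blast
  then obtain n :: int where n: "y = t + 2 * pi * of_int n"
    using sin_cos_eq_iff[of y t] by auto
  have "cos a \<le> cos \<bar>y\<bar>" using le y by simp
  then have "\<bar>y\<bar> \<le> a" using cos_mono_le_eq[of a "\<bar>y\<bar>"] assms y by simp
  then show "\<exists>n::int. \<bar>t + 2 * pi * of_int n\<bar> \<le> a" using n by blast
next
  assume "\<exists>n::int. \<bar>t + 2 * pi * of_int n\<bar> \<le> a"
  then obtain n :: int where n: "\<bar>t + 2 * pi * of_int n\<bar> \<le> a" by blast
  have "cos a \<le> cos \<bar>t + 2 * pi * of_int n\<bar>"
    using n assms by (intro cos_monotone_0_pi_le) auto
  also have "\<dots> = cos t" by (simp add: cos_add)
  finally show "cos a \<le> cos t" .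
qed

text \<open>For \<open>1 \<le> norm x\<close> this is \<open>arccos (1 / norm x)\<close>, the
  angular radius of the cap. The argument of \<open>arctan\<close> is the tangent length, the
  quantity it will be compared with.\<close>

definition half_angle :: "'a::real_normed_vector \<Rightarrow> real" where
  "half_angle x = arctan (sqrt ((norm x)\<^sup>2 - 1))"

lemma half_angle_bounds: "1 \<le> norm x \<Longrightarrow> 0 \<le> half_angle x \<and> half_angle x < pi / 2"
  using arctan_ubound[of "sqrt ((norm x)\<^sup>2 - 1)"] by (simp add: half_angle_def)

lemma cos_half_angle:
  assumes "1 \<le> norm x"
  shows "cos (half_angle x) = 1 / norm x"
  using assms by (simp add: half_angle_def cos_arctan)

lemma cis_sees_iff:
  assumes "1 \<le> norm x" "x = norm x *\<^sub>R cis p"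
  shows "cis t \<in> sees x \<longleftrightarrow> (\<exists>n::int. t + 2 * pi * of_int n \<in> {p - half_angle x..p + half_angle x})"
proof -
  have "cis t \<bullet> x = norm x * cos (t - p)"
    by (subst assms(2)) (simp add: inner_complex_def cos_diff algebra_simps)
  then have "cis t \<in> sees x \<longleftrightarrow> cos (half_angle x) \<le> cos (t - p)"
    using assms(1) by (simp add: sees_def cos_half_angle divide_le_eq mult.commute) (auto simp: mult.commute)
  also have "\<dots> \<longleftrightarrow> (\<exists>n::int. \<bar>t - p + 2 * pi * of_int n\<bar> \<le> half_angle x)"
    using half_angle_bounds[OF assms(1)] by (intro cos_ge_cos_iff) auto
  also have "\<dots> \<longleftrightarrow> (\<exists>n::int. t + 2 * pi * of_int n \<in> {p - half_angle x..p + half_angle x})"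
    by (intro arg_cong[where f=Ex] ext) (auto simp: abs_le_iff algebra_simps)
  finally show ?thesis .
qed

definition arc :: "complex \<Rightarrow> real set" where
  "arc x = {t\<in>{0..2 * pi}. cis t \<in> sees x}"

lemma arc_eq_wrapped:
  assumes "1 \<le> norm x" "x = norm x *\<^sub>R cis p"
  shows "arc x = wrapped (p - half_angle x) (p + half_angle x)"
  unfolding arc_def wrapped_def cis_sees_iff[OF assms] ..

lemma
  assumes "1 \<le> norm x"
  shows arc_measurable: "arc x \<in> sets lborel"
    and measure_arc_le: "measure lborel (arc x) \<le> 2 * half_angle x"
proof -
  have x: "x = norm x *\<^sub>R cis (Arg x)"
    using rcis_cmod_Arg[of x] by (simp add: rcis_def scaleR_conv_of_real)
  note eq = arc_eq_wrapped[OF assms x]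
  have le: "Arg x - half_angle x \<le> Arg x + half_angle x" using half_angle_bounds[OF assms] by simp
  show "arc x \<in> sets lborel" "measure lborel (arc x) \<le> 2 * half_angle x"
    using wrapped_measurable[OF le] measure_wrapped_le[OF le] by (simp_all add: eq)
qed

text \<open>The arcs have centres \<open>p\<close>, \<open>p + b\<close> and half-angles
  \<open>\<alpha>\<close>, \<open>\<beta>\<close>. Being unnested forces the difference of the
  half-angles to be at most \<open>b\<close>, so both ends of the arc move forward. The symmetric
  difference lies in the two intervals swept by the ends, whose lengths add up to
  \<open>2 * b\<close>.\<close>

lemma measure_arc_diff_le:
  assumes un: "unnested x y" and x: "x = norm x *\<^sub>R cis p" and y: "y = norm y *\<^sub>R cis (p + b)" and b: "0 \<le> b"
  shows "measure lborel (sym_diff (arc x) (arc y)) \<le> 2 * b"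
proof -
  have nx: "1 \<le> norm x" "1 \<le> norm y" using unnested_norm_ge[OF un] by auto
  define \<alpha> where "\<alpha> = half_angle x"
  define \<beta> where "\<beta> = half_angle y"
  have sx: "cis t \<in> sees x \<longleftrightarrow> (\<exists>n::int. t + 2 * pi * of_int n \<in> {p - \<alpha>..p + \<alpha>})" for t
    using cis_sees_iff[OF nx(1) x] by (simp add: \<alpha>_def)
  have sy: "cis t \<in> sees y \<longleftrightarrow> (\<exists>n::int. t + 2 * pi * of_int n \<in> {p + b - \<beta>..p + b + \<beta>})" for t
    using cis_sees_iff[OF nx(2) y] by (simp add: \<beta>_def)
  have cis: "\<exists>t. u = cis t" if "u \<in> sees z" for u z :: complex
  proof
    have "rcis 1 (Arg u) = u" using that rcis_cmod_Arg[of u] unfolding sees_def by auto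
    then show "u = cis (Arg u)" by (simp add: rcis_def)
  qed
  have ab: "\<alpha> - \<beta> \<le> b"
  proof (rule ccontr)
    assume "\<not> \<alpha> - \<beta> \<le> b"
    then have "sees y \<subseteq> sees x"
    proof (intro subsetI)
      fix u assume u: "u \<in> sees y"
      then obtain t where t: "u = cis t" using cis by blast
      then obtain n :: int where "t + 2 * pi * of_int n \<in> {p + b - \<beta>..p + b + \<beta>}" using u sy by blast
      then have "t + 2 * pi * of_int n \<in> {p - \<alpha>..p + \<alpha>}" using \<open>\<not> \<alpha> - \<beta> \<le> b\<close> b by auto
      then show "u \<in> sees x" using sx t by blast
    qed
    then show False using un by (simp add: unnested_def)
  qed
  have ba: "\<beta> - \<alpha> \<le> b"
  proof (rule ccontr)
    assume "\<not> \<beta> - \<alpha> \<le> b"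
    then have "sees x \<subseteq> sees y"
    proof (intro subsetI)
      fix u assume u: "u \<in> sees x"
      then obtain t where t: "u = cis t" using cis by blast
      then obtain n :: int where "t + 2 * pi * of_int n \<in> {p - \<alpha>..p + \<alpha>}" using u sx by blast
      then have "t + 2 * pi * of_int n \<in> {p + b - \<beta>..p + b + \<beta>}" using \<open>\<not> \<beta> - \<alpha> \<le> b\<close> b by auto
      then show "u \<in> sees y" using sy t by blast
    qed
    then show False using un by (simp add: unnested_def)
  qed
  let ?A = "wrapped (p - \<alpha>) (p + b - \<beta>)" and ?B = "wrapped (p + \<alpha>) (p + b + \<beta>)"
  have le: "p - \<alpha> \<le> p + b - \<beta>" "p + \<alpha> \<le> p + b + \<beta>" using ab ba by auto
  have sets: "?A \<in> sets lborel" "?B \<in> sets lborel"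
    using wrapped_measurable[OF le(1)] wrapped_measurable[OF le(2)] by blast+
  have sub: "wrapped l r \<subseteq> {0..2 * pi}" for l r unfolding wrapped_def by (rule Collect_restrict)
  have fin: "{0..2 * pi} \<in> fmeasurable lborel" by (intro fmeasurableI) simp_all
  note meas = fmeasurableI2[OF fin sub sets(1)] fmeasurableI2[OF fin sub sets(2)]
  have arc: "arc x \<in> sets lborel" "arc y \<in> sets lborel"
    using arc_measurable nx by blast+
  have "sym_diff (arc x) (arc y) \<subseteq> ?A \<union> ?B"
  proof
    fix t assume "t \<in> sym_diff (arc x) (arc y)"
    then have t: "t \<in> {0..2 * pi}" and "cis t \<in> sees x \<and> cis t \<notin> sees y \<or> cis t \<in> sees y \<and> cis t \<notin> sees x"
      unfolding arc_def by blast+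
    then obtain n :: int where "t + 2 * pi * of_int n \<in> {p - \<alpha>..p + b - \<beta>} \<union> {p + \<alpha>..p + b + \<beta>}"
    proof (elim disjE conjE)
      assume *: "cis t \<in> sees x" "cis t \<notin> sees y"
      then obtain n :: int where n: "t + 2 * pi * of_int n \<in> {p - \<alpha>..p + \<alpha>}" using sx by blast
      moreover have "t + 2 * pi * of_int n \<notin> {p + b - \<beta>..p + b + \<beta>}" using * sy by blast
      ultimately have "t + 2 * pi * of_int n \<in> {p - \<alpha>..p + b - \<beta>}" using ab ba by auto
      then show thesis using that by blast
    next
      assume *: "cis t \<in> sees y" "cis t \<notin> sees x"
      then obtain n :: int where n: "t + 2 * pi * of_int n \<in> {p + b - \<beta>..p + b + \<beta>}" using sy by blast
      moreover have "t + 2 * pi * of_int n \<notin> {p - \<alpha>..p + \<alpha>}" using * sx by blast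
      ultimately have "t + 2 * pi * of_int n \<in> {p + \<alpha>..p + b + \<beta>}" using ab ba by auto
      then show thesis using that by blast
    qed
    then show "t \<in> ?A \<union> ?B" using t unfolding wrapped_def by blast
  qed
  then have "measure lborel (sym_diff (arc x) (arc y)) \<le> measure lborel (?A \<union> ?B)"
    using sets.Un[OF sets.Diff sets.Diff, OF arc arc(2,1)] fmeasurable.Un[OF meas]
    by (rule measure_mono_fmeasurable)
  also have "\<dots> \<le> measure lborel ?A + measure lborel ?B"
    using sets by (rule measure_Un_le)
  also have "\<dots> \<le> (p + b - \<beta> - (p - \<alpha>)) + (p + b + \<beta> - (p + \<alpha>))"
    using measure_wrapped_le[OF le(1)] measure_wrapped_le[OF le(2)] by (rule add_mono)
  finally show ?thesis by simp
qed

section \<open>A string stretched around a disc\<close>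

text \<open>The tangent length from \<open>x\<close> to the circle of radius \<open>r\<close>, minus
  the arc of that circle from the tangent point to the direction of \<open>x\<close>.\<close>

definition tangent_defect :: "real \<Rightarrow> 'a::real_normed_vector \<Rightarrow> real" where
  "tangent_defect r x = sqrt ((norm x)\<^sup>2 - r\<^sup>2) - r * arctan (sqrt ((norm x)\<^sup>2 - r\<^sup>2) / r)"

lemma tangent_defect_nonneg:
  assumes "0 < r" "r \<le> norm x"
  shows "0 \<le> tangent_defect r x"
proof -
  have "0 \<le> sqrt ((norm x)\<^sup>2 - r\<^sup>2)" using assms by simp
  then have "arctan (sqrt ((norm x)\<^sup>2 - r\<^sup>2) / r) \<le> sqrt ((norm x)\<^sup>2 - r\<^sup>2) / r"
    using assms by (intro arctan_le_self) simp
  then show ?thesis using assms by (simp add: tangent_defect_def field_simps)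
qed

lemma tangent_defect_self: "norm x = r \<Longrightarrow> tangent_defect r x = 0"
  by (simp add: tangent_defect_def)

text \<open>The function \<open>r * (polar angle) + tangent_defect r\<close> has gradient of norm one outside the disc
  of radius r: it is the length of a string wrapped around the disc.\<close>

lemma string_length_le:
  fixes d r t1 t2 :: real
  assumes "0 \<le> t1" "t1 \<le> t2" "0 < d" "0 < r" "r\<^sup>2 \<le> d\<^sup>2 + t1\<^sup>2"
  defines "h \<equiv> \<lambda>t. sqrt (d\<^sup>2 + t\<^sup>2 - r\<^sup>2) - r * arctan (sqrt (d\<^sup>2 + t\<^sup>2 - r\<^sup>2) / r)"
  shows "r * (arctan (t2 / d) - arctan (t1 / d)) + \<bar>h t2 - h t1\<bar> \<le> t2 - t1"
proof -
  \<comment> \<open>The two signs of \<open>e\<close> give the two signs of the absolute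
    value.\<close>
  have mono: "t1 - r * arctan (t1 / d) - e * h t1 \<le> t2 - r * arctan (t2 / d) - e * h t2" if e: "e = 1 \<or> e = -1" for e
  proof (rule DERIV_nonneg_imp_increasing_open[OF assms(2)])
    fix t assume t: "t1 < t" "t < t2"
    define q where "q = sqrt (d\<^sup>2 + t\<^sup>2 - r\<^sup>2)"
    have "t1\<^sup>2 < t\<^sup>2" using t assms(1) by (intro power_strict_mono) auto
    then have pos: "0 < d\<^sup>2 + t\<^sup>2 - r\<^sup>2" using assms(5) by simp
    then have q: "0 < q" "q\<^sup>2 = d\<^sup>2 + t\<^sup>2 - r\<^sup>2" by (simp_all add: q_def)
    have dq: "((\<lambda>t. sqrt (d\<^sup>2 + t\<^sup>2 - r\<^sup>2)) has_real_derivative t / q) (at t)"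
      using pos by (auto intro!: derivative_eq_intros simp: q_def field_simps)
    have den: "0 < d\<^sup>2 + t\<^sup>2" using assms(3) by (simp add: add_pos_nonneg)
    have "(h has_real_derivative t / q - r * (inverse (1 + (q / r)\<^sup>2) * (t / q / r))) (at t)"
      unfolding h_def q_def
      by (rule DERIV_diff[OF dq DERIV_cmult[OF DERIV_chain2[OF DERIV_arctan DERIV_cdivide[OF dq]]], unfolded q_def])
    moreover have "t / q - r * (inverse (1 + (q / r)\<^sup>2) * (t / q / r)) = t * q / (d\<^sup>2 + t\<^sup>2)"
    proof -
      have "1 + (q / r)\<^sup>2 = (d\<^sup>2 + t\<^sup>2) / r\<^sup>2"
        using assms(4) by (simp add: power_divide q(2) field_simps)
      then have "inverse (1 + (q / r)\<^sup>2) = r\<^sup>2 / (d\<^sup>2 + t\<^sup>2)" by simp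
      moreover have "r * (A * (B / r)) = A * B" for A B using assms(4) by simp
      ultimately have "t / q - r * (inverse (1 + (q / r)\<^sup>2) * (t / q / r)) = t / q * (1 - r\<^sup>2 / (d\<^sup>2 + t\<^sup>2))"
        by (simp only: right_diff_distrib mult_1_right) (simp only: mult.commute)
      also have "1 - r\<^sup>2 / (d\<^sup>2 + t\<^sup>2) = q\<^sup>2 / (d\<^sup>2 + t\<^sup>2)"
        using den by (metis diff_divide_distrib divide_self less_irrefl q(2))
      finally show ?thesis using q(1) by (simp add: power2_eq_square)
    qed
    ultimately have dh: "(h has_real_derivative t * q / (d\<^sup>2 + t\<^sup>2)) (at t)" by simp
    have da: "((\<lambda>t. arctan (t / d)) has_real_derivative d / (d\<^sup>2 + t\<^sup>2)) (at t)"
    proof -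
      have "((\<lambda>t. arctan (t / d)) has_real_derivative inverse (1 + (t / d)\<^sup>2) * (1 / d)) (at t)"
        using assms(3) by (auto intro!: derivative_eq_intros DERIV_chain2[OF DERIV_arctan])
      moreover have "1 + (t / d)\<^sup>2 = (d\<^sup>2 + t\<^sup>2) / d\<^sup>2" using assms(3) by (simp add: power_divide field_simps)
      ultimately show ?thesis using assms(3) by (simp add: power2_eq_square field_simps)
    qed
    \<comment> \<open>Since \<open>r\<^sup>2 + q\<^sup>2 = d\<^sup>2 + t\<^sup>2\<close>, the two
      arithmetic-geometric bounds add up exactly to the denominator of the derivative.\<close>
    have "r * d \<le> (r\<^sup>2 + d\<^sup>2) / 2" "\<bar>t * q\<bar> \<le> (t\<^sup>2 + q\<^sup>2) / 2"
      using sum_squares_bound[of r d] sum_squares_bound[of "\<bar>t\<bar>" "\<bar>q\<bar>"] by (auto simp: abs_mult)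
    then have "r * d + e * (t * q) \<le> d\<^sup>2 + t\<^sup>2" using e q(2) by (auto simp: abs_le_iff)
    then have "(r * d + e * (t * q)) / (d\<^sup>2 + t\<^sup>2) \<le> 1"
      using den by (simp add: divide_le_eq_1)
    then have "0 \<le> 1 - r * (d / (d\<^sup>2 + t\<^sup>2)) - e * (t * q / (d\<^sup>2 + t\<^sup>2))"
      by (simp add: add_divide_distrib)
    moreover have "((\<lambda>t. t - r * arctan (t / d) - e * h t) has_real_derivative
        1 - r * (d / (d\<^sup>2 + t\<^sup>2)) - e * (t * q / (d\<^sup>2 + t\<^sup>2))) (at t)"
      by (rule DERIV_diff[OF DERIV_diff[OF DERIV_ident DERIV_cmult[OF da]] DERIV_cmult[OF dh]])
    ultimately show "\<exists>y. ((\<lambda>t. t - r * arctan (t / d) - e * h t) has_real_derivative y) (at t) \<and> 0 \<le> y"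
      by blast
  next
    show "continuous_on {t1..t2} (\<lambda>t. t - r * arctan (t / d) - e * h t)"
      unfolding h_def using assms(3,4) by (intro continuous_intros) auto
  qed
  from mono[of 1] mono[of "-1"] show ?thesis by (auto simp: algebra_simps abs_le_iff)
qed

lemma string_length_le_signed:
  fixes d r t1 t2 :: real
  assumes "t1 \<le> t2" "0 < d" "0 < r" "\<And>t. t \<in> {t1..t2} \<Longrightarrow> r\<^sup>2 \<le> d\<^sup>2 + t\<^sup>2"
  defines "h \<equiv> \<lambda>t. sqrt (d\<^sup>2 + t\<^sup>2 - r\<^sup>2) - r * arctan (sqrt (d\<^sup>2 + t\<^sup>2 - r\<^sup>2) / r)"
  shows "r * (arctan (t2 / d) - arctan (t1 / d)) + \<bar>h t2 - h t1\<bar> \<le> t2 - t1"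
proof -
  have neg: "r * (arctan (s2 / d) - arctan (s1 / d)) + \<bar>h s2 - h s1\<bar> \<le> s2 - s1"
    if "s1 \<le> s2" "s2 \<le> 0" "r\<^sup>2 \<le> d\<^sup>2 + s2\<^sup>2" for s1 s2
    using string_length_le[of "- s2" "- s1" d r] that assms(2,3) unfolding h_def
    by (simp add: arctan_minus abs_minus_commute)
  have pos: "r * (arctan (s2 / d) - arctan (s1 / d)) + \<bar>h s2 - h s1\<bar> \<le> s2 - s1"
    if "s1 \<le> s2" "0 \<le> s1" "r\<^sup>2 \<le> d\<^sup>2 + s1\<^sup>2" for s1 s2
    using string_length_le[of s1 s2 d r] that assms(2,3) unfolding h_def by simp
  consider "0 \<le> t1" | "t2 \<le> 0" | "t1 \<le> 0" "0 \<le> t2" by linarith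
  then show ?thesis
  proof cases
    case 1
    then show ?thesis using pos[of t1 t2] assms(1,4) by auto
  next
    case 2
    then show ?thesis using neg[of t1 t2] assms(1,4) by auto
  next
    case 3
    have "r * (arctan (t2 / d) - arctan (0 / d)) + \<bar>h t2 - h 0\<bar> \<le> t2 - 0"
      using 3 assms(4)[of 0] by (intro pos) auto
    moreover have "r * (arctan (0 / d) - arctan (t1 / d)) + \<bar>h 0 - h t1\<bar> \<le> 0 - t1"
      using 3 assms(4)[of 0] by (intro neg) auto
    ultimately show ?thesis by (simp add: algebra_simps)
  qed
qed

text \<open>After a rotation the line is \<open>Re w = d\<close> with \<open>0 < d\<close>, where
  the polar angle is \<open>arctan (t / d)\<close>, and the string estimate is applied on both sides
  of \<open>z\<close>. If \<open>z\<close> is a nearest point on the circle of radius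
  \<open>r\<close>, its defect vanishes and both end defects appear with positive sign.\<close>

lemma unnested_edge_outside:
  fixes x y z :: complex
  assumes un: "unnested x y" and line: "\<And>t. 1 < norm (x + t *\<^sub>R (y - x))"
    and r: "0 < r" "\<And>w. w \<in> closed_segment x y \<Longrightarrow> r \<le> norm w" and z: "z \<in> closed_segment x y"
  shows "r / 2 * measure lborel (sym_diff (arc x) (arc y))
    + \<bar>tangent_defect r x - tangent_defect r z\<bar> + \<bar>tangent_defect r z - tangent_defect r y\<bar> \<le> dist x y"
proof -
  have main: "r / 2 * measure lborel (sym_diff (arc x) (arc y))
    + \<bar>tangent_defect r x - tangent_defect r z\<bar> + \<bar>tangent_defect r z - tangent_defect r y\<bar> \<le> dist x y"
    if un: "unnested x y" and r2: "\<And>w. w \<in> closed_segment x y \<Longrightarrow> r \<le> norm w" and z: "z \<in> closed_segment x y"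
      and c: "norm c = 1" "x = c * Complex d t1" "y = c * Complex d t2" "0 < d" "t1 \<le> t2"
    for x y c :: complex and d t1 t2 :: real
  proof -
    obtain s where s: "0 \<le> s" "s \<le> 1" "z = (1 - s) *\<^sub>R x + s *\<^sub>R y"
      using z unfolding closed_segment_def by blast
    define t0 where "t0 = (1 - s) * t1 + s * t2"
    have seg: "c * Complex d ((1 - s) * t1 + s * t2) = (1 - s) *\<^sub>R x + s *\<^sub>R y" for s
      by (simp add: c(2,3) complex_eq_iff algebra_simps)
    have z0: "z = c * Complex d t0" by (simp add: s(3) seg t0_def)
    have "t1 \<le> t0"
    proof -
      have "t0 = t1 + s * (t2 - t1)" by (simp add: t0_def algebra_simps)
      then show ?thesis using s c(5) by simp
    qed
    moreover have "t0 \<le> t2"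
    proof -
      have "t0 = t2 - (1 - s) * (t2 - t1)" by (simp add: t0_def algebra_simps)
      then show ?thesis using s c(5) by simp
    qed
    ultimately have t0: "t1 \<le> t0" "t0 \<le> t2" by auto
    have norm_c: "norm (c * Complex d t) = sqrt (d\<^sup>2 + t\<^sup>2)" for t
      using c(1) by (simp add: norm_mult complex_norm)
    have rt: "r\<^sup>2 \<le> d\<^sup>2 + t\<^sup>2" if t: "t \<in> {t1..t2}" for t
    proof -
      have "\<exists>s. 0 \<le> s \<and> s \<le> 1 \<and> t = (1 - s) * t1 + s * t2"
      proof (cases "t1 = t2")
        case False
        define s where "s = (t - t1) / (t2 - t1)"
        have "s * (t2 - t1) = t - t1" using False by (simp add: s_def)
        then have "t = (1 - s) * t1 + s * t2" by (simp add: algebra_simps)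
        moreover have "0 \<le> s" "s \<le> 1" using t c(5) False by (simp_all add: s_def)
        ultimately show ?thesis by blast
      qed (use t in auto)
      then have "c * Complex d t \<in> closed_segment x y" unfolding closed_segment_def using seg by auto
      from r2[OF this] have "r \<le> sqrt (d\<^sup>2 + t\<^sup>2)" by (simp add: norm_c)
      then show ?thesis using r(1) power_mono[of r "sqrt (d\<^sup>2 + t\<^sup>2)" 2] by simp
    qed
    define h where "h = (\<lambda>t. sqrt (d\<^sup>2 + t\<^sup>2 - r\<^sup>2) - r * arctan (sqrt (d\<^sup>2 + t\<^sup>2 - r\<^sup>2) / r))"
    have td: "tangent_defect r (c * Complex d t) = h t" for t
      by (simp add: tangent_defect_def norm_c h_def)
    have 1: "r * (arctan (t0 / d) - arctan (t1 / d)) + \<bar>h t0 - h t1\<bar> \<le> t0 - t1"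
      unfolding h_def using t0 c(4) r(1) rt by (intro string_length_le_signed) auto
    have 2: "r * (arctan (t2 / d) - arctan (t0 / d)) + \<bar>h t2 - h t0\<bar> \<le> t2 - t0"
      unfolding h_def using t0 c(4) r(1) rt by (intro string_length_le_signed) auto
    have polar: "c * Complex d t = norm (c * Complex d t) *\<^sub>R cis (Arg c + arctan (t / d))" for t
    proof -
      have "sqrt (1 + (t / d)\<^sup>2) = sqrt (d\<^sup>2 + t\<^sup>2) / d"
      proof -
        have "1 + (t / d)\<^sup>2 = (d\<^sup>2 + t\<^sup>2) / d\<^sup>2" using c(4) by (simp add: power_divide field_simps)
        then show ?thesis using c(4) by (simp add: real_sqrt_divide)
      qed
      moreover have "sqrt (d\<^sup>2 + t\<^sup>2) \<noteq> 0" using c(4) by (simp add: add_nonneg_eq_0_iff)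
      ultimately have "sqrt (d\<^sup>2 + t\<^sup>2) *\<^sub>R cis (arctan (t / d)) = Complex d t"
        using c(4) by (simp add: complex_eq_iff cos_arctan sin_arctan)
      moreover have "cis (Arg c) = c"
        using rcis_cmod_Arg[of c] c(1) by (simp add: rcis_def)
      ultimately show ?thesis
        by (simp add: norm_c flip: cis_mult) (metis mult_scaleR_right)
    qed
    define b where "b = arctan (t2 / d) - arctan (t1 / d)"
    have "0 \<le> b" using c(4,5) by (simp add: b_def arctan_monotone' divide_right_mono)
    moreover have "y = norm y *\<^sub>R cis (Arg c + arctan (t1 / d) + b)"
      using polar[of t2] by (simp add: c(3) b_def)
    ultimately have "measure lborel (sym_diff (arc x) (arc y)) \<le> 2 * b"
      using polar[of t1] by (intro measure_arc_diff_le[OF un]) (simp_all add: c(2))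
    then have "r / 2 * measure lborel (sym_diff (arc x) (arc y)) \<le> r / 2 * (2 * b)"
      using r(1) by (intro mult_left_mono) auto
    moreover have "dist x y = t2 - t1"
    proof -
      have "x - y = c * Complex 0 (t1 - t2)" by (simp add: c(2,3) complex_eq_iff algebra_simps)
      then show ?thesis using c(1,5) by (simp add: dist_norm norm_mult complex_norm)
    qed
    ultimately show ?thesis
      using 1 2 unfolding c(2,3) z0 td b_def by (simp add: algebra_simps abs_minus_commute)
  qed
  define v where "v = sgn (y - x)"
  have "x \<noteq> y" using un by (auto simp: unnested_def)
  then have v: "norm v = 1" "y = x + dist x y *\<^sub>R v"
    by (simp_all add: v_def norm_sgn sgn_div_norm dist_norm norm_minus_commute)
  define c where "c = - \<i> * v"
  have c: "norm c = 1" by (simp add: c_def norm_mult v)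
  then have cc: "c * cnj c = 1" by (simp add: complex_norm_square[symmetric])
  define d where "d = Re (cnj c * x)"
  define t where "t = Im (cnj c * x)"
  have x: "x = c * Complex d t"
  proof -
    have "Complex d t = cnj c * x" by (simp add: d_def t_def complex_eq_iff)
    then show ?thesis using cc by (metis mult.assoc mult_1)
  qed
  have vc: "v = c * \<i>" by (simp add: c_def complex_eq_iff)
  have y: "y = c * Complex d (t + dist x y)"
  proof -
    have "y = c * Complex d t + dist x y *\<^sub>R (c * \<i>)" using v(2) x vc by simp
    then show ?thesis by (simp add: complex_eq_iff algebra_simps)
  qed
  have "d \<noteq> 0"
  proof
    assume "d = 0"
    have "x + (- t / dist x y) *\<^sub>R (y - x) = x - t *\<^sub>R v"
      using \<open>x \<noteq> y\<close> v(2) by (metis (no_types, lifting) add_diff_cancel_left' diff_conv_add_uminus dist_eq_0_iff nonzero_eq_divide_eq scaleR_minus_left scaleR_scaleR)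
    also have "\<dots> = 0" unfolding vc using x \<open>d = 0\<close> by (simp add: complex_eq_iff)
    finally show False using line[of "- t / dist x y"] by simp
  qed
  show ?thesis
  proof (cases "0 < d")
    case True
    show ?thesis by (rule main[OF un r(2) z c x y True]) auto
  next
    \<comment> \<open>For negative \<open>d\<close> a half turn and an exchange of \<open>x\<close>
      and \<open>y\<close> restore the normal form.\<close>
    case False
    have x': "x = (- c) * Complex (- d) (- t)" and y': "y = (- c) * Complex (- d) (- t - dist x y)"
      using x y by (simp_all add: complex_eq_iff algebra_simps)
    have "unnested y x" using un by (auto simp: unnested_def)
    from main[OF this _ _ _ y' x'] show ?thesis
      using r(2) z c False \<open>d \<noteq> 0\<close>
      by (simp add: closed_segment_commute dist_commute Un_commute abs_minus_commute add.commute add.left_commute)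
  qed
qed

text \<open>Here the two caps may be disjoint, so their full measures are paid for. This is
  affordable because a tangent length is \<open>half_angle\<close> plus
  \<open>tangent_defect 1\<close>.\<close>

lemma unnested_edge_crossing:
  fixes x y :: complex
  assumes un: "unnested x y" and z: "z \<in> closed_segment x y" "norm z \<le> 1"
  shows "1 / 2 * measure lborel (sym_diff (arc x) (arc y)) + tangent_defect 1 x + tangent_defect 1 y \<le> dist x y"
proof -
  have nx: "1 \<le> norm x" "1 \<le> norm y" using unnested_norm_ge[OF un] by auto
  have arc: "arc x \<in> sets lborel" "arc y \<in> sets lborel" using arc_measurable nx by blast+
  have sub: "arc w \<subseteq> {0..2 * pi}" for w unfolding arc_def by (rule Collect_restrict)
  have fin: "{0..2 * pi} \<in> fmeasurable lborel" by (intro fmeasurableI) simp_all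
  note meas = fmeasurableI2[OF fin sub arc(1)] fmeasurableI2[OF fin sub arc(2)]
  have "sym_diff (arc x) (arc y) \<subseteq> arc x \<union> arc y" by auto
  then have "measure lborel (sym_diff (arc x) (arc y)) \<le> measure lborel (arc x \<union> arc y)"
    using sets.Un[OF sets.Diff sets.Diff, OF arc arc(2,1)] fmeasurable.Un[OF meas]
    by (rule measure_mono_fmeasurable)
  also have "\<dots> \<le> measure lborel (arc x) + measure lborel (arc y)"
    using arc by (rule measure_Un_le)
  also have "\<dots> \<le> 2 * half_angle x + 2 * half_angle y"
    using measure_arc_le[OF nx(1)] measure_arc_le[OF nx(2)] by (rule add_mono)
  finally have "1 / 2 * measure lborel (sym_diff (arc x) (arc y)) \<le> half_angle x + half_angle y" by simp
  then show ?thesis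
    using unnested_segment_meets_ball[OF un z] by (simp add: tangent_defect_def half_angle_def)
qed

text \<open>The minimum is at \<open>w = 1\<close>, where the derivative
  \<open>1 - 2 / (1 + w\<^sup>2)\<close> changes sign.\<close>

lemma diff_two_arctan_ge:
  fixes w :: real
  assumes "0 \<le> w"
  shows "1 - pi / 2 \<le> w - 2 * arctan w"
proof -
  define f where "f w = w - 2 * arctan w" for w :: real
  have df: "(f has_real_derivative 1 - 2 / (1 + t\<^sup>2)) (at t)" for t
    unfolding f_def by (auto intro!: derivative_eq_intros DERIV_arctan simp: divide_inverse)
  have den: "0 < 1 + t\<^sup>2" for t :: real by (simp add: add_pos_nonneg)
  have f1: "f 1 = 1 - pi / 2" by (simp add: f_def)
  show ?thesis
  proof (cases "1 \<le> w")
    case True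
    have "f 1 \<le> f w"
    proof (rule DERIV_nonneg_imp_nondecreasing[OF True])
      fix t :: real assume "1 \<le> t" "t \<le> w"
      then have "1 \<le> t\<^sup>2" by (simp add: one_le_power)
      then have "0 \<le> 1 - 2 / (1 + t\<^sup>2)" using den[of t] by (simp add: field_simps)
      then show "\<exists>y. (f has_real_derivative y) (at t) \<and> 0 \<le> y" using df by blast
    qed
    then show ?thesis by (simp only: f1 f_def[of w])
  next
    case False
    have "f 1 \<le> f w"
    proof (rule DERIV_nonpos_imp_nonincreasing[of w 1])
      fix t :: real assume "w \<le> t" "t \<le> 1"
      then have "t\<^sup>2 \<le> 1" using assms by (simp add: power_le_one)
      then have "1 - 2 / (1 + t\<^sup>2) \<le> 0" using den[of t] by (simp add: field_simps)
      then show "\<exists>y. (f has_real_derivative y) (at t) \<and> y \<le> 0" using df by blast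
    qed (use False in auto)
    then show ?thesis by (simp only: f1 f_def[of w])
  qed
qed

text \<open>The right side increases with \<open>r\<close>, its derivative being \<open>pi\<close>
  minus two angles of at most \<open>pi / 2\<close>. At \<open>r = 1\<close> it is
  \<open>pi + w - 2 * arctan w\<close> with \<open>w\<close> the tangent length. The two ends
  together give \<open>pi + 2\<close>.\<close>

lemma endpoint_contribution_ge:
  fixes x :: "'a::real_normed_vector"
  assumes "1 \<le> r" "r \<le> norm x"
  shows "pi / 2 + 1 \<le> r * (pi - half_angle x) + tangent_defect r x"
proof -
  define R where "R = norm x"
  define K where "K r = r * (pi - half_angle x) + (sqrt (R\<^sup>2 - r\<^sup>2) - r * arctan (sqrt (R\<^sup>2 - r\<^sup>2) / r))" for r
  have "K 1 \<le> K r"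
  proof (rule DERIV_nonneg_imp_increasing_open[OF assms(1)])
    fix t assume t: "1 < t" "t < r"
    define q where "q = sqrt (R\<^sup>2 - t\<^sup>2)"
    have "t\<^sup>2 < R\<^sup>2" using t assms by (intro power_strict_mono) (auto simp: R_def)
    then have q: "0 < q" "q\<^sup>2 = R\<^sup>2 - t\<^sup>2" by (simp_all add: q_def)
    have dq: "((\<lambda>t. sqrt (R\<^sup>2 - t\<^sup>2)) has_real_derivative - t / q) (at t)"
      using q by (auto intro!: derivative_eq_intros simp: q_def field_simps)
    have dqt: "((\<lambda>t. sqrt (R\<^sup>2 - t\<^sup>2) / t) has_real_derivative (- t / q * t - q * 1) / (t * t)) (at t)"
      using DERIV_divide[OF dq DERIV_ident] t by (simp add: q_def)
    have da: "((\<lambda>t. arctan (sqrt (R\<^sup>2 - t\<^sup>2) / t)) has_real_derivative - 1 / q) (at t)"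
    proof -
      have "((\<lambda>t. arctan (sqrt (R\<^sup>2 - t\<^sup>2) / t)) has_real_derivative
          inverse (1 + (q / t)\<^sup>2) * ((- t / q * t - q * 1) / (t * t))) (at t)" (is "(_ has_real_derivative ?D) _")
        using DERIV_chain2[OF DERIV_arctan dqt] by (simp add: q_def)
      moreover have 1: "inverse (1 + (q / t)\<^sup>2) = t\<^sup>2 / R\<^sup>2"
      proof -
        have "1 + (q / t)\<^sup>2 = R\<^sup>2 / t\<^sup>2" using t by (simp add: power_divide q(2) field_simps)
        then show ?thesis by simp
      qed
      moreover have 2: "(- t / q * t - q * 1) / (t * t) = - R\<^sup>2 / (q * t\<^sup>2)"
      proof -
        have "- t / q * t - q * 1 = - (t\<^sup>2 + q\<^sup>2) / q" using q(1) by (simp add: field_simps power2_eq_square)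
        also have "t\<^sup>2 + q\<^sup>2 = R\<^sup>2" by (simp add: q(2))
        finally show ?thesis by (simp add: power2_eq_square)
      qed
      moreover have 3: "t\<^sup>2 / R\<^sup>2 * (- R\<^sup>2 / (q * t\<^sup>2)) = - 1 / q"
      proof -
        have "R \<noteq> 0" using assms by (auto simp: R_def)
        then show ?thesis using t by simp
      qed
      moreover have "?D = - 1 / q" unfolding 1 2 by (rule 3)
      ultimately show ?thesis by (simp only:)
    qed
    have "(K has_real_derivative (1 * (pi - half_angle x) + (- t / q - (1 * arctan (sqrt (R\<^sup>2 - t\<^sup>2) / t) + (- 1 / q) * t)))) (at t)"
      unfolding K_def
      by (intro DERIV_add DERIV_cmult_right DERIV_ident DERIV_diff dq DERIV_mult da)
    then have "(K has_real_derivative (pi - half_angle x - arctan (q / t))) (at t)"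
      by (simp add: q_def)
    moreover have "0 \<le> pi - half_angle x - arctan (q / t)"
      using half_angle_bounds[of x] arctan_ubound[of "q / t"] assms by simp
    ultimately show "\<exists>y. (K has_real_derivative y) (at t) \<and> 0 \<le> y" by blast
  next
    show "continuous_on {1..r} K"
      unfolding K_def by (intro continuous_intros) auto
  qed
  moreover have "pi / 2 + 1 \<le> K 1"
  proof -
    have "K 1 = pi + (sqrt (R\<^sup>2 - 1) - 2 * arctan (sqrt (R\<^sup>2 - 1)))"
      by (simp add: K_def half_angle_def R_def)
    moreover have "0 \<le> sqrt (R\<^sup>2 - 1)" using assms by (simp add: R_def)
    ultimately show ?thesis using diff_two_arctan_ge[of "sqrt (R\<^sup>2 - 1)"] by simp
  qed
  ultimately show ?thesis by (simp add: K_def R_def tangent_defect_def)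
qed

lemma successively_mem_edge:
  assumes "successively P xs" "xs = as @ x # y # bs"
  shows "P x y"
  using assms by (simp add: successively_append_iff)

lemma successively_split:
  assumes "successively P xs" "xs = as @ x # y # bs"
  shows "successively P (as @ [x]) \<and> successively P (y # bs)"
  using assms by (simp add: successively_append_iff)

text \<open>The string is wound around a disc of radius \<open>r\<close>, adapted to the polygon.
  The edge estimates add up to \<open>r / 2\<close> times the total change of the caps plus the
  variation of the tangent defect; starting from an edge \<open>e\<close> nearest to the origin,
  this variation collects the defects of both ends with positive sign.\<close>

lemma planar_inradius_open:
  fixes xs :: "complex list"
  assumes "covering xs" "xs \<noteq> []"
  shows "pi + 2 \<le> edge_sum dist xs"
proof -
  obtain ys :: "complex list" where ys: "covering ys" "ys \<noteq> []" "successively unnested ys" "edge_sum dist ys \<le> edge_sum dist xs"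
    by (rule prune_open[OF assms])
  obtain y0 y1 ys' where ys_eq: "ys = y0 # y1 # ys'"
    by (rule covering_not_singleton[OF ys(1,2)])
  define E where "E = {(x, y). \<exists>as bs. ys = as @ x # y # bs}"
  have "ys = [] @ y0 # y1 # ys'" by (simp add: ys_eq)
  then have "(y0, y1) \<in> E" unfolding E_def by blast
  then have "E \<noteq> {}" by blast
  have "p \<in> set ys \<times> set ys" if pE: "p \<in> E" for p
  proof -
    obtain x y where p: "p = (x, y)" by (cases p)
    then obtain as bs where "ys = as @ x # y # bs" using pE unfolding E_def by blast
    then show ?thesis by (simp add: p)
  qed
  then have "E \<subseteq> set ys \<times> set ys" by blast
  then have "finite E" by (rule finite_subset) simp
  have unE: "unnested x y" if xyE: "(x, y) \<in> E" for x y
  proof -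
    obtain as bs where "ys = as @ x # y # bs" using xyE unfolding E_def by blast
    then show ?thesis by (rule successively_mem_edge[OF ys(3)])
  qed
  define m where "m = (\<lambda>(x, y). infdist (0 :: complex) (closed_segment x y))"
  obtain e where e: "e \<in> E" "\<And>e'. e' \<in> E \<Longrightarrow> m e \<le> m e'"
  proof -
    have "Min (m ` E) \<in> m ` E" using \<open>finite E\<close> \<open>E \<noteq> {}\<close> by (intro Min_in) auto
    then obtain e where "e \<in> E" "m e = Min (m ` E)" by (metis imageE)
    moreover have "Min (m ` E) \<le> m e'" if "e' \<in> E" for e' using that \<open>finite E\<close> by simp
    ultimately show thesis using that by simp
  qed
  obtain x y where xy: "e = (x, y)" by (cases e)
  obtain z where z: "z \<in> closed_segment x y" "norm z = m e"
  proof (rule infdist_attains_inf[of "closed_segment x y" 0])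
    fix w assume "w \<in> closed_segment x y" "infdist 0 (closed_segment x y) = dist 0 w"
    then show thesis using that by (simp add: m_def xy)
  qed simp_all
  have m_le: "m e \<le> norm w" if "w \<in> closed_segment x' y'" "(x', y') \<in> E" for w x' y'
  proof -
    have "m e \<le> infdist 0 (closed_segment x' y')" using e(2)[OF that(2)] by (simp add: m_def)
    also have "\<dots> \<le> dist 0 w" using that(1) by (rule infdist_le)
    finally show ?thesis by simp
  qed
  \<comment> \<open>If \<open>1 < m e\<close>, the polygon touches the circle of radius
    \<open>r\<close> at \<open>z\<close>; otherwise \<open>r = 1\<close> and the edge
    \<open>e\<close> meets the unit disc.\<close>
  define r where "r = max 1 (m e)"
  have r: "1 \<le> r" by (simp add: r_def)
  define \<mu> where "\<mu> x y = measure lborel (sym_diff (arc x) (arc y))" for x y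
  have r_le: "r \<le> norm w" if w: "w \<in> set ys" for w
  proof -
    obtain as bs where w: "ys = as @ w # bs" using split_list[OF w] by blast
    have "\<exists>v. (w, v) \<in> E \<or> (v, w) \<in> E"
    proof (cases bs)
      case (Cons b bs')
      then have "ys = as @ w # b # bs'" using w by simp
      then show ?thesis unfolding E_def by blast
    next
      case Nil
      then have "as \<noteq> []" using w ys_eq by auto
      then have "ys = butlast as @ last as # w # []" using w Nil by simp
      then show ?thesis unfolding E_def by blast
    qed
    then obtain v where "(w, v) \<in> E \<or> (v, w) \<in> E" by blast
    then have "1 \<le> norm w \<and> m e \<le> norm w"
    proof
      assume E: "(w, v) \<in> E"
      show ?thesis using unnested_norm_ge[OF unE[OF E]] m_le[OF _ E, of w] by simp
    next
      assume E: "(v, w) \<in> E"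
      show ?thesis using unnested_norm_ge[OF unE[OF E]] m_le[OF _ E, of w] by simp
    qed
    then show ?thesis by (simp add: r_def)
  qed
  have crossing: "1 / 2 * \<mu> x' y' + tangent_defect r x' + tangent_defect r y' \<le> dist x' y'"
    if "(x', y') \<in> E" "w \<in> closed_segment x' y'" "norm w \<le> 1" for x' y' w
  proof -
    have r1: "r = 1" using order_trans[OF m_le[OF that(2,1)] that(3)] unfolding r_def by (rule max_absorb1)
    show ?thesis unfolding r1 \<mu>_def by (rule unnested_edge_crossing[OF unE[OF that(1)] that(2,3)])
  qed
  have outside: "r / 2 * \<mu> x' y' + \<bar>tangent_defect r x' - tangent_defect r w\<bar>
      + \<bar>tangent_defect r w - tangent_defect r y'\<bar> \<le> dist x' y'"
    if E: "(x', y') \<in> E" and out: "\<And>v. v \<in> closed_segment x' y' \<Longrightarrow> 1 < norm v" and w: "w \<in> closed_segment x' y'" for x' y' w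
  proof -
    have "\<forall>t. 1 < norm (x' + t *\<^sub>R (y' - x'))"
      using unnested_cases[OF unE[OF E]] out by (meson not_le)
    moreover have "r \<le> norm v" if "v \<in> closed_segment x' y'" for v
      using m_le[OF that E] out[OF that] by (simp add: r_def)
    ultimately show ?thesis
      unfolding \<mu>_def using r by (intro unnested_edge_outside unE[OF E] w) simp_all
  qed
  have edge: "r / 2 * \<mu> x' y' + \<bar>tangent_defect r x' - tangent_defect r y'\<bar> \<le> dist x' y'"
    if "(x', y') \<in> E" for x' y'
  proof (cases "\<exists>w\<in>closed_segment x' y'. norm w \<le> 1")
    case True
    then obtain w where w: "w \<in> closed_segment x' y'" "norm w \<le> 1" by blast
    have r1: "r = 1" using order_trans[OF m_le[OF w(1) that] w(2)] unfolding r_def by (rule max_absorb1)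
    have "0 \<le> tangent_defect r x'" "0 \<le> tangent_defect r y'"
      using unnested_norm_ge[OF unE[OF that]] r1 by (auto intro: tangent_defect_nonneg)
    then show ?thesis using crossing[OF that w] r1 by (simp add: abs_le_iff)
  next
    case False
    then have "1 < norm v" if "v \<in> closed_segment x' y'" for v using that by (meson not_le)
    from outside[OF that this, of x'] show ?thesis by simp
  qed
  have xyE: "(x, y) \<in> E" using e(1) xy by simp
  \<comment> \<open>On the nearest edge both defects are gained instead of their difference: either
    the edge crosses the unit disc, or the defect vanishes at \<open>z\<close>.\<close>
  have special: "r / 2 * \<mu> x y + tangent_defect r x + tangent_defect r y \<le> dist x y"
  proof (cases "m e \<le> 1")
    case True
    then have "r = 1" by (simp add: r_def)
    then show ?thesis using crossing[OF xyE z(1)] z(2) True by simp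
  next
    case False
    then have "r = norm z" by (simp add: r_def z)
    then have "tangent_defect r z = 0" by (simp add: tangent_defect_self)
    moreover have "1 < norm v" if "v \<in> closed_segment x y" for v
      using m_le[OF that xyE] False by simp
    ultimately show ?thesis using outside[OF xyE _ z(1)] by simp
  qed
  obtain as bs where split: "ys = as @ x # y # bs" using xyE unfolding E_def by blast
  define h :: "complex \<Rightarrow> real" where "h = tangent_defect r"
  let ?f = "\<lambda>x y. r / 2 * \<mu> x y + \<bar>h x - h y\<bar>"
  have succ: "successively (\<lambda>x y. ?f x y \<le> dist x y) ys"
  proof (rule ccontr)
    assume "\<not> ?thesis"
    then obtain as v w bs where vw: "ys = as @ v # w # bs" "\<not> ?f v w \<le> dist v w"
      by (rule not_successively_split)
    from vw(1) have "(v, w) \<in> E" unfolding E_def by blast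
    from edge[OF this] have "?f v w \<le> dist v w" unfolding h_def .
    with vw(2) show False by (rule notE)
  qed
  have pieces: "successively (\<lambda>x y. ?f x y \<le> dist x y) (as @ [x])" "successively (\<lambda>x y. ?f x y \<le> dist x y) (y # bs)"
    using successively_split[OF succ split] by blast+
  have f: "edge_sum ?f zs = r / 2 * edge_sum \<mu> zs + edge_sum (\<lambda>x y. \<bar>h x - h y\<bar>) zs" for zs
    by (simp only: edge_sum_add edge_sum_mult)
  have "hd (as @ [x]) = hd ys" "last (y # bs) = last ys"
    unfolding split by (simp_all add: hd_append)
  then have "\<bar>h (hd ys) - h x\<bar> \<le> edge_sum (\<lambda>x y. \<bar>h x - h y\<bar>) (as @ [x])"
    "\<bar>h y - h (last ys)\<bar> \<le> edge_sum (\<lambda>x y. \<bar>h x - h y\<bar>) (y # bs)"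
    using edge_sum_ge_abs_diff[of "as @ [x]" h] edge_sum_ge_abs_diff[of "y # bs" h] by simp_all
  moreover have "edge_sum dist ys = edge_sum dist (as @ [x]) + dist x y + edge_sum dist (y # bs)"
    unfolding split using edge_sum_append[of _ as x "y # bs"] by simp
  moreover have "edge_sum \<mu> ys = edge_sum \<mu> (as @ [x]) + \<mu> x y + edge_sum \<mu> (y # bs)"
    unfolding split using edge_sum_append[of _ as x "y # bs"] by simp
  then have "r / 2 * edge_sum \<mu> ys = r / 2 * edge_sum \<mu> (as @ [x]) + r / 2 * \<mu> x y + r / 2 * edge_sum \<mu> (y # bs)"
    by (simp only: distrib_left)
  moreover note edge_sum_mono[OF pieces(1), unfolded f] edge_sum_mono[OF pieces(2), unfolded f]
    special[folded h_def]
  ultimately have main: "r / 2 * edge_sum \<mu> ys + h (hd ys) + h (last ys) \<le> edge_sum dist ys"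
    by linarith
  define M where "M = restrict_space lborel {0..2 * pi}"
  have sub: "arc w \<subseteq> {0..2 * pi}" for w unfolding arc_def by (rule Collect_restrict)
  have sets_M: "A \<in> sets M \<longleftrightarrow> A \<subseteq> {0..2 * pi} \<and> A \<in> sets lborel" for A
    unfolding M_def by (rule sets_restrict_space_iff) simp
  have meas_M: "measure M A = measure lborel A" if "A \<subseteq> {0..2 * pi}" for A
    unfolding M_def using that by (intro measure_restrict_space) auto
  have space_M: "space M = {0..2 * pi}" by (simp add: M_def space_restrict_space)
  have fin_M: "finite_measure M"
    unfolding M_def by (intro finite_measure_restrict_space finite_measureI) (simp_all add: emeasure_restrict_space)
  have "2 * measure M (space M) \<le> edge_sum (\<lambda>x y. measure M (sym_diff (arc x) (arc y))) ys
      + measure M (arc (hd ys)) + measure M (arc (last ys))"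
  proof (rule measure_changes_open[OF fin_M _ ys(2)])
    fix w assume "w \<in> set ys"
    then have "1 \<le> norm w" using r_le r by fastforce
    then show "arc w \<in> sets M" unfolding sets_M using arc_measurable sub by blast
  next
    fix t assume "t \<in> space M"
    then have t: "t \<in> {0..2 * pi}" by (simp only: space_M)
    obtain x where "x \<in> set ys" "cis t \<in> sees x"
      using ys(1) norm_cis[of t] unfolding covering_def by blast
    then show "\<exists>x\<in>set ys. t \<in> arc x" using t unfolding arc_def by blast
  qed
  moreover have "(\<lambda>x y. measure M (sym_diff (arc x) (arc y))) = \<mu>"
  proof (intro ext)
    fix x y
    have "sym_diff (arc x) (arc y) \<subseteq> {0..2 * pi}" using sub by blast
    then show "measure M (sym_diff (arc x) (arc y)) = \<mu> x y" unfolding \<mu>_def by (rule meas_M)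
  qed
  moreover have "measure M (arc w) \<le> 2 * half_angle w" if "w \<in> set ys" for w
    using measure_arc_le[of w] r_le[OF that] r by (simp add: meas_M[OF sub])
  then have "measure M (arc (hd ys)) \<le> 2 * half_angle (hd ys)" "measure M (arc (last ys)) \<le> 2 * half_angle (last ys)"
    using hd_in_set[OF ys(2)] last_in_set[OF ys(2)] by blast+
  moreover have "measure M (space M) = 2 * pi"
    unfolding space_M using meas_M[of "{0..2 * pi}"] by simp
  ultimately have "4 * pi \<le> edge_sum \<mu> ys + 2 * half_angle (hd ys) + 2 * half_angle (last ys)"
    by simp
  \<comment> \<open>Each end is assigned the share \<open>r * (pi - half_angle _)\<close>, which
    together with its defect is bounded by \<open>endpoint_contribution_ge\<close>.\<close>
  then have "r / 2 * (4 * pi - 2 * half_angle (hd ys) - 2 * half_angle (last ys)) \<le> r / 2 * edge_sum \<mu> ys"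
    using r by (intro mult_left_mono) auto
  moreover have "pi / 2 + 1 \<le> r * (pi - half_angle (hd ys)) + h (hd ys)"
    "pi / 2 + 1 \<le> r * (pi - half_angle (last ys)) + h (last ys)"
    unfolding h_def using r r_le ys(2) by (auto intro!: endpoint_contribution_ge)
  ultimately have "pi + 2 \<le> edge_sum dist ys"
    using main unfolding right_diff_distrib by (simp add: mult.commute mult.left_commute)
  then show ?thesis using ys(4) by simp
qed

section \<open>The spatial inradius bound for closed polygons\<close>

text \<open>The part of the unit ball in the cone over the cap: its volume is a third of the cap
  area, so areas on the sphere become Lebesgue measures. The apex is left out because it would lie
  in every sector.\<close>

definition sector :: "real^3 \<Rightarrow> (real^3) set" where
  "sector x = {v. v \<noteq> 0 \<and> norm v \<le> 1 \<and> norm v \<le> v \<bullet> x}"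

text \<open>Identifies nested pairs with R^3 isometrically and preserving measure, so that a solid
  can be cut into planar slices by Fubini.\<close>

definition of_triple :: "(real \<times> real) \<times> real \<Rightarrow> real^3" where
  "of_triple p = (\<chi> i. if i = 1 then fst (fst p) else if i = 2 then snd (fst p) else snd p)"

lemma of_triple_nth [simp]:
  "of_triple p $ 1 = fst (fst p)" "of_triple p $ 2 = snd (fst p)" "of_triple p $ 3 = snd p"
  by (simp_all add: of_triple_def)

lemma norm_of_triple [simp]: "norm (of_triple p) = norm p"
  by (simp add: norm_vec_def L2_set_def sum_3 norm_prod_def)

lemma of_triple_eq_0 [simp]: "of_triple p = 0 \<longleftrightarrow> p = 0"
  by (metis norm_eq_zero norm_of_triple)

lemma borel_measurable_of_triple [measurable]: "of_triple \<in> borel \<rightarrow>\<^sub>M borel"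
proof -
  have "continuous_on UNIV of_triple"
    unfolding of_triple_def
  proof (rule continuous_on_vec_lambda)
    fix i :: 3
    show "continuous_on UNIV (\<lambda>p :: (real \<times> real) \<times> real. if i = 1 then fst (fst p) else if i = 2 then snd (fst p) else snd p)"
      by (cases "i = 1"; cases "i = 2") (auto intro!: continuous_intros)
  qed
  then show ?thesis by (rule borel_measurable_continuous_onI)
qed

lemma lborel_of_triple: "lborel = distr lborel borel of_triple"
proof (rule lborel_eqI)
  fix l u :: "real^3"
  assume lu: "\<And>b. b \<in> Basis \<Longrightarrow> l \<bullet> b \<le> u \<bullet> b"
  have le: "l $ i \<le> u $ i" for i
    using lu[of "axis i 1"] by (simp add: axis_in_Basis_iff cart_eq_inner_axis)
  have "of_triple -` box l u = ({l $ 1<..<u $ 1} \<times> {l $ 2<..<u $ 2}) \<times> {l $ 3<..<u $ 3}"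
    by (auto simp: mem_box_cart forall_3)
  then have "emeasure (distr lborel borel of_triple) (box l u)
      = emeasure ((lborel \<Otimes>\<^sub>M lborel) \<Otimes>\<^sub>M lborel) (({l $ 1<..<u $ 1} \<times> {l $ 2<..<u $ 2}) \<times> {l $ 3<..<u $ 3})"
    by (simp add: emeasure_distr lborel_prod)
  also have "\<dots> = emeasure (lborel \<Otimes>\<^sub>M lborel) ({l $ 1<..<u $ 1} \<times> {l $ 2<..<u $ 2}) * emeasure lborel {l $ 3<..<u $ 3}"
    by (intro lborel.emeasure_pair_measure_Times pair_measureI) simp_all
  also have "\<dots> = emeasure lborel {l $ 1<..<u $ 1} * emeasure lborel {l $ 2<..<u $ 2} * emeasure lborel {l $ 3<..<u $ 3}"
  proof -
    have "emeasure (lborel \<Otimes>\<^sub>M lborel) ({l $ 1<..<u $ 1} \<times> {l $ 2<..<u $ 2})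
        = emeasure lborel {l $ 1<..<u $ 1} * emeasure lborel {l $ 2<..<u $ 2}"
      by (rule lborel.emeasure_pair_measure_Times) auto
    then show ?thesis by (rule arg_cong)
  qed
  also have "\<dots> = ennreal ((u $ 1 - l $ 1) * (u $ 2 - l $ 2) * (u $ 3 - l $ 3))"
  proof -
    have "emeasure lborel {l $ i<..<u $ i} = ennreal (u $ i - l $ i)" for i
      using le by (rule emeasure_lborel_Ioo)
    then show ?thesis using le by (simp only: ennreal_mult'' diff_ge_0_iff_ge mult_nonneg_nonneg)
  qed
  also have "(u $ 1 - l $ 1) * (u $ 2 - l $ 2) * (u $ 3 - l $ 3) = (\<Prod>b\<in>Basis. (u - l) \<bullet> b)"
  proof -
    have "bij_betw (\<lambda>i :: 3. axis i (1 :: real)) UNIV Basis"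
      unfolding bij_betw_def inj_on_def Basis_vec_def by (auto simp: axis_eq_axis)
    then have "(\<Prod>b\<in>Basis. (u - l) \<bullet> b) = (\<Prod>i\<in>UNIV. (u - l) \<bullet> axis i 1)"
      by (rule prod.reindex_bij_betw[symmetric])
    also have "\<dots> = (\<Prod>i\<in>UNIV. u $ i - l $ i)" by (simp only: inner_axis inner_real_def mult_1_right vector_minus_component)
    also have "\<dots> = (u $ 1 - l $ 1) * (u $ 2 - l $ 2) * (u $ 3 - l $ 3)"
      unfolding UNIV_3 by simp
    finally show ?thesis by (rule sym)
  qed
  finally show "emeasure (distr lborel borel of_triple) (box l u) = ennreal (\<Prod>b\<in>Basis. (u - l) \<bullet> b)" .
qed simp

lemma sector_measurable [measurable]: "sector x \<in> sets borel"
proof -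
  have "sector x = (cball 0 1 \<inter> {v. norm v \<le> v \<bullet> x}) - {0}" by (auto simp: sector_def)
  moreover have "closed {v. norm v \<le> v \<bullet> x}" by (intro closed_Collect_le continuous_intros)
  ultimately show ?thesis by (simp add: borel_closed)
qed

text \<open>Horizontal slices are discs: up to height \<open>s\<close> the cone bounds the squared
  radius by \<open>k * c\<^sup>2\<close>, above it the ball bounds it by
  \<open>1 - c\<^sup>2\<close>.\<close>

lemma emeasure_sector_axis:
  assumes s: "0 < s" "s \<le> 1"
  shows "emeasure lborel (sector (axis 3 (1 / s))) = ennreal (2 * pi / 3 * (1 - s))"
proof -
  define k where "k = 1 / s\<^sup>2 - 1"
  have "s\<^sup>2 \<le> 1" using s by (simp add: power_le_one)
  then have k: "0 \<le> k" using s by (simp add: k_def field_simps)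
  let ?C = "of_triple -` sector (axis 3 (1 / s))"
  let ?r = "\<lambda>c. if 0 \<le> c \<and> c \<le> s then pi * k * c\<^sup>2 else if s < c \<and> c \<le> 1 then pi * (1 - c\<^sup>2) else 0"
  have slice: "emeasure lborel ((\<lambda>q. (q, c)) -` ?C) = ennreal (?r c)" if "c \<noteq> 0" for c
  proof -
    have norm_le: "norm (q, c) \<le> d \<longleftrightarrow> (norm q)\<^sup>2 \<le> d\<^sup>2 - c\<^sup>2" if "0 \<le> d" for q :: "real \<times> real" and d
      using that by (simp add: norm_prod_def) (metis (no_types, opaque_lifting) le_diff_eq real_sqrt_le_iff real_sqrt_unique)
    have disc: "{q :: real \<times> real. (norm q)\<^sup>2 \<le> d} = cball 0 (sqrt d)" if "0 \<le> d" for d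
      using that by (auto simp: real_le_rsqrt dest: real_sqrt_le_mono) (metis norm_ge_zero real_sqrt_le_iff real_sqrt_unique)
    have area: "emeasure lborel (cball (0 :: real \<times> real) (sqrt d)) = ennreal (pi * d)" if "0 \<le> d" for d
      using that by (simp add: emeasure_cball unit_ball_vol_2)
    have "(\<lambda>q. (q, c)) -` ?C = {q. norm (q, c) \<le> 1 \<and> norm (q, c) \<le> c / s}"
      using that by (auto simp: sector_def inner_axis prod_eq_iff zero_prod_def)
    also have "\<dots> = (if 0 \<le> c then {q. (norm q)\<^sup>2 \<le> min (1 - c\<^sup>2) (k * c\<^sup>2)} else {})"
    proof (cases "0 \<le> c")
      case True
      then have "(c / s)\<^sup>2 - c\<^sup>2 = k * c\<^sup>2" by (simp add: k_def power_divide algebra_simps)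
      then show ?thesis using True s norm_le[of 1] norm_le[of "c / s"] by auto
    next
      case False
      then have "c / s < 0" using s by (simp add: divide_neg_pos)
      then have "\<not> norm (q, c) \<le> c / s" for q :: "real \<times> real"
        using norm_ge_zero[of "(q, c)"] by linarith
      then show ?thesis using False by simp
    qed
    also have "emeasure lborel \<dots> = ennreal (?r c)"
    proof -
      consider "c < 0" | "0 \<le> c" "c \<le> s" | "s < c" "c \<le> 1" | "1 < c" by linarith
      then show ?thesis
      proof cases
        case 2
        then have "c\<^sup>2 \<le> s\<^sup>2" by (simp add: power_mono)
        then have "c\<^sup>2 * (1 / s\<^sup>2) \<le> 1" using s by simp
        then have "min (1 - c\<^sup>2) (k * c\<^sup>2) = k * c\<^sup>2" by (simp add: k_def algebra_simps min_def)
        then show ?thesis using 2 k by (simp add: disc area mult.assoc)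
      next
        case 3
        then have "s\<^sup>2 \<le> c\<^sup>2" using s by (simp add: power_mono)
        then have "1 \<le> c\<^sup>2 * (1 / s\<^sup>2)" using s by simp
        then have "min (1 - c\<^sup>2) (k * c\<^sup>2) = 1 - c\<^sup>2" by (simp add: k_def algebra_simps min_def)
        moreover have "c\<^sup>2 \<le> 1" using 3 s by (simp add: power_le_one)
        ultimately show ?thesis using 3 s by (simp add: disc area)
      next
        case 4
        then have "1 < c\<^sup>2" by (simp add: one_less_power)
        then have "\<not> (norm q)\<^sup>2 \<le> 1 - c\<^sup>2" for q :: "real \<times> real"
          using zero_le_power2[of "norm q"] by linarith
        then show ?thesis using 4 s by simp
      qed (use s in auto)
    qed
    finally show ?thesis .
  qed
  have "emeasure lborel (sector (axis 3 (1 / s))) = emeasure (distr lborel borel of_triple) (sector (axis 3 (1 / s)))"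
    by (simp flip: lborel_of_triple)
  also have "\<dots> = emeasure (lborel \<Otimes>\<^sub>M lborel) ?C"
    by (subst emeasure_distr) (simp_all add: lborel_prod)
  also have "\<dots> = (\<integral>\<^sup>+c. emeasure lborel ((\<lambda>q. (q, c)) -` ?C) \<partial>lborel)"
  proof (rule lborel_pair.emeasure_pair_measure_alt2)
    have "?C \<in> sets borel"
      using measurable_sets[OF borel_measurable_of_triple sector_measurable] by simp
    then show "?C \<in> sets (lborel \<Otimes>\<^sub>M lborel)" unfolding lborel_prod by simp
  qed
  also have "\<dots> = (\<integral>\<^sup>+c. ennreal (pi * k * c\<^sup>2) * indicator {0..s} c + ennreal (pi * (1 - c\<^sup>2)) * indicator {s..1} c \<partial>lborel)"
  proof (rule nn_integral_cong_AE)
    \<comment> \<open>The slice formula is stated for nonzero heights, and at height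
      \<open>s\<close> both indicators count; these two heights form a null set.\<close>
    show "AE c in lborel. emeasure lborel ((\<lambda>q. (q, c)) -` ?C)
        = ennreal (pi * k * c\<^sup>2) * indicator {0..s} c + ennreal (pi * (1 - c\<^sup>2)) * indicator {s..1} c"
      using AE_lborel_singleton[of "0 :: real"] AE_lborel_singleton[of s]
    proof eventually_elim
      case (elim c)
      show ?case unfolding slice[OF elim(1)] using elim s by (auto simp: indicator_def)
    qed
  qed
  also have "\<dots> = (\<integral>\<^sup>+c. ennreal (pi * k * c\<^sup>2) * indicator {0..s} c \<partial>lborel)
      + (\<integral>\<^sup>+c. ennreal (pi * (1 - c\<^sup>2)) * indicator {s..1} c \<partial>lborel)"
    by (rule nn_integral_add) auto
  also have "(\<integral>\<^sup>+c. ennreal (pi * k * c\<^sup>2) * indicator {0..s} c \<partial>lborel) = ennreal (pi * k * s ^ 3 / 3 - pi * k * 0 ^ 3 / 3)"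
    using s k by (intro nn_integral_FTC_Icc) (auto intro!: derivative_eq_intros simp: power2_eq_square)
  also have "(\<integral>\<^sup>+c. ennreal (pi * (1 - c\<^sup>2)) * indicator {s..1} c \<partial>lborel)
      = ennreal (pi * (1 - 1 ^ 3 / 3) - pi * (s - s ^ 3 / 3))"
    using s by (intro nn_integral_FTC_Icc) (auto intro!: derivative_eq_intros simp: power2_eq_square mult_le_one)
  also have "ennreal (pi * k * s ^ 3 / 3 - pi * k * 0 ^ 3 / 3) + ennreal (pi * (1 - 1 ^ 3 / 3) - pi * (s - s ^ 3 / 3))
      = ennreal ((pi * k * s ^ 3 / 3 - pi * k * 0 ^ 3 / 3) + (pi * (1 - 1 ^ 3 / 3) - pi * (s - s ^ 3 / 3)))"
  proof (rule ennreal_plus[symmetric])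
    have "0 \<le> (1 - s) * ((1 - s) * (2 + s))" using s by simp
    then have "0 \<le> pi * ((1 - 1 ^ 3 / 3) - (s - s ^ 3 / 3))"
      by (intro mult_nonneg_nonneg) (simp_all add: algebra_simps power3_eq_cube)
    then show "0 \<le> pi * (1 - 1 ^ 3 / 3) - pi * (s - s ^ 3 / 3)" by (simp only: right_diff_distrib)
  qed (use s k in auto)
  also have "(pi * k * s ^ 3 / 3 - pi * k * 0 ^ 3 / 3) + (pi * (1 - 1 ^ 3 / 3) - pi * (s - s ^ 3 / 3)) = 2 * pi / 3 * (1 - s)"
  proof -
    have "k * s ^ 3 = s - s ^ 3" using s by (simp add: k_def field_simps power2_eq_square power3_eq_cube)
    then have "pi * k * s ^ 3 = pi * s - pi * s ^ 3" by (simp add: mult.assoc right_diff_distrib)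
    then show ?thesis by (simp add: field_simps)
  qed
  finally show ?thesis .
qed

lemma sector_lmeasurable: "sector x \<in> lmeasurable"
  by (rule fmeasurableI2[of "cball 0 1"]) (auto simp: sector_def)

lemma sector_orthogonal_image:
  fixes f :: "real^3 \<Rightarrow> real^3"
  assumes f: "orthogonal_transformation f"
  shows "f ` sector x = sector (f x)"
proof -
  have lin: "linear f" and bij: "bij f" using f by (auto simp: orthogonal_transformation_linear orthogonal_transformation_bij)
  have mem: "f v \<in> sector (f x) \<longleftrightarrow> v \<in> sector x" for v
  proof -
    have "f v = 0 \<longleftrightarrow> v = 0" by (metis f norm_eq_zero orthogonal_transformation_norm)
    then show ?thesis using f by (simp add: sector_def orthogonal_transformation_def orthogonal_transformation_norm[OF f])
  qed
  then show ?thesis using bij by (auto simp: bij_def surj_def) (metis image_eqI mem)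
qed

lemma measure_sector:
  assumes "1 \<le> norm x"
  shows "measure lebesgue (sector x) = 2 * pi / 3 * (1 - 1 / norm x)"
proof -
  have "norm x = norm (axis 3 (norm x) :: real^3)"
    by (simp add: norm_eq_sqrt_inner inner_axis_axis)
  then obtain f :: "real^3 \<Rightarrow> real^3" where f: "orthogonal_transformation f" "f x = axis 3 (norm x)"
    by (rule orthogonal_transformation_exists)
  have "measure lebesgue (sector x) = measure lebesgue (f ` sector x)"
    using measure_orthogonal_image[OF f(1) sector_lmeasurable] by simp
  also have "\<dots> = measure lborel (sector (axis 3 (1 / (1 / norm x))))"
    by (simp add: sector_orthogonal_image[OF f(1)] f(2))
  also have "\<dots> = 2 * pi / 3 * (1 - 1 / norm x)"
  proof -
    have "0 < norm x" using assms by linarith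
    then have "0 < 1 / norm x" "1 / norm x \<le> 1" using assms by simp_all
    from emeasure_sector_axis[OF this] this show ?thesis by (simp add: measure_def)
  qed
  finally show ?thesis .
qed

section \<open>Lunes between sectors rotated about an axis\<close>

definition polar_point :: "real \<Rightarrow> real \<Rightarrow> real^3" where
  "polar_point \<rho> p = of_triple ((\<rho> * cos p, \<rho> * sin p), 0)"

lemma norm_polar_point [simp]: "norm (polar_point \<rho> p) = \<bar>\<rho>\<bar>"
proof -
  have "(\<rho> * cos p)\<^sup>2 + (\<rho> * sin p)\<^sup>2 = \<rho>\<^sup>2 * ((cos p)\<^sup>2 + (sin p)\<^sup>2)"
    by (simp only: power_mult_distrib distrib_left)
  then show ?thesis
    by (simp add: polar_point_def norm_prod_def)
qed

lemma inner_polar_point: "v \<bullet> polar_point \<rho> p = \<rho> * (v $ 1 * cos p + v $ 2 * sin p)"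
  by (simp add: polar_point_def inner_vec_def sum_3 algebra_simps)

definition axial_rotation :: "real \<Rightarrow> real^3 \<Rightarrow> real^3" where
  "axial_rotation t v = of_triple ((v $ 1 * cos t - v $ 2 * sin t, v $ 1 * sin t + v $ 2 * cos t), v $ 3)"

lemma orthogonal_axial_rotation: "orthogonal_transformation (axial_rotation t)"
proof -
  have "linear (axial_rotation t)"
    by (rule linearI) (simp_all add: axial_rotation_def vec_eq_iff forall_3 algebra_simps)
  moreover have "norm (axial_rotation t v) = norm v" for v
  proof -
    have "(v $ 1 * cos t - v $ 2 * sin t)\<^sup>2 + (v $ 1 * sin t + v $ 2 * cos t)\<^sup>2
        = (v $ 1)\<^sup>2 * ((sin t)\<^sup>2 + (cos t)\<^sup>2) + (v $ 2)\<^sup>2 * ((sin t)\<^sup>2 + (cos t)\<^sup>2)"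
      by algebra
    then show ?thesis
      by (simp add: axial_rotation_def norm_vec_def L2_set_def sum_3)
  qed
  ultimately show ?thesis by (simp add: orthogonal_transformation)
qed

lemma axial_rotation_polar_point: "axial_rotation t (polar_point \<rho> p) = polar_point \<rho> (p + t)"
  by (simp add: axial_rotation_def polar_point_def vec_eq_iff forall_3 cos_add sin_add algebra_simps)

text \<open>For fixed \<open>v\<close>, the angles \<open>p\<close> with
  \<open>v \<in> sector (polar_point \<rho> p)\<close> form, modulo \<open>2 * pi\<close>, an arc of
  half-width \<open>\<beta>\<close> around the longitude \<open>\<eta>\<close> of \<open>v\<close>.
  Lying in the lune at \<open>q\<close> means that the beginning of this arc falls between
  \<open>q\<close> and \<open>q + e\<close>; for different multiples of \<open>\<delta>\<close>
  these windows are disjoint modulo \<open>2 * pi\<close>.\<close>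

lemma lunes_disjoint:
  assumes "0 < \<rho>" "0 \<le> e" "e \<le> \<delta>" "real N * \<delta> = 2 * pi" "j < k" "k < N"
  shows "(sector (polar_point \<rho> (real j * \<delta> + e)) - sector (polar_point \<rho> (real j * \<delta>))) \<inter>
    (sector (polar_point \<rho> (real k * \<delta> + e)) - sector (polar_point \<rho> (real k * \<delta>))) = {}"
proof (rule ccontr)
  assume "\<not> ?thesis"
  then obtain v where v: "v \<in> sector (polar_point \<rho> (real j * \<delta> + e))" "v \<notin> sector (polar_point \<rho> (real j * \<delta>))"
    "v \<in> sector (polar_point \<rho> (real k * \<delta> + e))" "v \<notin> sector (polar_point \<rho> (real k * \<delta>))" by blast
  then have nv: "v \<noteq> 0" "norm v \<le> 1" by (auto simp: sector_def)
  define w where "w = Complex (v $ 1) (v $ 2)"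
  define r where "r = norm w"
  define \<eta> where "\<eta> = Arg w"
  have "w = rcis r \<eta>" by (simp add: r_def \<eta>_def rcis_cmod_Arg)
  then have comp: "v $ 1 = r * cos \<eta>" "v $ 2 = r * sin \<eta>"
    by (simp_all add: w_def rcis_def complex_eq_iff)
  have inner: "v \<bullet> polar_point \<rho> p = \<rho> * r * cos (p - \<eta>)" for p
    by (simp add: inner_polar_point comp cos_diff algebra_simps)
  have state: "v \<in> sector (polar_point \<rho> p) \<longleftrightarrow> norm v \<le> \<rho> * r * cos (p - \<eta>)" for p
    using nv by (simp add: sector_def inner)
  have "0 < norm v" using nv by simp
  then have "0 < \<rho> * r * cos (real j * \<delta> + e - \<eta>)" using v(1) unfolding state by linarith
  moreover have "0 \<le> \<rho> * r" using assms(1) by (simp add: r_def)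
  ultimately have \<rho>r: "0 < \<rho> * r" by (metis less_eq_real_def less_irrefl mult_zero_left)
  define \<kappa> where "\<kappa> = norm v / (\<rho> * r)"
  have state': "v \<in> sector (polar_point \<rho> p) \<longleftrightarrow> \<kappa> \<le> cos (p - \<eta>)" for p
    unfolding state \<kappa>_def using \<rho>r by (simp add: divide_le_eq mult.commute)
  have "\<kappa> \<le> 1" using v(1) cos_le_one[of "real j * \<delta> + e - \<eta>"] unfolding state' by linarith
  moreover have "0 \<le> \<kappa>" using \<rho>r by (simp add: \<kappa>_def)
  ultimately have \<beta>: "cos (arccos \<kappa>) = \<kappa>" "0 \<le> arccos \<kappa>" "arccos \<kappa> \<le> pi"
    by (auto intro: cos_arccos arccos_lbound arccos_ubound)
  define \<beta> where "\<beta> = arccos \<kappa>"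
  have in_iff: "v \<in> sector (polar_point \<rho> p) \<longleftrightarrow> (\<exists>n::int. \<bar>p - \<eta> + 2 * pi * of_int n\<bar> \<le> \<beta>)" for p
    using cos_ge_cos_iff[OF \<beta>(2,3), of "p - \<eta>"] unfolding state' by (simp add: \<beta>(1) \<beta>_def)
  define a where "a = real j * \<delta>"
  define c where "c = real k * \<delta>"
  have \<delta>: "0 \<le> \<delta>" using assms(2,3) by simp
  have "a + \<delta> \<le> c"
  proof -
    have "real (Suc j) * \<delta> \<le> real k * \<delta>" using assms(5) \<delta> by (intro mult_right_mono) auto
    then show ?thesis by (simp add: a_def c_def algebra_simps)
  qed
  moreover have "c + \<delta> \<le> 2 * pi"
  proof -
    have "real (Suc k) * \<delta> \<le> real N * \<delta>" using assms(6) \<delta> by (intro mult_right_mono) auto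
    then show ?thesis using assms(4) by (simp add: c_def algebra_simps)
  qed
  moreover have "0 \<le> a" using \<delta> by (simp add: a_def)
  ultimately have ord: "a \<le> a + e" "a + e \<le> c" "c \<le> c + e" "c + e \<le> a + 2 * pi" using assms(2,3) by auto
  obtain n :: int where n: "\<bar>a + e - \<eta> + 2 * pi * of_int n\<bar> \<le> \<beta>" using v(1) in_iff by (auto simp: a_def)
  obtain m :: int where m: "\<bar>c + e - \<eta> + 2 * pi * of_int m\<bar> \<le> \<beta>" using v(3) in_iff by (auto simp: c_def)
  have out_a: "\<not> \<bar>a - \<eta> + 2 * pi * of_int i\<bar> \<le> \<beta>" for i :: int using v(2) in_iff[of a] unfolding a_def by blast
  have out_c: "\<not> \<bar>c - \<eta> + 2 * pi * of_int i\<bar> \<le> \<beta>" for i :: int using v(4) in_iff[of c] unfolding c_def by blast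
  have "m < n"
  proof (rule ccontr)
    assume "\<not> m < n"
    then have "2 * pi * of_int n \<le> 2 * pi * real_of_int m" by simp
    then have "\<bar>c - \<eta> + 2 * pi * of_int n\<bar> \<le> \<beta>" using n m ord by linarith
    then show False using out_c by blast
  qed
  then have "real_of_int m + 1 \<le> of_int n" by simp
  then have "2 * pi * (real_of_int m + 1) \<le> 2 * pi * of_int n" by (rule mult_left_mono) simp
  then have mn: "2 * pi * of_int m + 2 * pi \<le> 2 * pi * of_int n" by (simp add: algebra_simps)
  have "\<bar>a - \<eta> + 2 * pi * of_int (m + 1)\<bar> \<le> \<beta>"
  proof -
    have "a - \<eta> + 2 * pi * of_int (m + 1) = a + 2 * pi - \<eta> + 2 * pi * of_int m" by (simp add: algebra_simps)
    then show ?thesis using n m ord mn by linarith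
  qed
  then show False using out_a by blast
qed

text \<open>The \<open>N\<close> rotated copies of the lune are disjoint and avoid two antipodal sectors around the axis.\<close>

lemma measure_lune_small:
  assumes \<rho>: "1 \<le> \<rho>" and N: "0 < N" and e: "0 \<le> e" "e \<le> 2 * pi / real N"
  shows "measure lebesgue (sector (polar_point \<rho> (p + e)) - sector (polar_point \<rho> p))
    \<le> 4 * pi / 3 * sqrt (1 - 1 / \<rho>\<^sup>2) / real N"
proof -
  define \<delta> where "\<delta> = 2 * pi / real N"
  define L where "L j = sector (polar_point \<rho> (real j * \<delta> + e)) - sector (polar_point \<rho> (real j * \<delta>))" for j
  define l where "l = measure lebesgue (sector (polar_point \<rho> (p + e)) - sector (polar_point \<rho> p))"
  have L_meas: "L j \<in> lmeasurable" for j unfolding L_def by (intro fmeasurable.Diff sector_lmeasurable)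
  have lune: "measure lebesgue (sector (polar_point \<rho> (q + t + e)) - sector (polar_point \<rho> (q + t)))
      = measure lebesgue (sector (polar_point \<rho> (q + e)) - sector (polar_point \<rho> q))" for q t
  proof -
    let ?f = "axial_rotation t"
    have "inj ?f" using orthogonal_axial_rotation orthogonal_transformation_bij bij_is_inj by blast
    then have "?f ` (sector (polar_point \<rho> (q + e)) - sector (polar_point \<rho> q))
        = sector (polar_point \<rho> (q + t + e)) - sector (polar_point \<rho> (q + t))"
      by (simp add: image_set_diff sector_orthogonal_image[OF orthogonal_axial_rotation]
          axial_rotation_polar_point add.commute add.left_commute)
    then show ?thesis
      using measure_orthogonal_image[OF orthogonal_axial_rotation, of "sector (polar_point \<rho> (q + e)) - sector (polar_point \<rho> q)" t]
      by (simp add: fmeasurable.Diff sector_lmeasurable)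
  qed
  have L_eq: "measure lebesgue (L j) = l" for j
    using lune[of p "real j * \<delta> - p"] by (simp add: L_def l_def)
  have disj: "disjoint_family_on L {..<N}"
    unfolding disjoint_family_on_def
  proof (intro ballI impI)
    fix j k assume "j \<in> {..<N}" "k \<in> {..<N}" "j \<noteq> k"
    then consider "j < k" "k < N" | "k < j" "j < N" by force
    moreover have "L j \<inter> L k = {}" if "j < k" "k < N" for j k
      unfolding L_def using that \<rho> e N by (intro lunes_disjoint[of _ _ _ N]) (auto simp: \<delta>_def)
    ultimately show "L j \<inter> L k = {}" by cases (blast, metis Int_commute)
  qed
  have union: "measure lebesgue (\<Union>j<N. L j) = real N * l"
  proof -
    have "measure lebesgue (\<Union>j<N. L j) = (\<Sum>j<N. measure lebesgue (L j))"
      using L_meas fmeasurableD2[OF L_meas] by (intro measure_finite_Union disj) (auto simp: image_subset_iff)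
    then show ?thesis by (simp add: L_eq)
  qed
  define c where "c = sqrt (1 - 1 / \<rho>\<^sup>2)"
  have "1 \<le> \<rho>\<^sup>2" "0 < \<rho>\<^sup>2" using \<rho> by (simp_all add: one_le_power)
  then have "1 / \<rho>\<^sup>2 \<le> 1" by simp
  then have c: "0 \<le> c" "c\<^sup>2 = 1 - 1 / \<rho>\<^sup>2" by (simp_all add: c_def)
  have "c\<^sup>2 < 1\<^sup>2" using c(2) \<rho> by simp
  then have "c < 1" by (rule power_less_imp_less_base) simp
  \<comment> \<open>\<open>c\<close> is the sine of the angular radius of the caps, so the lunes
    stay in the zone \<open>\<bar>v $ 3\<bar> \<le> c * norm v\<close>. Removing the two polar
    sectors leaves the volume \<open>4 * pi / 3 * s\<close> of the ball. The strict
    \<open>c < s\<close> separates zone and poles; \<open>s\<close> tends to \<open>c\<close> at the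
    end.\<close>
  have bound: "real N * l \<le> 4 * pi / 3 * s" if s: "c < s" "s \<le> 1" for s
  proof -
    define u where "u = (axis 3 (1 / s) :: real^3)"
    have s0: "0 < s" using s c by simp
    have norm_u: "norm u = 1 / s" "norm (- u) = 1 / s" using s0
      by (simp_all add: u_def norm_eq_sqrt_inner inner_axis_axis real_sqrt_divide)
    have inner_u: "v \<bullet> u = v $ 3 / s" for v by (simp add: u_def inner_axis)
    have "1 \<le> norm u" "1 \<le> norm (- u)" using s s0 by (simp_all add: norm_u)
    then have caps: "measure lebesgue (sector u) = 2 * pi / 3 * (1 - s)" "measure lebesgue (sector (- u)) = 2 * pi / 3 * (1 - s)"
      using measure_sector[of u] measure_sector[of "- u"] by (simp_all add: norm_u)
    have zone: "norm v * s \<ge> \<bar>v $ 3\<bar> \<and> v \<noteq> 0 \<and> norm v \<le> 1 \<and> \<bar>v $ 3\<bar> < norm v * s" if "v \<in> sector (polar_point \<rho> q)" for v q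
    proof -
      have v: "v \<noteq> 0" "norm v \<le> 1" "norm v \<le> \<rho> * (v $ 1 * cos q + v $ 2 * sin q)"
        using that by (auto simp: sector_def inner_polar_point)
      have "((v $ 1)\<^sup>2 + (v $ 2)\<^sup>2) * ((cos q)\<^sup>2 + (sin q)\<^sup>2)
          = (v $ 1 * cos q + v $ 2 * sin q)\<^sup>2 + (v $ 1 * sin q - v $ 2 * cos q)\<^sup>2"
        by algebra
      then have "(v $ 1 * cos q + v $ 2 * sin q)\<^sup>2 \<le> (v $ 1)\<^sup>2 + (v $ 2)\<^sup>2"
        using zero_le_power2[of "v $ 1 * sin q - v $ 2 * cos q"] by simp
      moreover have "(norm v)\<^sup>2 \<le> (\<rho> * (v $ 1 * cos q + v $ 2 * sin q))\<^sup>2" using v(3) by (rule power_mono) simp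
      ultimately have "(norm v)\<^sup>2 \<le> \<rho>\<^sup>2 * ((v $ 1)\<^sup>2 + (v $ 2)\<^sup>2)"
        by (simp add: power_mult_distrib) (meson mult_left_mono order_trans zero_le_power2)
      moreover have norm_v: "(norm v)\<^sup>2 = (v $ 1)\<^sup>2 + (v $ 2)\<^sup>2 + (v $ 3)\<^sup>2"
        by (simp add: norm_vec_def L2_set_def sum_3)
      ultimately have "(norm v)\<^sup>2 \<le> \<rho>\<^sup>2 * ((norm v)\<^sup>2 - (v $ 3)\<^sup>2)" by simp
      then have "(v $ 3)\<^sup>2 \<le> c\<^sup>2 * (norm v)\<^sup>2" using \<rho> by (simp add: c(2) field_simps)
      then have "\<bar>v $ 3\<bar> \<le> c * norm v" using c(1) by (metis abs_le_square_iff abs_of_nonneg mult_nonneg_nonneg norm_ge_zero power_mult_distrib)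
      also have "\<dots> < s * norm v" using s v(1) by simp
      finally show ?thesis using v by (simp add: mult.commute)
    qed
    have disj1: "(\<Union>j<N. L j) \<inter> sector u = {}" "(\<Union>j<N. L j) \<inter> sector (- u) = {}"
    proof -
      have "v \<notin> sector u" "v \<notin> sector (- u)" if "v \<in> L j" for v j
      proof -
        have "v \<in> sector (polar_point \<rho> (real j * \<delta> + e))" using that by (simp add: L_def)
        from zone[OF this] have "\<bar>v $ 3\<bar> < norm v * s" by blast
        then have "\<bar>v $ 3\<bar> / s < norm v" using s0 by (simp only: pos_divide_less_eq)
        then have "\<bar>v $ 3 / s\<bar> < norm v" using s0 by (simp only: abs_divide abs_of_pos)
        then have "\<not> norm v \<le> v $ 3 / s" "\<not> norm v \<le> - (v $ 3 / s)" by linarith+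
        then show "v \<notin> sector u" "v \<notin> sector (- u)" by (simp_all add: sector_def inner_u)
      qed
      then show "(\<Union>j<N. L j) \<inter> sector u = {}" "(\<Union>j<N. L j) \<inter> sector (- u) = {}" by auto
    qed
    have disj2: "sector u \<inter> sector (- u) = {}"
    proof -
      have False if "norm v \<le> v \<bullet> u" "norm v \<le> - (v \<bullet> u)" "v \<noteq> 0" for v
        using that zero_less_norm_iff[of v] by linarith
      then show ?thesis by (auto simp: sector_def)
    qed
    have Un: "(\<Union>j<N. L j) \<in> lmeasurable" using L_meas by (intro fmeasurable.finite_UN) auto
    have disjoint_sum: "measure lebesgue (A \<union> B) = measure lebesgue A + measure lebesgue B"
      if "A \<in> lmeasurable" "B \<in> lmeasurable" "A \<inter> B = {}" for A B :: "(real^3) set"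
      by (rule measure_Union[OF fmeasurableD2[OF that(1), folded infinity_ennreal_def]
            fmeasurableD2[OF that(2), folded infinity_ennreal_def] fmeasurableD[OF that(1)] fmeasurableD[OF that(2)] that(3)])
    have "real N * l + 2 * pi / 3 * (1 - s) + 2 * pi / 3 * (1 - s)
        = measure lebesgue ((\<Union>j<N. L j) \<union> sector u \<union> sector (- u))"
    proof -
      have "measure lebesgue ((\<Union>j<N. L j) \<union> sector u \<union> sector (- u))
          = measure lebesgue ((\<Union>j<N. L j) \<union> sector u) + measure lebesgue (sector (- u))"
        by (rule disjoint_sum) (use disj1 disj2 Un in \<open>auto intro: sector_lmeasurable fmeasurable.Un\<close>)
      also have "measure lebesgue ((\<Union>j<N. L j) \<union> sector u) = measure lebesgue (\<Union>j<N. L j) + measure lebesgue (sector u)"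
        by (rule disjoint_sum[OF Un sector_lmeasurable disj1(1)])
      finally show ?thesis by (simp add: union caps)
    qed
    also have "\<dots> \<le> measure lebesgue (cball (0 :: real^3) 1)"
    proof (rule measure_mono_fmeasurable)
      show "(\<Union>j<N. L j) \<union> sector u \<union> sector (- u) \<subseteq> cball 0 1"
        by (auto simp: L_def sector_def)
      show "(\<Union>j<N. L j) \<union> sector u \<union> sector (- u) \<in> sets lebesgue"
        using Un sector_lmeasurable by (intro sets.Un) auto
    qed simp
    also have "\<dots> = 4 * pi / 3"
      using content_cball[of 1 "0 :: real^3"] by (simp add: unit_ball_vol_3)
    finally show ?thesis by (simp add: field_simps)
  qed
  have "real N * l \<le> 4 * pi / 3 * c"
  proof (rule ccontr)
    assume "\<not> ?thesis"
    then have "c < 3 / (4 * pi) * (real N * l)" by (simp add: field_simps)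
    then obtain s where "c < s" "s < min 1 (3 / (4 * pi) * (real N * l))"
      using \<open>c < 1\<close> dense[of c "min 1 (3 / (4 * pi) * (real N * l))"] by auto
    then show False using bound[of s] by (simp add: field_simps)
  qed
  then show ?thesis using N by (simp add: l_def c_def field_simps)
qed

section \<open>The volume pseudo-metric between sectors\<close>

definition sector_dist :: "real^3 \<Rightarrow> real^3 \<Rightarrow> real" where
  "sector_dist x y = measure lebesgue (sym_diff (sector x) (sector y))"

lemma sector_diff_lmeasurable: "sym_diff (sector x) (sector y) \<in> lmeasurable"
  by (intro fmeasurable.Un fmeasurable.Diff sector_lmeasurable)

lemma sector_dist_commute: "sector_dist x y = sector_dist y x"
  by (simp add: sector_dist_def Un_commute)

lemma sector_dist_triangle: "sector_dist x z \<le> sector_dist x y + sector_dist y z"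
proof -
  have "sector_dist x z \<le> measure lebesgue (sym_diff (sector x) (sector y) \<union> sym_diff (sector y) (sector z))"
    unfolding sector_dist_def
    by (intro measure_mono_fmeasurable fmeasurable.Un[OF sector_diff_lmeasurable sector_diff_lmeasurable]
        fmeasurableD[OF sector_diff_lmeasurable]) blast
  also have "\<dots> \<le> sector_dist x y + sector_dist y z"
    unfolding sector_dist_def by (intro measure_Un_le fmeasurableD[OF sector_diff_lmeasurable])
  finally show ?thesis .
qed

lemma sector_dist_le_sum: "sector_dist x y \<le> measure lebesgue (sector x) + measure lebesgue (sector y)"
proof -
  have "sector_dist x y \<le> measure lebesgue (sector x \<union> sector y)"
    unfolding sector_dist_def
    by (intro measure_mono_fmeasurable fmeasurable.Un[OF sector_lmeasurable sector_lmeasurable]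
        fmeasurableD[OF sector_diff_lmeasurable]) blast
  also have "\<dots> \<le> measure lebesgue (sector x) + measure lebesgue (sector y)"
    by (intro measure_Un_le fmeasurableD[OF sector_lmeasurable])
  finally show ?thesis .
qed

lemma sector_dist_self [simp]: "sector_dist x x = 0"
  by (simp add: sector_dist_def)

lemma sector_dist_orthogonal:
  assumes f: "orthogonal_transformation f"
  shows "sector_dist (f x) (f y) = sector_dist x y"
proof -
  have "inj f" using f orthogonal_transformation_bij bij_is_inj by blast
  then have "sym_diff (sector (f x)) (sector (f y)) = f ` sym_diff (sector x) (sector y)"
    by (simp add: sector_orthogonal_image[OF f, symmetric] image_Un image_set_diff)
  then show ?thesis
    unfolding sector_dist_def using measure_orthogonal_image[OF f sector_diff_lmeasurable] by simp
qed

lemma sector_iff_sees: "v \<in> sector x \<longleftrightarrow> v \<noteq> 0 \<and> norm v \<le> 1 \<and> sgn v \<in> sees x"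
proof (cases "v = 0")
  case False
  then have "v \<noteq> 0" .
  moreover have "sgn v \<bullet> x = (v \<bullet> x) / norm v" by (simp add: sgn_div_norm divide_inverse)
  ultimately have "1 \<le> sgn v \<bullet> x \<longleftrightarrow> norm v \<le> v \<bullet> x"
    by (simp add: pos_le_divide_eq)
  then show ?thesis using \<open>v \<noteq> 0\<close> by (simp add: sector_def sees_def norm_sgn)
qed (simp add: sector_def)

lemma sector_dist_nested:
  assumes "sees x \<subseteq> sees y" "1 \<le> norm x" "1 \<le> norm y"
  shows "sector_dist x y = 2 * pi / 3 * (1 / norm x - 1 / norm y)"
proof -
  have sub: "sector x \<subseteq> sector y" using assms(1) by (auto simp: sector_iff_sees)
  then have "sym_diff (sector x) (sector y) = sector y - sector x" by blast
  then have "sector_dist x y = measure lebesgue (sector y) - measure lebesgue (sector x)"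
    unfolding sector_dist_def
    using measurable_measure_Diff[OF sector_lmeasurable fmeasurableD[OF sector_lmeasurable] sub] by simp
  then show ?thesis
    unfolding measure_sector[OF assms(2)] measure_sector[OF assms(3)] right_diff_distrib by linarith
qed

text \<open>Lunes of angle at most \<open>2 * pi / N\<close> are bounded by packing \<open>N\<close>
  of them; a general angle is composed of such lunes, with an error vanishing as \<open>N\<close>
  grows. The two lunes of the symmetric difference have equal volume since the sectors do, which
  doubles the bound.\<close>

lemma sector_dist_rotate:
  assumes \<rho>: "1 \<le> \<rho>" and t: "0 \<le> t"
  shows "sector_dist (polar_point \<rho> p) (polar_point \<rho> (p + t)) \<le> 4 / 3 * sqrt (1 - 1 / \<rho>\<^sup>2) * t"
proof -
  define c where "c = sqrt (1 - 1 / \<rho>\<^sup>2)"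
  define T where "T q = sector (polar_point \<rho> q)" for q
  have T: "T q \<in> lmeasurable" for q unfolding T_def by (rule sector_lmeasurable)
  have "1 \<le> \<rho>\<^sup>2" "0 < \<rho>\<^sup>2" using \<rho> by (simp_all add: one_le_power)
  then have "1 / \<rho>\<^sup>2 \<le> 1" by simp
  then have c: "0 \<le> c" by (simp add: c_def)
  have step: "measure lebesgue (T (q + e) - T q) \<le> 4 * pi / 3 * c / real N"
    if "0 < N" "0 \<le> e" "e \<le> 2 * pi / real N" for N e q
    using measure_lune_small[OF \<rho> that] by (simp add: T_def c_def)
  have chain: "measure lebesgue (T (p + real i * (2 * pi / real N)) - T p) \<le> real i * (4 * pi / 3 * c / real N)"
    if N: "0 < N" for i N
  proof (induction i)
    case (Suc i)
    let ?q = "p + real i * (2 * pi / real N)"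
    have "measure lebesgue (T (?q + 2 * pi / real N) - T p)
        \<le> measure lebesgue ((T (?q + 2 * pi / real N) - T ?q) \<union> (T ?q - T p))"
      by (intro measure_mono_fmeasurable fmeasurableD fmeasurable.Un fmeasurable.Diff T) blast
    also have "\<dots> \<le> measure lebesgue (T (?q + 2 * pi / real N) - T ?q) + measure lebesgue (T ?q - T p)"
      by (intro measure_Un_le fmeasurableD fmeasurable.Diff T)
    also have "\<dots> \<le> 4 * pi / 3 * c / real N + real i * (4 * pi / 3 * c / real N)"
      using Suc N by (intro add_mono step) auto
    also have "\<dots> = real (Suc i) * (4 * pi / 3 * c / real N)" by (simp only: of_nat_Suc distrib_right mult_1_left)
    also have "?q + 2 * pi / real N = p + real (Suc i) * (2 * pi / real N)"
      by (simp only: of_nat_Suc distrib_right mult_1_left ac_simps)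
    finally show ?case .
  qed (simp add: T_def)
  have lune: "measure lebesgue (T (p + t) - T p) \<le> 2 / 3 * c * t + 4 * pi / 3 * c / real N" if N: "0 < N" for N
  proof -
    define i where "i = nat \<lfloor>t * real N / (2 * pi)\<rfloor>"
    have "real i = of_int \<lfloor>t * real N / (2 * pi)\<rfloor>" using t by (simp add: i_def)
    then have i: "real i \<le> t * real N / (2 * pi)" "t * real N / (2 * pi) < real i + 1" by linarith+
    define e where "e = t - real i * (2 * pi / real N)"
    let ?q = "p + real i * (2 * pi / real N)"
    have "(t * real N / (2 * pi)) * (2 * pi / real N) = t" using N by simp
    moreover have "real i * (2 * pi / real N) \<le> (t * real N / (2 * pi)) * (2 * pi / real N)"
      using i(1) by (rule mult_right_mono) simp
    moreover have "(t * real N / (2 * pi)) * (2 * pi / real N) \<le> (real i + 1) * (2 * pi / real N)"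
      using less_imp_le[OF i(2)] by (rule mult_right_mono) simp
    ultimately have e: "0 \<le> e" "e \<le> 2 * pi / real N" unfolding e_def distrib_right by linarith+
    have "measure lebesgue (T (?q + e) - T p) \<le> measure lebesgue ((T (?q + e) - T ?q) \<union> (T ?q - T p))"
      by (intro measure_mono_fmeasurable fmeasurableD fmeasurable.Un fmeasurable.Diff T) blast
    also have "\<dots> \<le> measure lebesgue (T (?q + e) - T ?q) + measure lebesgue (T ?q - T p)"
      by (intro measure_Un_le fmeasurableD fmeasurable.Diff T)
    also have "\<dots> \<le> 4 * pi / 3 * c / real N + real i * (4 * pi / 3 * c / real N)"
      using N e by (intro add_mono step chain) auto
    finally have 1: "measure lebesgue (T (?q + e) - T p) \<le> 4 * pi / 3 * c / real N + real i * (4 * pi / 3 * c / real N)" .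
    have "real i * (4 * pi / 3 * c / real N) \<le> (t * real N / (2 * pi)) * (4 * pi / 3 * c / real N)"
      using i(1) c by (intro mult_right_mono) auto
    also have "(t * real N / (2 * pi)) * (4 * pi / 3 * c / real N) = 2 / 3 * c * t" using N by simp
    finally have 2: "real i * (4 * pi / 3 * c / real N) \<le> 2 / 3 * c * t" .
    have q: "?q + e = p + t" by (simp add: e_def)
    show ?thesis using 1 2 unfolding q by linarith
  qed
  have le: "measure lebesgue (T (p + t) - T p) \<le> 2 / 3 * c * t"
  proof (rule LIMSEQ_le_const)
    have "(\<lambda>n. 2 / 3 * c * t + 4 * pi / 3 * c * inverse (real (Suc n))) \<longlonglongrightarrow> 2 / 3 * c * t + 4 * pi / 3 * c * 0"
      by (intro tendsto_intros LIMSEQ_inverse_real_of_nat)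
    then show "(\<lambda>n. 2 / 3 * c * t + 4 * pi / 3 * c * inverse (real (Suc n))) \<longlonglongrightarrow> 2 / 3 * c * t" by simp
    show "\<exists>N. \<forall>n\<ge>N. measure lebesgue (T (p + t) - T p) \<le> 2 / 3 * c * t + 4 * pi / 3 * c * inverse (real (Suc n))"
      using lune[OF zero_less_Suc] unfolding divide_inverse by blast
  qed
  have eq: "measure lebesgue (T (p + t)) = measure lebesgue (T p)"
  proof -
    have "1 \<le> norm (polar_point \<rho> q)" for q using \<rho> by simp
    from measure_sector[OF this] show ?thesis unfolding T_def by (simp only: norm_polar_point)
  qed
  have diff: "measure lebesgue (A - B) = measure lebesgue A - measure lebesgue (A \<inter> B)"
    if "A \<in> lmeasurable" "B \<in> lmeasurable" for A B :: "(real^3) set"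
  proof -
    have "A - B = A - A \<inter> B" by blast
    then show ?thesis
      using measurable_measure_Diff[OF that(1) fmeasurableD[OF fmeasurable.Int[OF that]] Int_lower1] by simp
  qed
  have "sector_dist (polar_point \<rho> p) (polar_point \<rho> (p + t)) \<le> measure lebesgue (T p - T (p + t)) + measure lebesgue (T (p + t) - T p)"
    unfolding sector_dist_def T_def[symmetric] by (intro measure_Un_le fmeasurableD fmeasurable.Diff T)
  also have "measure lebesgue (T p - T (p + t)) = measure lebesgue (T (p + t) - T p)"
    using diff[OF T T] eq by (simp add: Int_commute)
  finally show ?thesis using le by (simp add: c_def)
qed

section \<open>Change of the cap along a line outside the ball\<close>

text \<open>Both points lie on the line that touches the sphere at angle \<open>q\<close>, at
  tangent lengths \<open>R\<close> and \<open>R'\<close>; moving outwards from the touching point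
  only enlarges the cap.\<close>

lemma polar_point_tangent:
  assumes "0 < R" "R \<le> R'"
  shows "sees (polar_point (sqrt (1 + R\<^sup>2)) (q + arctan R)) \<subseteq> sees (polar_point (sqrt (1 + R'\<^sup>2)) (q + arctan R'))"
proof (rule sees_subset_beyond)
  define z where "z = polar_point 1 q"
  define w where "w = polar_point 1 (q + pi / 2)"
  have eq: "polar_point (sqrt (1 + s\<^sup>2)) (q + arctan s) = z + s *\<^sub>R w" for s
  proof -
    have pos: "sqrt (1 + s\<^sup>2) \<noteq> 0" by (simp add: add_nonneg_eq_0_iff)
    have "sqrt (1 + s\<^sup>2) * cos (q + arctan s) = cos q - s * sin q"
      using pos by (simp add: cos_add cos_arctan sin_arctan right_diff_distrib)
    moreover have "sqrt (1 + s\<^sup>2) * sin (q + arctan s) = sin q + s * cos q"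
      using pos by (simp add: sin_add cos_arctan sin_arctan distrib_left)
    ultimately show ?thesis
      by (simp add: z_def w_def polar_point_def vec_eq_iff forall_3 cos_add sin_add)
  qed
  show "norm z \<le> 1" by (simp add: z_def)
  show "0 < R / R'" "R / R' \<le> 1" using assms by simp_all
  show "polar_point (sqrt (1 + R\<^sup>2)) (q + arctan R) = (1 - R / R') *\<^sub>R z + (R / R') *\<^sub>R polar_point (sqrt (1 + R'\<^sup>2)) (q + arctan R')"
    unfolding eq using assms by (simp add: algebra_simps)
qed

text \<open>On a line at distance \<open>d\<close>, the cap area changes at rate at most
  \<open>((2 * pi - 4) * t + 4 * d * R) / \<rho> ^ 3\<close>, from growth along a tangent and from
  rotation. Equality holds at \<open>d = 1\<close>, \<open>t = R\<close>,
  \<open>\<rho>\<^sup>2 = 3 / 2\<close>; here the constant of the spatial bound arises.\<close>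

lemma inspection_rate_le:
  fixes d t \<rho> R :: real
  assumes "0 \<le> t" "1 \<le> d" "0 < \<rho>" "0 \<le> R" "\<rho>\<^sup>2 = d\<^sup>2 + t\<^sup>2" "R\<^sup>2 = \<rho>\<^sup>2 - 1"
  shows "(2 * pi - 4) * t + 4 * d * R \<le> 4 * pi / (3 * sqrt 3) * \<rho> ^ 3"
proof -
  define k where "k = 2 * pi - 4"
  define E where "E = 4 * pi / (3 * sqrt 3)"
  have pi: "3.1415 < pi" "pi < 3.1416" using pi_approx by simp_all
  have E: "0 < E" "E\<^sup>2 = 16 * pi\<^sup>2 / 27" by (simp_all add: E_def power_divide power_mult_distrib)
  have d2: "1 \<le> d\<^sup>2" using assms(2) by (simp add: one_le_power)
  have "t\<^sup>2 \<le> R\<^sup>2" using assms(5,6) d2 by simp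
  then have tR: "t \<le> R" using assms(4) by (rule power2_le_imp_le)
  define x where "x = \<rho>\<^sup>2"
  have x1: "1 \<le> x" using assms(5) d2 zero_le_power2[of t] unfolding x_def by linarith
  have R2: "R\<^sup>2 = x - 1" using assms(6) by (simp add: x_def)
  have \<rho>3: "(\<rho> ^ 3)\<^sup>2 = x ^ 3" by (simp add: x_def flip: power_mult)
  show ?thesis
  proof (cases "4 * R\<^sup>2 \<le> k")
    case True
    \<comment> \<open>Near the extremal position, \<open>d \<le> (1 + d\<^sup>2) / 2\<close>
      replaces \<open>d\<close> by its square, and the resulting bound is largest at
      \<open>t = R\<close>, where the line is tangent to the sphere.\<close>
    have "d \<le> 1 + (d\<^sup>2 - 1) / 2" using sum_squares_bound[of 1 d] by (simp add: field_simps)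
    also have "d\<^sup>2 - 1 = R\<^sup>2 - t\<^sup>2" using assms(5,6) by simp
    finally have "R * d \<le> R * (1 + (R\<^sup>2 - t\<^sup>2) / 2)" using assms(4) by (rule mult_left_mono)
    note Rd = this
    have D: "4 * (R * (1 + D / 2)) = 4 * R + 2 * R * D" for D by (simp add: field_simps)
    have 1: "k * t + 4 * d * R \<le> k * t + 4 * R + 2 * R * (R\<^sup>2 - t\<^sup>2)"
    proof -
      have "4 * (R * d) \<le> 4 * R + 2 * R * (R\<^sup>2 - t\<^sup>2)" using Rd D[of "R\<^sup>2 - t\<^sup>2"] by linarith
      moreover have "4 * d * R = 4 * (R * d)" by simp
      ultimately show ?thesis by linarith
    qed
    have "2 * R * (R + t) \<le> 2 * R * (R + R)" using tR assms(4) by (intro mult_left_mono) auto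
    then have "2 * R * (R + t) \<le> k" using True by (simp add: power2_eq_square)
    then have "0 \<le> (R - t) * (k - 2 * R * (R + t))" using tR by (intro mult_nonneg_nonneg) auto
    then have "k * t + 2 * R * (R\<^sup>2 - t\<^sup>2) \<le> k * R" by (simp add: power2_eq_square algebra_simps)
    then have "k * t + 4 * d * R \<le> 2 * pi * R" using 1 by (simp add: k_def algebra_simps)
    also have "\<dots> \<le> E * \<rho> ^ 3"
    proof (rule power2_le_imp_le)
      \<comment> \<open>The double root \<open>x = 3 / 2\<close> is the extremal squared
        distance.\<close>
      have "0 \<le> (2 * x - 3)\<^sup>2 * (x + 3)" using x1 by simp
      then have "27 * (x - 1) \<le> 4 * x ^ 3" by (simp add: power2_eq_square power3_eq_cube algebra_simps)
      then have "4 * pi\<^sup>2 * (27 * (x - 1)) / 27 \<le> 4 * pi\<^sup>2 * (4 * x ^ 3) / 27"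
        by (intro divide_right_mono mult_left_mono) auto
      then show "(2 * pi * R)\<^sup>2 \<le> (E * \<rho> ^ 3)\<^sup>2"
        unfolding power_mult_distrib E(2) R2 \<rho>3 by simp
      show "0 \<le> E * \<rho> ^ 3" using E assms(3) by simp
    qed
    finally show ?thesis by (simp add: k_def E_def)
  next
    case False
    have k: "2.283 < k" "k < 2.2832" using pi by (simp_all add: k_def)
    have x: "1.5707 < x" using False R2 k by simp
    have "k * t + 4 * d * R \<le> E * \<rho> ^ 3"
    proof (rule power2_le_imp_le)
      \<comment> \<open>Away from the extremal position, Cauchy-Schwarz for the vectors
        \<open>(k, 4 * R)\<close> and \<open>(t, d)\<close> leaves room for numerical
        bounds.\<close>
      have "(k * t + 4 * R * d)\<^sup>2 \<le> (k\<^sup>2 + (4 * R)\<^sup>2) * (t\<^sup>2 + d\<^sup>2)"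
        using zero_le_power2[of "k * d - 4 * R * t"] by (simp add: power2_eq_square algebra_simps)
      also have "\<dots> = (k\<^sup>2 + 16 * (x - 1)) * x"
        using assms(5) by (simp add: power_mult_distrib R2 x_def add.commute)
      also have "\<dots> \<le> (E\<^sup>2 * x\<^sup>2) * x"
      proof (rule mult_right_mono)
        have "k\<^sup>2 \<le> 2.2832\<^sup>2" using k by (intro power_mono) auto
        moreover have "3.1415\<^sup>2 \<le> pi\<^sup>2" using pi by (intro power_mono) auto
        then have "5.848 \<le> E\<^sup>2" unfolding E(2) by (simp add: power2_eq_square)
        then have "5.848 * x\<^sup>2 \<le> E\<^sup>2 * x\<^sup>2" by (rule mult_right_mono) simp
        \<comment> \<open>\<open>1.5707\<close> bounds \<open>x\<close> from below and
          \<open>5.848\<close> bounds \<open>E\<^sup>2\<close>; \<open>6.8145464\<close> is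
          \<open>16 - 1.5707 * 5.848\<close>, which makes the linear coefficient of the product
          equal to \<open>-16\<close>.\<close>
        moreover have "0 \<le> (x - 1.5707) * (5.848 * x - 6.8145464)" using x by (intro mult_nonneg_nonneg) auto
        then have "16 * (x - 1) + 5.2131 \<le> 5.848 * x\<^sup>2"
        proof -
          have "(x - 1.5707) * (5.848 * x - 6.8145464)
              = 5.848 * x\<^sup>2 - 6.8145464 * x - 1.5707 * 5.848 * x + 1.5707 * 6.8145464"
            by algebra
          with \<open>0 \<le> (x - 1.5707) * (5.848 * x - 6.8145464)\<close> show ?thesis by simp
        qed
        ultimately show "k\<^sup>2 + 16 * (x - 1) \<le> E\<^sup>2 * x\<^sup>2" by (simp add: power2_eq_square)
      qed (use x1 in auto)
      also have "\<dots> = (E * \<rho> ^ 3)\<^sup>2" unfolding power_mult_distrib \<rho>3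
        by (simp add: power2_eq_square power3_eq_cube)
      finally show "(k * t + 4 * d * R)\<^sup>2 \<le> (E * \<rho> ^ 3)\<^sup>2" by (simp add: mult_ac)
      show "0 \<le> E * \<rho> ^ 3" using E assms(3) by simp
    qed
    then show ?thesis by (simp add: k_def E_def)
  qed
qed

text \<open>The straight move is replaced by two: outwards along the tangent through the first point
  until the norm is \<open>\<rho> t\<close>, where the caps are nested, and then a rotation.
  \<open>\<psi> t\<close> is the angle at which that tangent touches the sphere, so the rotation is
  by \<open>\<psi> t - \<psi> s\<close>.\<close>

lemma sector_dist_step:
  fixes d :: real
  assumes d: "1 < d" and st: "0 \<le> s" "s \<le> t"
  defines "\<rho> \<equiv> \<lambda>t. sqrt (d\<^sup>2 + t\<^sup>2)" and "R \<equiv> \<lambda>t. sqrt (d\<^sup>2 + t\<^sup>2 - 1)"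
    and "\<psi> \<equiv> \<lambda>t. arctan (t / d) - arctan (sqrt (d\<^sup>2 + t\<^sup>2 - 1))"
  assumes \<psi>: "\<psi> s \<le> \<psi> t"
  shows "3 * sector_dist (polar_point (\<rho> s) (arctan (s / d))) (polar_point (\<rho> t) (arctan (t / d)))
    \<le> 2 * pi * (1 / \<rho> s - 1 / \<rho> t) + 4 * (R t / \<rho> t) * (\<psi> t - \<psi> s)"
proof -
  have d2: "1 < d\<^sup>2" using d by (simp add: one_less_power)
  have pos: "1 < d\<^sup>2 + t\<^sup>2" for t :: real using d2 zero_le_power2[of t] by linarith
  have R: "0 < R t" "(R t)\<^sup>2 = d\<^sup>2 + t\<^sup>2 - 1" "\<rho> t = sqrt (1 + (R t)\<^sup>2)" for t
    using pos[of t] by (simp_all add: R_def \<rho>_def)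
  have \<rho>1: "1 \<le> \<rho> t" for t using pos[of t] by (simp add: \<rho>_def)
  have "s\<^sup>2 \<le> t\<^sup>2" using st by (intro power_mono) auto
  then have "R s \<le> R t" by (simp add: R_def)
  define x where "x = polar_point (\<rho> s) (arctan (s / d))"
  define y where "y = polar_point (\<rho> t) (\<psi> s + arctan (R t))"
  define z where "z = polar_point (\<rho> t) (arctan (t / d))"
  have x: "x = polar_point (\<rho> s) (\<psi> s + arctan (R s))" by (simp add: x_def \<psi>_def R_def)
  have "sees x \<subseteq> sees y"
    unfolding x y_def R(3) by (rule polar_point_tangent[OF R(1) \<open>R s \<le> R t\<close>])
  then have "sector_dist x y = 2 * pi / 3 * (1 / \<rho> s - 1 / \<rho> t)"
    using \<rho>1[of s] \<rho>1[of t] by (subst sector_dist_nested) (simp_all add: x_def y_def)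
  moreover have z: "z = polar_point (\<rho> t) (\<psi> s + arctan (R t) + (\<psi> t - \<psi> s))"
    by (simp add: z_def \<psi>_def R_def)
  have "sector_dist y z \<le> 4 / 3 * sqrt (1 - 1 / (\<rho> t)\<^sup>2) * (\<psi> t - \<psi> s)"
    unfolding y_def z by (rule sector_dist_rotate[OF \<rho>1]) (use \<psi> in simp)
  moreover have "sqrt (1 - 1 / (\<rho> t)\<^sup>2) = R t / \<rho> t"
  proof -
    have "1 - 1 / (\<rho> t)\<^sup>2 = (R t / \<rho> t)\<^sup>2" using pos[of t] d by (simp add: power_divide R_def \<rho>_def diff_divide_distrib)
    then show ?thesis using R(1)[of t] \<rho>1[of t] by simp
  qed
  ultimately show ?thesis
    using sector_dist_triangle[of x z y] by (simp add: x_def z_def)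
qed

text \<open>A Riemann sum argument. One step is estimated with the factor \<open>c\<close> at its
  right end, while the derivative bound needs it at the left end. Over equal parts the differences
  of \<open>c\<close> telescope to at most 1, so the total error is at most four times the mesh and
  vanishes in the limit.\<close>

lemma sector_dist_line:
  fixes d :: real
  assumes d: "1 < d" and ab: "0 \<le> a" "a \<le> b"
  defines "P \<equiv> \<lambda>t. polar_point (sqrt (d\<^sup>2 + t\<^sup>2)) (arctan (t / d))"
  shows "3 * sector_dist (P a) (P b) \<le> 4 * pi / (3 * sqrt 3) * (b - a)"
proof -
  define E where "E = 4 * pi / (3 * sqrt 3)"
  define \<rho> where "\<rho> t = sqrt (d\<^sup>2 + t\<^sup>2)" for t
  define R where "R t = sqrt (d\<^sup>2 + t\<^sup>2 - 1)" for t
  define \<psi> where "\<psi> t = arctan (t / d) - arctan (R t)" for t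
  define c where "c t = R t / \<rho> t" for t
  have d2: "1 < d\<^sup>2" using d by (simp add: one_less_power)
  have pos: "1 < d\<^sup>2 + t\<^sup>2" for t :: real using d2 zero_le_power2[of t] by linarith
  have R: "0 < R t" "(R t)\<^sup>2 = d\<^sup>2 + t\<^sup>2 - 1" for t using pos[of t] by (simp_all add: R_def)
  have \<rho>: "1 < \<rho> t" "0 < \<rho> t" "(\<rho> t)\<^sup>2 = d\<^sup>2 + t\<^sup>2" for t
    using pos[of t] by (simp_all add: \<rho>_def)
  have D\<rho>: "(\<rho> has_real_derivative t / \<rho> t) (at t)" for t
    unfolding \<rho>_def using pos[of t] by (auto intro!: derivative_eq_intros simp: field_simps)
  have DR: "(R has_real_derivative t / R t) (at t)" for t
    unfolding R_def using pos[of t] by (auto intro!: derivative_eq_intros simp: field_simps)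
  have Dinv: "((\<lambda>t. 1 / \<rho> t) has_real_derivative - t / \<rho> t ^ 3) (at t)" for t
  proof -
    have "((\<lambda>t. inverse (\<rho> t)) has_real_derivative - (inverse (\<rho> t) * (t / \<rho> t) * inverse (\<rho> t))) (at t)"
      using D\<rho> \<rho>(2)[of t] by (intro DERIV_inverse') auto
    then show ?thesis using \<rho>(2)[of t] by (simp add: divide_inverse power3_eq_cube mult_ac)
  qed
  have D\<psi>: "(\<psi> has_real_derivative (d * R t - t) / ((\<rho> t)\<^sup>2 * R t)) (at t)" for t
  proof -
    have "((\<lambda>t. arctan (t / d)) has_real_derivative inverse (1 + (t / d)\<^sup>2) * (1 / d)) (at t)"
      by (rule DERIV_chain2[OF DERIV_arctan DERIV_cdivide[OF DERIV_ident]])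
    moreover have "inverse (1 + (t / d)\<^sup>2) * (1 / d) = d / (\<rho> t)\<^sup>2"
    proof -
      have "1 + (t / d)\<^sup>2 = (\<rho> t)\<^sup>2 / d\<^sup>2" using d by (simp add: \<rho>(3) power_divide field_simps)
      then show ?thesis using d by (simp add: power2_eq_square)
    qed
    moreover have "((\<lambda>t. arctan (R t)) has_real_derivative inverse (1 + (R t)\<^sup>2) * (t / R t)) (at t)"
      by (rule DERIV_chain2[OF DERIV_arctan DR])
    moreover have "inverse (1 + (R t)\<^sup>2) * (t / R t) = t / ((\<rho> t)\<^sup>2 * R t)"
      by (simp add: R(2) \<rho>(3) divide_inverse)
    ultimately have "(\<psi> has_real_derivative d / (\<rho> t)\<^sup>2 - t / ((\<rho> t)\<^sup>2 * R t)) (at t)"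
      unfolding \<psi>_def using DERIV_diff by fastforce
    moreover have "d / (\<rho> t)\<^sup>2 - t / ((\<rho> t)\<^sup>2 * R t) = (d * R t - t) / ((\<rho> t)\<^sup>2 * R t)"
      using R(1)[of t] by (simp add: diff_divide_distrib)
    ultimately show ?thesis by simp
  qed
  have tR: "t \<le> d * R t" if "0 \<le> t" for t
  proof (rule power2_le_imp_le)
    have "0 \<le> (d\<^sup>2 - 1) * (d\<^sup>2 + t\<^sup>2)" using d2 by simp
    then show "t\<^sup>2 \<le> (d * R t)\<^sup>2" by (simp add: power_mult_distrib R(2) algebra_simps)
    show "0 \<le> d * R t" using d R(1)[of t] by simp
  qed
  have \<psi>_mono: "\<psi> s \<le> \<psi> t" if st: "0 \<le> s" "s \<le> t" for s t
  proof (rule DERIV_nonneg_imp_nondecreasing[OF st(2)])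
    fix x assume "s \<le> x" "x \<le> t"
    then have "0 \<le> (d * R x - x) / ((\<rho> x)\<^sup>2 * R x)" using tR[of x] st R(1)[of x] by simp
    then show "\<exists>y. (\<psi> has_real_derivative y) (at x) \<and> 0 \<le> y" using D\<psi> by blast
  qed
  have \<psi>_lip: "\<psi> t - \<psi> s \<le> t - s" if st: "0 \<le> s" "s \<le> t" for s t
  proof -
    have "s - \<psi> s \<le> t - \<psi> t"
    proof (rule DERIV_nonneg_imp_nondecreasing[OF st(2)])
      fix x assume x: "s \<le> x" "x \<le> t"
      have "d * 1 \<le> d * d" using d by (intro mult_left_mono) auto
      then have "d \<le> d\<^sup>2" by (simp add: power2_eq_square)
      then have "d \<le> (\<rho> x)\<^sup>2" using \<rho>(3)[of x] zero_le_power2[of x] by linarith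
      then have "d * R x \<le> (\<rho> x)\<^sup>2 * R x" using R(1)[of x] by (intro mult_right_mono) auto
      then have "d * R x - x \<le> (\<rho> x)\<^sup>2 * R x" using x st by simp
      then have "(d * R x - x) / ((\<rho> x)\<^sup>2 * R x) \<le> 1" using R(1)[of x] \<rho>(2)[of x] by (simp add: divide_le_eq_1)
      then have "0 \<le> 1 - (d * R x - x) / ((\<rho> x)\<^sup>2 * R x)" by simp
      then show "\<exists>y. ((\<lambda>x. x - \<psi> x) has_real_derivative y) (at x) \<and> 0 \<le> y"
        using DERIV_diff[OF DERIV_ident D\<psi>] by blast
    qed
    then show ?thesis by simp
  qed
  have c_mono: "c s \<le> c t" if st: "0 \<le> s" "s \<le> t" for s t
  proof (rule power2_le_imp_le)
    have c2: "(c t)\<^sup>2 = 1 - 1 / (d\<^sup>2 + t\<^sup>2)" for t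
      using pos[of t] d by (simp add: c_def power_divide R(2) \<rho>(3) diff_divide_distrib)
    have "s\<^sup>2 \<le> t\<^sup>2" using st by (intro power_mono) auto
    then show "(c s)\<^sup>2 \<le> (c t)\<^sup>2" unfolding c2 using pos[of s] by (simp add: divide_left_mono frac_le)
    show "0 \<le> c t" using R(1)[of t] \<rho>(2)[of t] by (simp add: c_def)
  qed
  have c01: "0 \<le> c t" "c t \<le> 1" for t
  proof -
    show "0 \<le> c t" using R(1)[of t] \<rho>(2)[of t] by (simp add: c_def)
    have "R t \<le> \<rho> t" by (simp add: R_def \<rho>_def)
    then show "c t \<le> 1" using \<rho>(2)[of t] by (simp add: c_def)
  qed
  \<comment> \<open>With \<open>c\<close> frozen at the left end, where it is smallest, the
    derivative of \<open>H\<close> is nonnegative by \<open>inspection_rate_le\<close>.\<close>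
  have main: "2 * pi * (1 / \<rho> s - 1 / \<rho> t) + 4 * c s * (\<psi> t - \<psi> s) \<le> E * (t - s)" if st: "0 \<le> s" "s \<le> t" for s t
  proof -
    define H where "H x = E * x + 2 * pi * (1 / \<rho> x) - 4 * c s * \<psi> x" for x
    have "H s \<le> H t"
    proof (rule DERIV_nonneg_imp_nondecreasing[OF st(2)])
      fix x assume x: "s \<le> x" "x \<le> t"
      let ?D = "E * 1 + 2 * pi * (- x / \<rho> x ^ 3) - 4 * c s * ((d * R x - x) / ((\<rho> x)\<^sup>2 * R x))"
      have "(H has_real_derivative ?D) (at x)"
        unfolding H_def by (intro DERIV_diff DERIV_add DERIV_cmult DERIV_ident Dinv D\<psi>)
      moreover have "0 \<le> ?D"
      proof -
        have x0: "0 \<le> x" using x st by simp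
        have "0 \<le> (d * R x - x) / ((\<rho> x)\<^sup>2 * R x)" using tR[OF x0] R(1)[of x] by simp
        then have "4 * c s * ((d * R x - x) / ((\<rho> x)\<^sup>2 * R x)) \<le> 4 * c x * ((d * R x - x) / ((\<rho> x)\<^sup>2 * R x))"
          using c_mono[of s x] x st by (intro mult_right_mono) auto
        also have "\<dots> = 4 * (d * R x - x) / \<rho> x ^ 3"
          using R(1)[of x] \<rho>(2)[of x] by (simp add: c_def power2_eq_square power3_eq_cube)
        finally have 1: "4 * c s * ((d * R x - x) / ((\<rho> x)\<^sup>2 * R x)) \<le> 4 * (d * R x - x) / \<rho> x ^ 3" .
        have "(2 * pi - 4) * x + 4 * d * R x \<le> E * \<rho> x ^ 3"
          unfolding E_def using x0 d \<rho>(2)[of x] R(1)[of x] \<rho>(3)[of x] R(2)[of x]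
          by (intro inspection_rate_le) auto
        then have "((2 * pi - 4) * x + 4 * d * R x) / \<rho> x ^ 3 \<le> E"
          using \<rho>(2)[of x] by (simp add: divide_le_eq)
        moreover have "((2 * pi - 4) * x + 4 * d * R x) / \<rho> x ^ 3 = 2 * pi * (x / \<rho> x ^ 3) + 4 * (d * R x - x) / \<rho> x ^ 3"
          by (simp add: add_divide_distrib[symmetric] algebra_simps)
        ultimately show ?thesis using 1 by simp
      qed
      ultimately show "\<exists>y. (H has_real_derivative y) (at x) \<and> 0 \<le> y" by blast
    qed
    then show ?thesis by (simp add: H_def algebra_simps)
  qed
  have step: "3 * sector_dist (P s) (P t) \<le> E * (t - s) + 4 * (c t - c s) * (t - s)" if st: "0 \<le> s" "s \<le> t" for s t
  proof -
    have "3 * sector_dist (P s) (P t) \<le> 2 * pi * (1 / \<rho> s - 1 / \<rho> t) + 4 * c t * (\<psi> t - \<psi> s)"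
      using sector_dist_step[OF d st] \<psi>_mono[OF st] unfolding P_def \<rho>_def R_def \<psi>_def c_def by simp
    also have "\<dots> = (2 * pi * (1 / \<rho> s - 1 / \<rho> t) + 4 * c s * (\<psi> t - \<psi> s)) + 4 * (c t - c s) * (\<psi> t - \<psi> s)"
      by (simp add: algebra_simps)
    also have "\<dots> \<le> E * (t - s) + 4 * (c t - c s) * (t - s)"
      using main[OF st] \<psi>_lip[OF st] c_mono[OF st] by (intro add_mono mult_left_mono) auto
    finally show ?thesis .
  qed
  have bound: "3 * sector_dist (P a) (P b) \<le> E * (b - a) + 4 * (b - a) * inverse (real (Suc n))" for n
  proof -
    define h where "h = (b - a) / real (Suc n)"
    define p where "p i = a + real i * h" for i
    have h: "0 \<le> h" using ab by (simp add: h_def)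
    have p: "0 \<le> p i" "p (Suc i) - p i = h" for i using ab h by (simp_all add: p_def algebra_simps)
    have "3 * sector_dist (P a) (P (p k)) \<le> E * (real k * h) + 4 * (c (p k) - c a) * h" for k
    proof (induction k)
      case (Suc k)
      have "3 * sector_dist (P (p k)) (P (p (Suc k))) \<le> E * h + 4 * (c (p (Suc k)) - c (p k)) * h"
        using step[of "p k" "p (Suc k)"] p[of k] h by simp
      then show ?case
        using Suc sector_dist_triangle[of "P a" "P (p (Suc k))" "P (p k)"] by (simp add: algebra_simps)
    qed (simp add: p_def)
    from this[of "Suc n"]
    have "3 * sector_dist (P a) (P b) \<le> E * (b - a) + 4 * (c b - c a) * h"
      by (simp add: p_def h_def)
    also have "4 * (c b - c a) * h \<le> 4 * 1 * h"
      using c01[of b] c01[of a] h by (intro mult_right_mono) auto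
    finally show ?thesis by (simp only: h_def divide_inverse mult.assoc mult_1)
  qed
  have "3 * sector_dist (P a) (P b) \<le> E * (b - a)"
  proof (rule LIMSEQ_le_const)
    have "(\<lambda>n. E * (b - a) + 4 * (b - a) * inverse (real (Suc n))) \<longlonglongrightarrow> E * (b - a) + 4 * (b - a) * 0"
      by (intro tendsto_intros LIMSEQ_inverse_real_of_nat)
    then show "(\<lambda>n. E * (b - a) + 4 * (b - a) * inverse (real (Suc n))) \<longlonglongrightarrow> E * (b - a)" by simp
  qed (use bound in blast)
  then show ?thesis by (simp add: E_def)
qed

lemma sector_dist_line_signed:
  fixes d :: real
  assumes d: "1 < d" and st: "s \<le> t"
  defines "P \<equiv> \<lambda>t. of_triple ((d, t), 0)"
  shows "3 * sector_dist (P s) (P t) \<le> 4 * pi / (3 * sqrt 3) * (t - s)"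
proof -
  have P: "P t = polar_point (sqrt (d\<^sup>2 + t\<^sup>2)) (arctan (t / d))" for t
  proof -
    have "1 + (t / d)\<^sup>2 = (d\<^sup>2 + t\<^sup>2) / d\<^sup>2" using d by (simp add: power_divide field_simps)
    then have "sqrt (1 + (t / d)\<^sup>2) = sqrt (d\<^sup>2 + t\<^sup>2) / d" using d by (simp add: real_sqrt_divide)
    moreover have "sqrt (d\<^sup>2 + t\<^sup>2) \<noteq> 0" using d by (simp add: add_nonneg_eq_0_iff)
    ultimately show ?thesis using d by (simp add: P_def polar_point_def cos_arctan sin_arctan)
  qed
  have pos: "3 * sector_dist (P s) (P t) \<le> 4 * pi / (3 * sqrt 3) * (t - s)" if "0 \<le> s" "s \<le> t" for s t
    unfolding P using sector_dist_line[OF d that] .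
  define f :: "real^3 \<Rightarrow> real^3" where "f v = of_triple ((v $ 1, - (v $ 2)), v $ 3)" for v
  have "linear f"
    by (rule linearI) (simp_all add: f_def vec_eq_iff forall_3)
  moreover have "norm (f v) = norm v" for v
    by (simp add: f_def norm_prod_def norm_vec_def L2_set_def sum_3)
  ultimately have f: "orthogonal_transformation f" by (simp add: orthogonal_transformation)
  have fP: "f (P t) = P (- t)" for t by (simp add: f_def P_def)
  have neg: "3 * sector_dist (P s) (P t) \<le> 4 * pi / (3 * sqrt 3) * (t - s)" if "t \<le> 0" "s \<le> t" for s t
    using pos[of "- t" "- s"] that sector_dist_orthogonal[OF f, of "P s" "P t"]
    by (simp add: fP sector_dist_commute)
  consider "0 \<le> s" | "t \<le> 0" | "s \<le> 0" "0 \<le> t" by linarith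
  then show ?thesis
  proof cases
    case 3
    define E where "E = 4 * pi / (3 * sqrt 3)"
    have "3 * sector_dist (P s) (P 0) \<le> E * (0 - s)" "3 * sector_dist (P 0) (P t) \<le> E * (t - 0)"
      unfolding E_def using 3 by (intro neg pos; simp)+
    then show ?thesis
      using sector_dist_triangle[of "P s" "P t" "P 0"] unfolding E_def[symmetric] by (simp add: algebra_simps)
  qed (use pos neg st in auto)
qed

text \<open>In the orthonormal frame formed by the direction \<open>a\<close> of the foot of the
  perpendicular, the direction \<open>T\<close> of the line and a common normal \<open>c\<close>,
  the points become \<open>(d, s, 0)\<close> and \<open>(d, s + dist x y, 0)\<close>.\<close>

lemma sector_dist_outside:
  fixes x y :: "real^3"
  assumes line: "\<And>t. 1 < norm (x + t *\<^sub>R (y - x))" and "x \<noteq> y"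
  shows "3 * sector_dist x y \<le> 4 * pi / (3 * sqrt 3) * dist x y"
proof -
  define T where "T = sgn (y - x)"
  have T: "norm T = 1" "y = x + dist x y *\<^sub>R T"
    using \<open>x \<noteq> y\<close> by (simp_all add: T_def norm_sgn sgn_div_norm dist_norm norm_minus_commute)
  have TT: "T \<bullet> T = 1" using T(1) by (simp add: dot_square_norm)
  define s where "s = T \<bullet> x"
  define a0 where "a0 = x - s *\<^sub>R T"
  define d where "d = norm a0"
  have a0T: "a0 \<bullet> T = 0" by (simp add: a0_def s_def inner_diff_left inner_diff_right TT inner_commute)
  have d: "1 < d"
  proof -
    have "a0 = x + (- s / dist x y) *\<^sub>R (y - x)"
      using \<open>x \<noteq> y\<close> by (simp add: a0_def T_def sgn_div_norm dist_norm norm_minus_commute divide_inverse)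
    then show ?thesis using line[of "- s / dist x y"] unfolding d_def by simp
  qed
  define a where "a = sgn a0"
  have "a0 \<noteq> 0" using d by (auto simp: d_def)
  then have a: "norm a = 1" "a0 = d *\<^sub>R a" by (simp_all add: a_def d_def norm_sgn sgn_div_norm)
  have aa: "a \<bullet> a = 1" using a(1) by (simp add: dot_square_norm)
  have aT: "a \<bullet> T = 0" using a0T by (simp add: a_def sgn_div_norm)
  have "dim {a, T} \<le> card {a, T}" by (rule dim_le_card') simp
  also have "\<dots> \<le> 2" by (simp add: card_insert_if)
  finally have "dim {a, T} < DIM(real^3)" by simp
  then obtain c0 where c0: "c0 \<noteq> 0" "\<And>v. v \<in> span {a, T} \<Longrightarrow> orthogonal c0 v"
    using orthogonal_to_subspace_exists by metis
  define c where "c = sgn c0"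
  have c: "norm c = 1" "c \<bullet> a = 0" "c \<bullet> T = 0"
    using c0(1) c0(2)[OF span_base, of a] c0(2)[OF span_base, of T]
    by (simp_all add: c_def norm_sgn sgn_div_norm orthogonal_def)
  define A :: "real^3^3" where "A = (\<chi> i. if i = 1 then a else if i = 2 then T else c)"
  have A: "A $ 1 = a" "A $ 2 = T" "A $ 3 = c" by (simp_all add: A_def)
  have "row i A = A $ i" for i by (simp add: row_def vec_eq_iff)
  then have "orthogonal_matrix A"
    unfolding orthogonal_matrix_orthonormal_rows using a(1) T(1) c aT
    by (simp add: forall_3 A orthogonal_def inner_commute)
  then have f: "orthogonal_transformation (\<lambda>v. A *v v)"
    by (simp add: orthogonal_transformation_matrix)
  have x: "x = d *\<^sub>R a + s *\<^sub>R T" using a(2) by (simp add: a0_def diff_eq_eq)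
  have y: "y = d *\<^sub>R a + (s + dist x y) *\<^sub>R T" using T(2) unfolding scaleR_add_left by (simp flip: x add.assoc)
  have orth: "T \<bullet> a = 0" "a \<bullet> c = 0" "T \<bullet> c = 0" using aT c by (simp_all add: inner_commute)
  have Av: "A *v (d *\<^sub>R a + t *\<^sub>R T) = of_triple ((d, t), 0)" for t
    by (simp add: vec_eq_iff forall_3 matrix_vector_mul_component A inner_add_right aa TT aT c orth)
  have "sector_dist x y = sector_dist (A *v x) (A *v y)"
    by (rule sector_dist_orthogonal[OF f, symmetric])
  also have "\<dots> = sector_dist (of_triple ((d, s), 0)) (of_triple ((d, s + dist x y), 0))"
    unfolding Av[symmetric] x[symmetric] y[symmetric] ..
  finally show ?thesis
    using sector_dist_line_signed[OF d, of s "s + dist x y"] by simp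
qed

lemma sector_dist_unnested:
  fixes x y :: "real^3"
  assumes un: "unnested x y"
  shows "3 * sector_dist x y \<le> 4 * pi / (3 * sqrt 3) * dist x y"
  using unnested_cases[OF un]
proof
  assume "\<forall>t. 1 < norm (x + t *\<^sub>R (y - x))"
  moreover have "x \<noteq> y" using un by (auto simp: unnested_def)
  ultimately show ?thesis by (intro sector_dist_outside) auto
next
  define E where "E = 4 * pi / (3 * sqrt 3)"
  have E: "0 \<le> E" "E\<^sup>2 = 16 * pi\<^sup>2 / 27" by (simp_all add: E_def power_divide power_mult_distrib)
  \<comment> \<open>The area of a cap against the tangent length. After squaring and cancelling
    \<open>r - 1\<close>, what remains is a cubic in \<open>r\<close> that is a nonnegative
    double-root polynomial plus \<open>4 * r\<^sup>2\<close>.\<close>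
  have cap: "2 * pi * (1 - 1 / r) \<le> E * sqrt (r\<^sup>2 - 1)" if r: "1 \<le> r" for r
  proof (rule power2_le_imp_le)
    have "0 \<le> (2 * r - 3)\<^sup>2 * (r + 3) + 4 * r\<^sup>2" using r by simp
    then have "27 * (r - 1) \<le> 4 * r\<^sup>2 * (r + 1)" by (simp add: power2_eq_square algebra_simps)
    then have "(r - 1) * (27 * (r - 1)) \<le> (r - 1) * (4 * r\<^sup>2 * (r + 1))" using r by (intro mult_left_mono) auto
    then have "27 * (r - 1)\<^sup>2 \<le> 4 * (r\<^sup>2 - 1) * r\<^sup>2" by (simp add: power2_eq_square algebra_simps)
    then have "27 * (r - 1)\<^sup>2 / r\<^sup>2 \<le> 4 * (r\<^sup>2 - 1)" using r by (simp add: pos_divide_le_eq)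
    moreover have "(1 - 1 / r)\<^sup>2 = (r - 1)\<^sup>2 / r\<^sup>2"
    proof -
      have "1 - 1 / r = (r - 1) / r" using r by (simp add: diff_divide_distrib)
      then show ?thesis by (simp add: power_divide)
    qed
    ultimately have "27 * (1 - 1 / r)\<^sup>2 \<le> 4 * (r\<^sup>2 - 1)" by simp
    then have "4 * pi\<^sup>2 / 27 * (27 * (1 - 1 / r)\<^sup>2) \<le> 4 * pi\<^sup>2 / 27 * (4 * (r\<^sup>2 - 1))" by (intro mult_left_mono) auto
    then show "(2 * pi * (1 - 1 / r))\<^sup>2 \<le> (E * sqrt (r\<^sup>2 - 1))\<^sup>2"
      unfolding power_mult_distrib E(2) using r by simp
    show "0 \<le> E * sqrt (r\<^sup>2 - 1)" using E r by simp
  qed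
  assume "\<exists>z\<in>closed_segment x y. norm z \<le> 1"
  then obtain z where z: "z \<in> closed_segment x y" "norm z \<le> 1" by blast
  have nx: "1 \<le> norm x" "1 \<le> norm y" using unnested_norm_ge[OF un] by auto
  have third: "3 * p \<le> q + r" if "p \<le> q / 3 + r / 3" for p q r :: real using that by simp
  have "3 * sector_dist x y \<le> 2 * pi * (1 - 1 / norm x) + 2 * pi * (1 - 1 / norm y)"
    using sector_dist_le_sum[of x y] unfolding measure_sector[OF nx(1)] measure_sector[OF nx(2)]
    unfolding times_divide_eq_left by (rule third)
  also have "\<dots> \<le> E * sqrt ((norm x)\<^sup>2 - 1) + E * sqrt ((norm y)\<^sup>2 - 1)"
    using cap[OF nx(1)] cap[OF nx(2)] by (rule add_mono)
  also have "\<dots> = E * (sqrt ((norm x)\<^sup>2 - 1) + sqrt ((norm y)\<^sup>2 - 1))" by (simp only: distrib_left)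
  also have "\<dots> \<le> E * dist x y"
    using unnested_segment_meets_ball[OF un z] E(1) by (rule mult_left_mono)
  finally show ?thesis by (simp add: E_def)
qed

lemma spatial_inradius_closed:
  fixes xs :: "(real^3) list"
  assumes "covering xs" "xs \<noteq> []"
  shows "6 * sqrt 3 \<le> edge_sum dist (xs @ [hd xs])"
proof -
  obtain ys :: "(real^3) list" where ys: "covering ys" "ys \<noteq> []" "successively unnested (ys @ [hd ys])"
    "edge_sum dist (ys @ [hd ys]) \<le> edge_sum dist (xs @ [hd xs])"
    by (rule prune_closed[OF assms])
  define E where "E = 4 * pi / (3 * sqrt 3)"
  have E: "0 < E" by (simp add: E_def)
  define B :: "(real^3) set" where "B = cball 0 1 - {0}"
  have B: "B \<in> sets borel" by (simp add: B_def)
  define M where "M = restrict_space lborel B"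
  have space_M: "space M = B" by (simp add: M_def space_restrict_space)
  have sets_M: "A \<in> sets M \<longleftrightarrow> A \<subseteq> B \<and> A \<in> sets lborel" for A
    unfolding M_def by (rule sets_restrict_space_iff) (use B in simp)
  have meas_M: "measure M A = measure lborel A" if "A \<subseteq> B" for A
    unfolding M_def using that B by (intro measure_restrict_space) auto
  have "emeasure lborel B \<le> emeasure lborel (cball (0 :: real^3) 1)"
    unfolding B_def by (intro emeasure_mono) auto
  then have fin_B: "emeasure lborel B < \<infinity>"
    using emeasure_bounded_finite[OF bounded_cball] by (rule le_less_trans)
  have fin_M: "finite_measure M"
    using fin_B B unfolding M_def by (intro finite_measureI) (simp add: space_restrict_space emeasure_restrict_space)
  have sub: "sector w \<subseteq> B" for w by (auto simp: sector_def B_def)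
  have sees_sgn: "\<exists>x\<in>set (ys @ [hd ys]). sgn v \<in> sees x" if "v \<noteq> 0" for v
    using ys(1) norm_sgn[of v] that unfolding covering_def by (metis Un_iff set_append)
  have "2 * measure M (space M) \<le> edge_sum (\<lambda>x y. measure M (sym_diff (sector x) (sector y))) (ys @ [hd ys])"
  proof (rule measure_changes_closed[OF fin_M])
    show "sector x \<in> sets M" for x unfolding sets_M using sub by simp
    show "hd (ys @ [hd ys]) = last (ys @ [hd ys])" using ys(2) by simp
  next
    fix v assume "v \<in> space M"
    then have v: "v \<noteq> 0" "norm v \<le> 1" by (auto simp: space_M B_def)
    then show "\<exists>x\<in>set (ys @ [hd ys]). v \<in> sector x"
      using sees_sgn[OF v(1)] unfolding sector_iff_sees by blast
    \<comment> \<open>The vertex that sees the opposite direction is the one that misses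
      \<open>v\<close>.\<close>
    obtain x where x: "x \<in> set (ys @ [hd ys])" "sgn (- v) \<in> sees x" using sees_sgn[of "- v"] v by auto
    have "v \<notin> sector x"
    proof
      assume "v \<in> sector x"
      then have "sgn v \<in> sees x" by (simp add: sector_iff_sees)
      then show False using x(2) by (simp add: sees_def sgn_minus)
    qed
    then show "\<exists>x\<in>set (ys @ [hd ys]). v \<notin> sector x" using x(1) by blast
  qed
  moreover have "(\<lambda>x y. measure M (sym_diff (sector x) (sector y))) = sector_dist"
  proof (intro ext)
    fix x y
    have "sym_diff (sector x) (sector y) \<subseteq> B" using sub by blast
    then show "measure M (sym_diff (sector x) (sector y)) = sector_dist x y"
      unfolding sector_dist_def by (simp add: meas_M)
  qed
  moreover have "measure M (space M) = 4 * pi / 3"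
  proof -
    have "B = cball 0 1 - {0}" "emeasure lborel {0 :: real^3} = 0" by (simp_all add: B_def)
    then have "emeasure lborel B = emeasure lborel (cball (0 :: real^3) 1)"
      by (simp add: emeasure_Diff_null_set null_sets_def)
    then have "measure lborel B = measure lborel (cball (0 :: real^3) 1)" by (simp add: measure_def)
    then show ?thesis
      unfolding space_M using meas_M[of B] content_cball[of 1 "0 :: real^3"] by (simp add: unit_ball_vol_3)
  qed
  moreover have "edge_sum sector_dist (ys @ [hd ys]) \<le> edge_sum (\<lambda>x y. E / 3 * dist x y) (ys @ [hd ys])"
  proof (rule edge_sum_mono)
    have "sector_dist x y \<le> E / 3 * dist x y" if "unnested x y" for x y
      using sector_dist_unnested[OF that] by (simp add: E_def)
    then show "successively (\<lambda>x y. sector_dist x y \<le> E / 3 * dist x y) (ys @ [hd ys])"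
      by (intro successively_set_cong[OF ys(3)])
  qed
  ultimately have "8 * pi \<le> E * edge_sum dist (ys @ [hd ys])"
    unfolding edge_sum_mult by (simp add: E_def)
  \<comment> \<open>Twice the area of the unit sphere, measured against the rate
    \<open>E\<close>.\<close>
  moreover have "8 * pi = E * (6 * sqrt 3)" by (simp add: E_def)
  ultimately have "6 * sqrt 3 \<le> edge_sum dist (ys @ [hd ys])" using E by simp
  then show ?thesis using ys(4) by simp
qed

section \<open>From curves to polygons\<close>

lemma edge_sum_map_upt: "edge_sum f (map z [0..<Suc n]) = (\<Sum>i<n. f (z i) (z (Suc i)))"
proof (induction n)
  case (Suc n)
  have "map z [0..<Suc (Suc n)] = map z [0..<n] @ z n # [z (Suc n)]" by simp
  moreover have "map z [0..<Suc n] = map z [0..<n] @ [z n]" by simp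
  ultimately show ?case
    using edge_sum_append[of f "map z [0..<n]" "z n" "[z (Suc n)]"] Suc by simp
qed simp

lemma polyline_length_diff_divide:
  fixes x :: "nat \<Rightarrow> 'a::euclidean_space"
  assumes "0 < R"
  shows "polyline_length (\<lambda>i. (x i - c) /\<^sub>R R) n = polyline_length x n / R"
proof -
  have "dist ((p - c) /\<^sub>R R) ((q - c) /\<^sub>R R) = dist p q / R" for p q :: 'a
    using assms by (simp add: dist_norm divide_inverse_commute flip: scaleR_diff_right)
  then show ?thesis by (simp add: polyline_length_def sum_divide_distrib)
qed

lemma polygon_approximation:
  fixes \<gamma> :: "real \<Rightarrow> 'a::metric_space"
  assumes "rectifiable_curve \<gamma> a b" "0 < e"
  obtains x n where "x 0 = \<gamma> a" "x n = \<gamma> b"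
    "\<And>s. s \<in> {a..b} \<Longrightarrow> \<exists>i\<le>n. dist (\<gamma> s) (x i) < e" "polyline_length x n \<le> curve_length \<gamma> a b"
proof -
  have "a < b" and cont: "continuous_on {a..b} \<gamma>" and bdd: "bdd_above (polygon_sums \<gamma> a b)"
    using assms(1) by (auto simp: rectifiable_curve_def)
  have "uniformly_continuous_on {a..b} \<gamma>" using cont by (simp add: compact_uniformly_continuous)
  then obtain d where "0 < d" and d: "\<And>s s'. \<lbrakk>s \<in> {a..b}; s' \<in> {a..b}; dist s' s < d\<rbrakk> \<Longrightarrow> dist (\<gamma> s') (\<gamma> s) < e"
    using \<open>0 < e\<close> unfolding uniformly_continuous_on_def by metis
  obtain n :: nat where n: "(b - a) / d < real n" using reals_Archimedean2 by blast
  have "0 < real n" using \<open>a < b\<close> \<open>0 < d\<close> n by (smt (verit) divide_pos_pos)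
  define h where "h = (b - a) / n"
  have h: "0 < h" "h < d" "n * h = b - a"
    using n \<open>0 < d\<close> \<open>0 < real n\<close> \<open>a < b\<close> by (simp_all add: h_def field_simps)
  define t where "t i = a + real i * h" for i
  have t: "t i \<in> {a..b}" if "i \<le> n" for i
  proof -
    have "real i * h \<le> n * h" using that h(1) by (intro mult_right_mono) auto
    then show ?thesis using h by (simp add: t_def)
  qed
  show ?thesis
  proof (rule that[of "\<gamma> \<circ> t" n])
    show "(\<gamma> \<circ> t) 0 = \<gamma> a" by (simp add: t_def)
    show "(\<gamma> \<circ> t) n = \<gamma> b" using h(3) by (simp add: t_def)
    show "\<exists>i\<le>n. dist (\<gamma> s) ((\<gamma> \<circ> t) i) < e" if s: "s \<in> {a..b}" for s
    proof (intro exI conjI)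
      define i where "i = nat \<lfloor>(s - a) / h\<rfloor>"
      have "real i = of_int \<lfloor>(s - a) / h\<rfloor>" using s h(1) by (simp add: i_def)
      then have "real i \<le> (s - a) / h" "(s - a) / h < real i + 1" by linarith+
      then have i: "real i * h \<le> s - a" "s - a < real i * h + h" using h(1) by (simp_all add: field_simps)
      have "real i * h \<le> n * h" using i(1) s h(3) by simp
      then show "i \<le> n" using h(1) by simp
      have "dist s (t i) < d" using i h by (simp add: t_def dist_real_def)
      then show "dist (\<gamma> s) ((\<gamma> \<circ> t) i) < e" using d[OF t[OF \<open>i \<le> n\<close>] s] by simp
    qed
    have "t 0 = a" "t n = b" "\<forall>i<n. t i \<le> t (Suc i)" using h by (simp_all add: t_def distrib_right)
    then have "polyline_length (\<gamma> \<circ> t) n \<in> polygon_sums \<gamma> a b"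
      unfolding polygon_sums_def polyline_length_def comp_def by blast
    then show "polyline_length (\<gamma> \<circ> t) n \<le> curve_length \<gamma> a b"
      unfolding curve_length_def using bdd by (rule cSup_upper)
  qed
qed

lemma rectifiable_length_nonneg:
  fixes \<gamma> :: "real \<Rightarrow> 'a::metric_space"
  assumes "rectifiable_curve \<gamma> a b"
  shows "0 \<le> curve_length \<gamma> a b"
proof -
  obtain x :: "nat \<Rightarrow> 'a" and n where "polyline_length x n \<le> curve_length \<gamma> a b"
    by (rule polygon_approximation[OF assms zero_less_one]) blast
  then show ?thesis using polyline_length_nonneg[of x n] by simp
qed

lemma polygon_breadth:
  fixes \<gamma> :: "real \<Rightarrow> 'a::euclidean_space"
  assumes rect: "rectifiable_curve \<gamma> a b" and W: "W < curve_width \<gamma> a b"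
  obtains x n where "has_breadth UNIV x n W" "x 0 = \<gamma> a" "x n = \<gamma> b"
    "polyline_length x n \<le> curve_length \<gamma> a b"
proof -
  \<comment> \<open>Both extremal points of the curve are replaced by vertices closer than
    \<open>e\<close>, which costs at most \<open>2 * e\<close>, the available gap.\<close>
  define e where "e = (curve_width \<gamma> a b - W) / 2"
  have "0 < e" using W by (simp add: e_def)
  then obtain x n where x: "x 0 = \<gamma> a" "x n = \<gamma> b" "polyline_length x n \<le> curve_length \<gamma> a b"
    and near: "\<And>s. s \<in> {a..b} \<Longrightarrow> \<exists>i\<le>n. dist (\<gamma> s) (x i) < e"
    by (rule polygon_approximation[OF rect]) auto
  have ab: "a < b" and cont: "continuous_on {a..b} \<gamma>" using rect by (auto simp: rectifiable_curve_def)
  have "has_breadth UNIV x n W"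
    unfolding has_breadth_def
  proof (intro ballI impI)
    fix u :: 'a
    assume u: "norm u = 1"
    have cu: "continuous_on {a..b} (\<lambda>s. u \<bullet> \<gamma> s)" by (intro continuous_intros cont)
    obtain p where p: "p \<in> {a..b}" "\<And>s. s \<in> {a..b} \<Longrightarrow> u \<bullet> \<gamma> s \<le> u \<bullet> \<gamma> p"
      using continuous_attains_sup[OF _ _ cu] ab by auto
    obtain q where q: "q \<in> {a..b}" "\<And>s. s \<in> {a..b} \<Longrightarrow> u \<bullet> \<gamma> q \<le> u \<bullet> \<gamma> s"
      using continuous_attains_inf[OF _ _ cu] ab by auto
    have "curve_width \<gamma> a b \<le> u \<bullet> \<gamma> p - u \<bullet> \<gamma> q"
      unfolding curve_width_def
    proof (rule cInf_lower)
      show "u \<bullet> \<gamma> p - u \<bullet> \<gamma> q \<in> {c2 - c1 |u c1 c2. norm u = 1 \<and> (\<forall>t\<in>{a..b}. c1 \<le> u \<bullet> \<gamma> t \<and> u \<bullet> \<gamma> t \<le> c2)}"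
        using u p q by blast
      show "bdd_below {c2 - c1 |u c1 c2. norm u = 1 \<and> (\<forall>t\<in>{a..b}. c1 \<le> u \<bullet> \<gamma> t \<and> u \<bullet> \<gamma> t \<le> c2)}"
        using ab by (intro bdd_belowI[of _ 0]) force
    qed
    moreover obtain i where i: "i \<le> n" "dist (\<gamma> p) (x i) < e" using near p(1) by blast
    moreover obtain j where j: "j \<le> n" "dist (\<gamma> q) (x j) < e" using near q(1) by blast
    moreover have "u \<bullet> (\<gamma> p - x i) \<le> dist (\<gamma> p) (x i)" "u \<bullet> (x j - \<gamma> q) \<le> dist (\<gamma> q) (x j)"
      using norm_cauchy_schwarz[of u "\<gamma> p - x i"] norm_cauchy_schwarz[of u "x j - \<gamma> q"] u
      by (simp_all add: dist_norm norm_minus_commute)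
    ultimately have "W \<le> u \<bullet> (x i - x j)"
      unfolding e_def inner_diff_right by argo
    then show "\<exists>i\<le>n. \<exists>j\<le>n. W \<le> u \<bullet> (x i - x j)" using i(1) j(1) by blast
  qed
  then show ?thesis using that x by blast
qed

text \<open>Otherwise a half-space bounds \<open>X\<close>, hence its convex hull, but the point
  \<open>c + \<rho> *\<^sub>R v\<close> of the sphere lies beyond it.\<close>

lemma sphere_in_hull_support:
  fixes X :: "'a::euclidean_space set"
  assumes sub: "sphere c \<rho> \<subseteq> convex hull X" and "0 < \<rho>" "norm v = 1" and R: "R < \<rho>"
  shows "\<exists>p\<in>X. R < v \<bullet> (p - c)"
proof (rule ccontr)
  assume "\<not> (\<exists>p\<in>X. R < v \<bullet> (p - c))"
  then have "X \<subseteq> {p. v \<bullet> p \<le> v \<bullet> c + R}" by (force simp: inner_diff_right)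
  then have "convex hull X \<subseteq> {p. v \<bullet> p \<le> v \<bullet> c + R}" by (intro hull_minimal convex_halfspace_le)
  moreover have "c + \<rho> *\<^sub>R v \<in> sphere c \<rho>" using \<open>0 < \<rho>\<close> \<open>norm v = 1\<close> by (simp add: dist_norm)
  ultimately have "v \<bullet> (c + \<rho> *\<^sub>R v) \<le> v \<bullet> c + R" using sub by blast
  then show False using \<open>norm v = 1\<close> R by (simp add: inner_add_right dot_square_norm)
qed

lemma polygon_inradius:
  fixes \<gamma> :: "real \<Rightarrow> 'a::euclidean_space"
  assumes rect: "rectifiable_curve \<gamma> a b" and R: "0 < R" "R < curve_inradius \<gamma> a b"
  obtains y :: "nat \<Rightarrow> 'a" and n where "\<And>v. norm v = 1 \<Longrightarrow> \<exists>i\<le>n. 1 \<le> v \<bullet> y i" "\<gamma> a = \<gamma> b \<Longrightarrow> y n = y 0"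
    "R * polyline_length y n \<le> curve_length \<gamma> a b"
proof -
  let ?S = "{0} \<union> {\<rho>. \<rho> > 0 \<and> (\<exists>x. sphere x \<rho> \<subseteq> convex hull (\<gamma> ` {a..b}) \<and> sphere x \<rho> \<inter> \<gamma> ` {a..b} = {})}"
  have "\<exists>\<rho>\<in>?S. R < \<rho>"
  proof (rule ccontr)
    assume "\<not> ?thesis"
    then have "Sup ?S \<le> R" by (intro cSup_least) force+
    then show False using R(2) by (simp add: curve_inradius_def)
  qed
  then obtain \<rho> c where \<rho>: "0 < \<rho>" "R < \<rho>" "sphere c \<rho> \<subseteq> convex hull (\<gamma> ` {a..b})" using R(1) by auto
  define e where "e = (\<rho> - R) / 2"
  have e: "0 < e" "R + e < \<rho>" using \<rho>(2) by (simp_all add: e_def field_simps)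
  obtain x n where x: "x 0 = \<gamma> a" "x n = \<gamma> b" "polyline_length x n \<le> curve_length \<gamma> a b"
    and near: "\<And>s. s \<in> {a..b} \<Longrightarrow> \<exists>i\<le>n. dist (\<gamma> s) (x i) < e"
    using e(1) by (rule polygon_approximation[OF rect]) auto
  \<comment> \<open>The centre is moved to the origin and \<open>R\<close> is scaled to 1; the slack
    between \<open>R\<close> and \<open>\<rho>\<close> absorbs the distance from the curve to the
    vertices.\<close>
  show ?thesis
  proof (rule that[of n "\<lambda>i. (x i - c) /\<^sub>R R"])
    fix v :: 'a
    assume v: "norm v = 1"
    obtain s where s: "s \<in> {a..b}" "R + e < v \<bullet> (\<gamma> s - c)"
      using sphere_in_hull_support[OF \<rho>(3,1) v e(2)] by blast
    obtain i where i: "i \<le> n" "dist (\<gamma> s) (x i) < e" using near s(1) by blast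
    have "v \<bullet> (\<gamma> s - x i) \<le> dist (\<gamma> s) (x i)"
      using norm_cauchy_schwarz[of v "\<gamma> s - x i"] v by (simp add: dist_norm)
    then have "R \<le> v \<bullet> (x i - c)" using s(2) i(2) unfolding inner_diff_right by linarith
    then have "1 \<le> v \<bullet> ((x i - c) /\<^sub>R R)"
      using R(1) unfolding inner_scaleR_right by (simp add: divide_inverse_commute[symmetric])
    then show "\<exists>i\<le>n. 1 \<le> v \<bullet> ((x i - c) /\<^sub>R R)" using i(1) by blast
  next
    show "R * polyline_length (\<lambda>i. (x i - c) /\<^sub>R R) n \<le> curve_length \<gamma> a b"
      using x(3) R(1) by (simp add: polyline_length_diff_divide)
  qed (simp add: x)
qed

lemma has_breadth_2I:
  fixes y :: "nat \<Rightarrow> 'a::euclidean_space"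
  assumes "\<And>v. norm v = 1 \<Longrightarrow> \<exists>i\<le>n. 1 \<le> v \<bullet> y i"
  shows "has_breadth UNIV y n 2"
  unfolding has_breadth_def
proof (intro ballI impI)
  fix u :: 'a
  assume "norm u = 1"
  then obtain i j where "i \<le> n" "1 \<le> u \<bullet> y i" "j \<le> n" "1 \<le> (- u) \<bullet> y j"
    using assms[of u] assms[of "- u"] by auto
  then have "2 \<le> u \<bullet> (y i - y j)" by (simp add: inner_diff_right)
  then show "\<exists>i\<le>n. \<exists>j\<le>n. 2 \<le> u \<bullet> (y i - y j)" using \<open>i \<le> n\<close> \<open>j \<le> n\<close> by blast
qed

lemma sqrt_mult_le:
  fixes p L s r q c :: real
  assumes "(c * r)\<^sup>2 * q + p\<^sup>2 \<le> L\<^sup>2" "s * r \<le> p" "0 \<le> s" "0 \<le> r" "0 \<le> L"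
  shows "sqrt (s\<^sup>2 + c\<^sup>2 * q) * r \<le> L"
proof -
  have "(s * r)\<^sup>2 \<le> p\<^sup>2" using assms(2-4) by (intro power_mono) auto
  then have "(s\<^sup>2 + c\<^sup>2 * q) * r\<^sup>2 \<le> L\<^sup>2"
    using assms(1) by (simp add: power_mult_distrib algebra_simps)
  then have "sqrt ((s\<^sup>2 + c\<^sup>2 * q) * r\<^sup>2) \<le> sqrt (L\<^sup>2)" by (rule real_sqrt_le_mono)
  then show ?thesis using assms(4,5) by (simp add: real_sqrt_mult)
qed

text \<open>Polygons only reach values strictly below the width or inradius; the bound for the curve
  itself is the limit from the left.\<close>

lemma le_of_less_approx:
  fixes C w L :: real
  assumes approx: "\<And>W. \<lbrakk>0 < W; W < w\<rbrakk> \<Longrightarrow> C * W \<le> L" and "0 \<le> L" "0 \<le> C"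
  shows "C * w \<le> L"
proof (cases "0 < w")
  case True
  show ?thesis
  proof (rule tendsto_upperbound)
    show "((\<lambda>W. C * W) \<longlongrightarrow> C * w) (at_left w)" by (intro tendsto_intros)
    show "\<forall>\<^sub>F W in at_left w. C * W \<le> L"
      using eventually_at_left_real[OF True] by (rule eventually_mono) (use approx in auto)
  qed simp
next
  case False
  then show ?thesis using assms(2,3) by (smt (verit) mult_nonneg_nonpos)
qed

text \<open>\<open>c\<close> counts how often the breadth is traversed in each removed dimension and
  \<open>s\<close> is the planar constant, so that open and closed curves share one proof.\<close>

lemma width_bound:
  fixes \<gamma> :: "real \<Rightarrow> 'a::euclidean_space"
  assumes rect: "rectifiable_curve \<gamma> a b" and dim: "DIM('a) = 2 + k"
    and "c = 3 \<and> s = 2.2782 \<or> c = 4 \<and> s = pi \<and> \<gamma> a = \<gamma> b"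
  shows "sqrt (s\<^sup>2 + c\<^sup>2 * real k) * curve_width \<gamma> a b \<le> curve_length \<gamma> a b"
proof (rule le_of_less_approx)
  fix W
  assume W: "0 < W" "W < curve_width \<gamma> a b"
  obtain x n where x: "has_breadth UNIV x n W" "x 0 = \<gamma> a" "x n = \<gamma> b"
      "polyline_length x n \<le> curve_length \<gamma> a b"
    by (rule polygon_breadth[OF rect W(2)])
  have c: "c = 3 \<or> c = 4 \<and> x n = x 0" using assms(3) x(2,3) by auto
  have dim': "DIM('a) = DIM(complex) + k" "2 \<le> DIM(complex)" using dim by simp_all
  obtain z :: "nat \<Rightarrow> complex" and h :: "complex \<Rightarrow> 'a" where h: "\<And>v. norm (h v) = norm v"
      "\<And>v i. v \<bullet> z i = h v \<bullet> x i" "x n = x 0 \<Longrightarrow> z n = z 0"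
      "(c * W)\<^sup>2 * real k + (polyline_length z n)\<^sup>2 \<le> (polyline_length x n)\<^sup>2"
    by (rule has_breadth_reduce_dimension[OF dim' x(1) less_imp_le[OF W(1)] c]) (rule that)
  have z: "has_breadth UNIV z n W"
    using x(1) h(1,2) unfolding has_breadth_def inner_diff_right by simp
  have "s * W \<le> polyline_length z n"
    using planar_breadth_closed[OF z] planar_breadth_open[OF z less_imp_le[OF W(1)]] assms(3) h(3) x(2,3) by fastforce
  with h(4) have "sqrt (s\<^sup>2 + c\<^sup>2 * real k) * W \<le> polyline_length x n"
    using W(1) assms(3) by (intro sqrt_mult_le) (auto simp: polyline_length_nonneg)
  then show "sqrt (s\<^sup>2 + c\<^sup>2 * real k) * W \<le> curve_length \<gamma> a b" using x(4) by simp
qed (use rectifiable_length_nonneg[OF rect] in auto)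

text \<open>After scaling, the breadth is that of the unit ball, namely 2; hence the factor
  \<open>2 * c\<close>. The base space \<open>'b\<close> is a parameter: the plane for arbitrary
  curves, three-space for closed ones.\<close>

lemma inradius_bound:
  fixes \<gamma> :: "real \<Rightarrow> 'a::euclidean_space"
  assumes rect: "rectifiable_curve \<gamma> a b" and dim: "DIM('a) = DIM('b::euclidean_space) + k" "2 \<le> DIM('b)"
    and c: "c = 3 \<or> c = 4 \<and> \<gamma> a = \<gamma> b" and "0 \<le> s"
    and reduced: "\<And>(z :: nat \<Rightarrow> 'b) n. covering (map z [0..<Suc n]) \<Longrightarrow> (c = 4 \<Longrightarrow> z n = z 0) \<Longrightarrow> s \<le> polyline_length z n"
  shows "sqrt (s\<^sup>2 + (2 * c)\<^sup>2 * real k) * curve_inradius \<gamma> a b \<le> curve_length \<gamma> a b"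
proof (rule le_of_less_approx)
  fix R
  assume R: "0 < R" "R < curve_inradius \<gamma> a b"
  obtain y :: "nat \<Rightarrow> 'a" and n where y: "\<And>v. norm v = 1 \<Longrightarrow> \<exists>i\<le>n. 1 \<le> v \<bullet> y i" "\<gamma> a = \<gamma> b \<Longrightarrow> y n = y 0"
      "R * polyline_length y n \<le> curve_length \<gamma> a b"
    by (rule polygon_inradius[OF rect R]) (rule that)
  have c': "c = 3 \<or> c = 4 \<and> y n = y 0" using c y(2) by auto
  have breadth: "has_breadth UNIV y n 2" using y(1) by (rule has_breadth_2I)
  obtain z :: "nat \<Rightarrow> 'b" and h :: "'b \<Rightarrow> 'a" where h: "\<And>v. norm (h v) = norm v"
      "\<And>v i. v \<bullet> z i = h v \<bullet> y i" "y n = y 0 \<Longrightarrow> z n = z 0"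
      "(c * 2)\<^sup>2 * real k + (polyline_length z n)\<^sup>2 \<le> (polyline_length y n)\<^sup>2"
    by (rule has_breadth_reduce_dimension[OF dim breadth zero_le_numeral c']) (rule that)
  have "covering (map z [0..<Suc n])"
    unfolding covering_def
  proof (intro allI impI)
    fix u :: 'b
    assume "norm u = 1"
    then obtain i where "i \<le> n" "1 \<le> h u \<bullet> y i" using y(1)[of "h u"] h(1) by auto
    then have "z i \<in> set (map z [0..<Suc n])" "u \<in> sees (z i)"
      using \<open>norm u = 1\<close> by (auto simp: sees_def h(2) simp del: upt_Suc)
    then show "\<exists>x\<in>set (map z [0..<Suc n]). u \<in> sees x" by blast
  qed
  then have "s \<le> polyline_length z n" by (rule reduced) (use c' h(3) in auto)
  with h(4) have "sqrt (s\<^sup>2 + (2 * c)\<^sup>2 * real k) * 1 \<le> polyline_length y n"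
    using \<open>0 \<le> s\<close> by (intro sqrt_mult_le) (auto simp: polyline_length_nonneg mult.commute)
  then have "R * sqrt (s\<^sup>2 + (2 * c)\<^sup>2 * real k) \<le> R * polyline_length y n" using R(1) by simp
  then show "sqrt (s\<^sup>2 + (2 * c)\<^sup>2 * real k) * R \<le> curve_length \<gamma> a b" using y(3) by (simp add: mult.commute)
qed (use rectifiable_length_nonneg[OF rect] in auto)

theorem theorem8p5:
  fixes \<gamma> :: "real \<Rightarrow> real ^ 'n" and a b :: real and k :: nat
  assumes "k \<ge> 1" and "CARD('n) = 2 + k"
    and "rectifiable_curve \<gamma> a b"
  shows "curve_length \<gamma> a b \<ge> sqrt (2.2782\<^sup>2 + 9 * real k) * curve_width \<gamma> a b
      \<and> curve_length \<gamma> a b \<ge> sqrt ((pi + 2)\<^sup>2 + 36 * real k) * curve_inradius \<gamma> a b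
      \<and> (\<gamma> a = \<gamma> b \<longrightarrow>
            curve_length \<gamma> a b \<ge> sqrt (pi\<^sup>2 + 16 * real k) * curve_width \<gamma> a b
          \<and> curve_length \<gamma> a b \<ge> sqrt ((6 * sqrt 3)\<^sup>2 + 64 * (real k - 1)) * curve_inradius \<gamma> a b)"
proof (intro conjI impI)
  have dim: "DIM(real ^ 'n) = 2 + k" using assms(2) by simp
  note rect = assms(3)
  show "sqrt (2.2782\<^sup>2 + 9 * real k) * curve_width \<gamma> a b \<le> curve_length \<gamma> a b"
    using width_bound[OF rect dim, of 3 "2.2782"] by simp
  have open_bound: "pi + 2 \<le> polyline_length z n" if "covering (map z [0..<Suc n])" for z :: "nat \<Rightarrow> complex" and n
    using planar_inradius_open[OF that] unfolding edge_sum_map_upt polyline_length_def by simp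
  have "DIM(real ^ 'n) = DIM(complex) + k" "2 \<le> DIM(complex)" using dim by simp_all
  from inradius_bound[OF rect this, of 3 "pi + 2"] open_bound
  show "sqrt ((pi + 2)\<^sup>2 + 36 * real k) * curve_inradius \<gamma> a b \<le> curve_length \<gamma> a b"
    using pi_ge_zero by simp
  assume closed: "\<gamma> a = \<gamma> b"
  show "sqrt (pi\<^sup>2 + 16 * real k) * curve_width \<gamma> a b \<le> curve_length \<gamma> a b"
    using width_bound[OF rect dim, of 4 pi] closed by simp
  have closed_bound: "6 * sqrt 3 \<le> polyline_length z n"
    if z: "covering (map z [0..<Suc n])" "z n = z 0" for z :: "nat \<Rightarrow> real^3" and n
  proof -
    \<comment> \<open>A closed polygon lists its first vertex twice, while the closed bound appends
      the head itself, so the last entry is dropped. A polygon without edges keeps its only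
      vertex.\<close>
    have "\<exists>xs. xs \<noteq> [] \<and> set xs = set (map z [0..<Suc n]) \<and> edge_sum dist (xs @ [hd xs]) = edge_sum dist (map z [0..<Suc n])"
    proof (cases n)
      case 0
      then show ?thesis by (intro exI[of _ "[z 0]"]) simp
    next
      case (Suc m)
      have split: "map z [0..<Suc n] = map z [0..<n] @ [z 0]" using z(2) by simp
      have "hd (map z [0..<n]) = z 0" "z 0 \<in> set (map z [0..<n])" using Suc by (simp_all add: hd_map del: upt_Suc)
      then show ?thesis
        unfolding split using Suc by (intro exI[of _ "map z [0..<n]"]) (auto simp del: upt_Suc)
    qed
    then obtain xs where xs: "xs \<noteq> []" "set xs = set (map z [0..<Suc n])"
        "edge_sum dist (xs @ [hd xs]) = edge_sum dist (map z [0..<Suc n])" by blast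
    have "covering xs" using z(1) unfolding covering_def xs(2) .
    from spatial_inradius_closed[OF this xs(1)] show ?thesis
      unfolding xs(3) edge_sum_map_upt polyline_length_def .
  qed
  \<comment> \<open>The reduction stops in three-space, so one dimension fewer is removed;
    \<open>1 \<le> k\<close> makes the natural subtraction exact.\<close>
  have "DIM(real ^ 'n) = DIM(real^3) + (k - 1)" "2 \<le> DIM(real^3)" using dim assms(1) by simp_all
  from inradius_bound[OF rect this, of 4 "6 * sqrt 3"] closed_bound closed
  show "sqrt ((6 * sqrt 3)\<^sup>2 + 64 * (real k - 1)) * curve_inradius \<gamma> a b \<le> curve_length \<gamma> a b"
    using assms(1) by (simp add: of_nat_diff)
qed

end
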